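(* Let $n_r\ge n\ge 1$ and let $\{H_i\}$ be a random process with values in $M_{n_r\times n}(\mathbb{C})$ which is ergodic, stationary and isotropically invariant, and let $H$ denote a random matrix with the common distribution of the $H_i$. Suppose that $\mathbb{E}\left[|\log\det H^\dagger H|\right]<\infty$. Let $L_{n,k}\subset M_{n\times nk}(\mathbb{C})$ be a family of $2n^2k$-dimensional lattices (with $k\to\infty$) such that, for some constant $C_L>0$ independent of $k$, $\det_{\min}(L_{n,k})=1$ and $\mathrm{Vol}(L_{n,k})^{\frac1{n^2k}}\le C_L$. Then, for power constraint $P>0$, any rate $$R<\mathbb{E}_H\left[\log\det\frac Pn H^\dagger H\right]-n\log C_L+n\log\frac{\pi e}{4n}$$ is achievable over the $(n,n_r,k)$-multiblock channel with fading $\{H_i\}$ using the codes built from $L_{n,k}$, both with maximum likelihood decoding and with naive lattice decoding.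
   Context: $\log$ is the base-2 logarithm. $\|\cdot\|$ is the Frobenius norm. Process: $\{H_i\}_{i\in\mathcal I}$, $\mathcal I=\mathbb{Z}$ or $\mathbb{N}$, is stationary if for all $t$ and all $i_1,\dots,i_k$ the joint law of $(H_{i_1+t},\dots,H_{i_k+t})$ equals that of $(H_{i_1},\dots,H_{i_k})$; it is ergodic if every Borel set $A$ of sequences with $T^{-1}(A)=A$, $T$ the shift $\{x_i\}\mapsto\{x_{i+1}\}$, has probability $0$ or $1$ under the law of the process. It is isotropically invariant if the distribution of $H$ is invariant under right multiplication by unitary matrices. Channel: in the $(n,n_r,k)$-multiblock channel a codeword $X=(X_1,\dots,X_k)\in M_{n\times nk}(\mathbb{C})$, $X_i\in M_n(\mathbb{C})$, is received as $Y_i=H_iX_i+W_i$, $i=1,\dots,k$, where the entries of the $W_i\in M_{n_r\times n}(\mathbb{C})$ are i.i.d. circularly symmetric complex Gaussian with mean $0$ and variance $1$ per complex dimension, independent of the $H_i$ and of $X$. The receiver (not the transmitter) knows $H_1,\dots,H_k$ and decodes after all $k$ blocks. Lattices: $M_{n\times nk}(\mathbb{C})$ is a $2n^2k$-dimensional real space with inner product $\langle X,Y\rangle=\Re(\mathrm{Tr}(XY^\dagger))$. A lattice is the $\mathbb{Z}$-span of $\mathbb{R}$-linearly independent matrices; its dimension is the number of these; $\mathrm{Vol}(L)$ is the square root of the determinant of the Gram matrix of a basis. For $X=(X_1,\dots,X_k)$ put $\mathrm{pdet}(X)=\prod_{i=1}^k\det(X_i)$ and $\det_{\min}(L)=\inf_{X\in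 L\setminus\{0\}}|\mathrm{pdet}(X)|$. The index $k$ ranges over some infinite set of positive integers. Codes: given $P>0$ and a rate $R$, let $C_{n,k}=\frac{(\pi nk)^{n^2k}}{(n^2k)!}$ and $\alpha>0$ be given by $\alpha^2=\frac{C_{n,k}^{1/(n^2k)}P}{2^{R/n}\mathrm{Vol}(L_{n,k})^{1/(n^2k)}}$. Let $B(r)$ be the set of matrices in $M_{n\times nk}(\mathbb{C})$ of Frobenius norm at most $r$. The code is $\mathcal{C}=B(\sqrt{Pkn})\cap(X_R+\alpha L_{n,k})$, where the shift $X_R\in M_{n\times nk}(\mathbb{C})$ is chosen so that $|\mathcal{C}|\ge 2^{Rnk}$ (such a shift exists). Thus every codeword satisfies $\frac1{nk}\|X\|^2\le P$, and the rate is at least $R$ bits per complex channel use. Decoding: maximum likelihood decoding outputs a minimizer of $\sum_{i=1}^k\|Y_i-H_iX_i'\|^2$ over $X'\in\mathcal{C}$; naive lattice decoding minimizes the same quantity over the whole infinite shifted lattice $X_R+\alpha L_{n,k}$. $P_e$ is the probability that the output differs from the transmitted codeword (uniform in $\mathcal{C}$). A rate $R$ is achievable if $P_e\to0$ as $k\to\infty$. *)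

theory Defs
  imports "HOL-Probability.Probability" "Jordan_Normal_Form.Determinant"
begin

no_notation Matrix.vec_index (infixl "$" 100)

section \<open>Complex matrices of fixed size\<close>

text \<open>
  An $m \times n$ complex matrix has type \<open>complex ^ 'n ^ 'm\<close>.  The library norm on this type is
  the Frobenius norm.
\<close>

definition cadj :: "complex ^ 'n ^ 'm \<Rightarrow> complex ^ 'm ^ 'n" where
  "cadj A = (\<chi> i j. cnj (A $ j $ i))"

definition unitary_matrix :: "complex ^ 'n ^ 'n \<Rightarrow> bool" where
  "unitary_matrix U \<longleftrightarrow>
     cadj U ** U = Finite_Cartesian_Product.mat 1 \<and> U ** cadj U = Finite_Cartesian_Product.mat 1"

text \<open>$\det(H^\dagger H)$ is a nonnegative real number.\<close>

definition gram_det :: "real \<Rightarrow> complex ^ 'n ^ 'm \<Rightarrow> real" where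
  "gram_det c A = Re (Determinants.det (c *\<^sub>R (cadj A ** A)))"

text \<open>
  $|\log x|$ with the convention $\log 0 = -\infty$, so that finiteness of
  $E[|\log\det H^\dagger H|]$ forces $\det H^\dagger H > 0$ almost surely.  The library's total
  function has \<open>log 2 0 = 0\<close> instead.
\<close>

definition abs_log2 :: "real \<Rightarrow> ennreal" where
  "abs_log2 x = (if x > 0 then ennreal \<bar>log 2 x\<bar> else \<infinity>)"

section \<open>Random processes\<close>

text \<open>
  Processes are indexed by a set \<open>I\<close> of integers.  As \<open>I\<close> is countable, for values in a second
  countable space the product \<open>\<sigma>\<close>-algebra on sequences is the Borel \<open>\<sigma>\<close>-algebra.
\<close>

definition stationary_process ::
    "'a measure \<Rightarrow> int set \<Rightarrow> (int \<Rightarrow> 'a \<Rightarrow> 'b::topological_space) \<Rightarrow> bool" where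
  "stationary_process M I X \<longleftrightarrow>
     (\<forall>(m::nat) (i :: nat \<Rightarrow> int) (t::int). (\<forall>j<m. i j \<in> I \<and> i j + t \<in> I) \<longrightarrow>
        distr M (\<Pi>\<^sub>M j\<in>{..<m}. borel) (\<lambda>\<omega>. \<lambda>j\<in>{..<m}. X (i j + t) \<omega>) =
        distr M (\<Pi>\<^sub>M j\<in>{..<m}. borel) (\<lambda>\<omega>. \<lambda>j\<in>{..<m}. X (i j) \<omega>))"

definition seq_shift :: "int set \<Rightarrow> (int \<Rightarrow> 'b) \<Rightarrow> int \<Rightarrow> 'b" where
  "seq_shift I x = (\<lambda>i\<in>I. x (i + 1))"

definition ergodic_process ::
    "'a measure \<Rightarrow> int set \<Rightarrow> (int \<Rightarrow> 'a \<Rightarrow> 'b::topological_space) \<Rightarrow> bool" where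
  "ergodic_process M I X \<longleftrightarrow>
     (\<forall>A \<in> sets (\<Pi>\<^sub>M i\<in>I. (borel :: 'b measure)).
        seq_shift I -` A \<inter> space (\<Pi>\<^sub>M i\<in>I. (borel :: 'b measure)) = A \<longrightarrow>
        measure (distr M (\<Pi>\<^sub>M i\<in>I. borel) (\<lambda>\<omega>. \<lambda>i\<in>I. X i \<omega>)) A \<in> {0, 1})"

definition isotropic_process ::
    "'a measure \<Rightarrow> int set \<Rightarrow> (int \<Rightarrow> 'a \<Rightarrow> complex ^ 'n ^ 'r) \<Rightarrow> bool" where
  "isotropic_process M I H \<longleftrightarrow>
     (\<forall>i\<in>I. \<forall>U. unitary_matrix U \<longrightarrow>
        distr M borel (\<lambda>\<omega>. H i \<omega> ** U) = distr M borel (H i))"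

section \<open>Multiblock words and lattices\<close>

text \<open>
  A matrix $X = (X_1,\dots,X_k) \in M_{n\times nk}(\mathbb{C})$ is represented by the sequence of its
  blocks, which is zero outside \<open>{1..k}\<close>; the number \<open>k\<close> of blocks varies, hence cannot be a type.
\<close>

type_synonym 'n word = "nat \<Rightarrow> complex ^ 'n ^ 'n"

definition words :: "nat \<Rightarrow> ('n::finite) word set" where
  "words k = {X. \<forall>i. i \<notin> {1..k} \<longrightarrow> X i = 0}"

text \<open>$\Re(\mathrm{Tr}(XY^\dagger))$, computed blockwise, and the Frobenius norm.\<close>

definition word_inner :: "nat \<Rightarrow> ('n::finite) word \<Rightarrow> ('n::finite) word \<Rightarrow> real" where
  "word_inner k X Y = (\<Sum>i=1..k. Re (Determinants.trace (X i ** cadj (Y i))))"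

definition word_norm :: "nat \<Rightarrow> ('n::finite) word \<Rightarrow> real" where
  "word_norm k X = sqrt (\<Sum>i=1..k. (norm (X i))\<^sup>2)"

definition pdet :: "nat \<Rightarrow> ('n::finite) word \<Rightarrow> complex" where
  "pdet k X = (\<Prod>i=1..k. Determinants.det (X i))"

definition det_min :: "nat \<Rightarrow> ('n::finite) word set \<Rightarrow> real" where
  "det_min k L = (INF X \<in> L - {\<lambda>_. 0}. cmod (pdet k X))"

text \<open>\<open>L\<close> is the lattice of dimension \<open>d\<close> with basis \<open>B 0, \<dots>, B (d - 1)\<close>.\<close>

definition lattice_basis :: "nat \<Rightarrow> nat \<Rightarrow> (nat \<Rightarrow> ('n::finite) word) \<Rightarrow> ('n::finite) word set \<Rightarrow> bool" where
  "lattice_basis k d B L \<longleftrightarrow>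
     (\<forall>j<d. B j \<in> words k) \<and>
     (\<forall>c :: nat \<Rightarrow> real. (\<forall>i. (\<Sum>j<d. c j *\<^sub>R B j i) = 0) \<longrightarrow> (\<forall>j<d. c j = 0)) \<and>
     L = {\<lambda>i. \<Sum>j<d. real_of_int (z j) *\<^sub>R B j i | z :: nat \<Rightarrow> int. True}"

text \<open>The value depends only on the lattice spanned by \<open>B\<close>.\<close>

definition lattice_vol :: "nat \<Rightarrow> nat \<Rightarrow> (nat \<Rightarrow> ('n::finite) word) \<Rightarrow> real" where
  "lattice_vol k d B =
     sqrt (Determinant.det (Matrix.mat d d (\<lambda>(i, j). word_inner k (B i) (B j))))"

section \<open>Codes\<close>

text \<open>
  \<open>ball_const n k\<close> is the volume of the ball of radius $\sqrt{nk}$ in real dimension $2n^2k$.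
\<close>

definition ball_const :: "nat \<Rightarrow> nat \<Rightarrow> real" where
  "ball_const n k = (pi * real n * real k) ^ (n\<^sup>2 * k) / fact (n\<^sup>2 * k)"

definition code_scale :: "nat \<Rightarrow> nat \<Rightarrow> real \<Rightarrow> real \<Rightarrow> real \<Rightarrow> real" where
  "code_scale n k P R V =
     sqrt (ball_const n k powr (1 / real (n\<^sup>2 * k)) * P
           / (2 powr (R / real n) * V powr (1 / real (n\<^sup>2 * k))))"

definition shifted_lattice :: "real \<Rightarrow> ('n::finite) word \<Rightarrow> ('n::finite) word set \<Rightarrow> ('n::finite) word set" where
  "shifted_lattice \<alpha> X\<^sub>R L = {\<lambda>i. X\<^sub>R i + \<alpha> *\<^sub>R Y i | Y. Y \<in> L}"

definition lattice_code ::
    "nat \<Rightarrow> real \<Rightarrow> real \<Rightarrow> ('n::finite) word \<Rightarrow> ('n::finite) word set \<Rightarrow> ('n::finite) word set" where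
  "lattice_code k P \<alpha> X\<^sub>R L =
     {X \<in> words k. word_norm k X \<le> sqrt (P * real k * real CARD('n))} \<inter> shifted_lattice \<alpha> X\<^sub>R L"

definition admissible_shift ::
    "nat \<Rightarrow> real \<Rightarrow> real \<Rightarrow> real \<Rightarrow> ('n::finite) word set \<Rightarrow> ('n::finite) word \<Rightarrow> bool" where
  "admissible_shift k P R \<alpha> L X\<^sub>R \<longleftrightarrow>
     X\<^sub>R \<in> words k \<and>
     real (card (lattice_code k P \<alpha> X\<^sub>R L)) \<ge> 2 powr (R * real CARD('n) * real k)"

section \<open>Channel and decoding\<close>

text \<open>
  Circularly symmetric of variance 1 per complex dimension: independent real and imaginary parts of
  variance \<open>1/2\<close> each (the last argument of \<open>normal_density\<close> before the point is the standard
  deviation).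
\<close>

definition complex_normal :: "complex measure" where
  "complex_normal =
     distr (density lborel (normal_density 0 (1 / sqrt 2)) \<Otimes>\<^sub>M
            density lborel (normal_density 0 (1 / sqrt 2))) borel (\<lambda>(x, y). Complex x y)"

definition noise :: "nat \<Rightarrow> (nat \<times> 'r \<times> 'n \<Rightarrow> complex) measure" where
  "noise k = (\<Pi>\<^sub>M e \<in> {1..k} \<times> UNIV. complex_normal)"

definition noise_block :: "(nat \<times> 'r \<times> 'n \<Rightarrow> complex) \<Rightarrow> nat \<Rightarrow> complex ^ 'n ^ 'r" where
  "noise_block w i = (\<chi> a b. w (i, a, b))"

definition channel_output ::
    "nat \<Rightarrow> (nat \<Rightarrow> complex ^ 'n ^ 'r) \<Rightarrow> ('n::finite) word \<Rightarrow> (nat \<times> 'r \<times> 'n \<Rightarrow> complex) \<Rightarrow>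
     nat \<Rightarrow> complex ^ 'n ^ 'r" where
  "channel_output k h X w = (\<lambda>i\<in>{1..k}. h i ** X i + noise_block w i)"

definition decoding_metric ::
    "nat \<Rightarrow> (nat \<Rightarrow> complex ^ 'n ^ 'r) \<Rightarrow> (nat \<Rightarrow> complex ^ 'n ^ 'r) \<Rightarrow> ('n::finite) word \<Rightarrow> real" where
  "decoding_metric k h Y X' = (\<Sum>i=1..k. (norm (Y i - h i ** X' i))\<^sup>2)"

type_synonym ('n, 'r) decoder =
  "(nat \<Rightarrow> complex ^ 'n ^ 'r) \<times> (nat \<Rightarrow> complex ^ 'n ^ 'r) \<Rightarrow> 'n word"

text \<open>
  A measurable map from the channel state and the received word to the search set \<open>S\<close> that outputs
  a minimizer of the metric over \<open>S\<close>, with arbitrary (measurable) tie-breaking.  Over an infinite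
  \<open>S\<close> a minimizer can fail to exist when some block of \<open>h\<close> is rank deficient; there the output is
  an arbitrary element of \<open>S\<close>.
\<close>

definition minimum_distance_decoder ::
    "nat \<Rightarrow> ('n::finite) word set \<Rightarrow> ('n::finite, 'r::finite) decoder \<Rightarrow> bool" where
  "minimum_distance_decoder k S D \<longleftrightarrow>
     D \<in> measurable ((\<Pi>\<^sub>M i\<in>{1..k}. borel) \<Otimes>\<^sub>M (\<Pi>\<^sub>M i\<in>{1..k}. borel)) (count_space S) \<and>
     (\<forall>h \<in> {1..k} \<rightarrow>\<^sub>E UNIV. \<forall>Y \<in> {1..k} \<rightarrow>\<^sub>E UNIV.
        (\<exists>X'. is_arg_min (decoding_metric k h Y) (\<lambda>X'. X' \<in> S) X') \<longrightarrow>
        is_arg_min (decoding_metric k h Y) (\<lambda>X'. X' \<in> S) (D (h, Y)))"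

definition channel_state ::
    "nat \<Rightarrow> (int \<Rightarrow> 'a \<Rightarrow> complex ^ 'n ^ 'r) \<Rightarrow> 'a \<Rightarrow> nat \<Rightarrow> complex ^ 'n ^ 'r" where
  "channel_state k H \<omega> = (\<lambda>i\<in>{1..k}. H (int i) \<omega>)"

text \<open>
  The product measure makes the uniform codeword, the fading process and the noise independent.
\<close>

definition error_prob ::
    "'a measure \<Rightarrow> (int \<Rightarrow> 'a \<Rightarrow> complex ^ 'n ^ 'r) \<Rightarrow> nat \<Rightarrow> ('n::finite) word set \<Rightarrow>
     ('n::finite, 'r::finite) decoder \<Rightarrow> real" where
  "error_prob M H k C D =
     (let N = uniform_count_measure C \<Otimes>\<^sub>M (M \<Otimes>\<^sub>M noise k) in
      measure N {(X, \<omega>, w) \<in> space N.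
        D (channel_state k H \<omega>, channel_output k (channel_state k H \<omega>) X w) \<noteq> X})"

text \<open>
  Achievability along the set \<open>K\<close> of block numbers with the codes \<open>code k X\<^sub>R\<close> obtained from
  admissible shifts \<open>X\<^sub>R\<close>, decoding by minimization over \<open>search k X\<^sub>R\<close>: such codes and decoders
  exist, and the error probability vanishes for every choice of shifts and of decoders.
\<close>

definition achievable ::
    "'a measure \<Rightarrow> (int \<Rightarrow> 'a \<Rightarrow> complex ^ 'n ^ 'r) \<Rightarrow> nat set \<Rightarrow>
     (nat \<Rightarrow> ('n::finite) word \<Rightarrow> bool) \<Rightarrow> (nat \<Rightarrow> ('n::finite) word \<Rightarrow> ('n::finite) word set) \<Rightarrow>
     (nat \<Rightarrow> ('n::finite) word \<Rightarrow> ('n::finite) word set) \<Rightarrow> bool" where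
  "achievable M H K adm code search \<longleftrightarrow>
     (\<forall>k\<in>K. \<exists>X. adm k X) \<and>
     (\<forall>k\<in>K. \<forall>X. adm k X \<longrightarrow>
        (\<exists>D :: ('n::finite, 'r::finite) decoder. minimum_distance_decoder k (search k X) D)) \<and>
     (\<forall>(X :: nat \<Rightarrow> ('n::finite) word) (D :: nat \<Rightarrow> ('n::finite, 'r::finite) decoder).
        (\<forall>k\<in>K. adm k (X k) \<and> minimum_distance_decoder k (search k (X k)) (D k)) \<longrightarrow>
        ((\<lambda>k. error_prob M H k (code k (X k)) (D k)) \<longlongrightarrow> 0) (inf sequentially (principal K)))"

end

theory Submission
  imports Defs "HOL-Real_Asymp.Real_Asymp"
begin

text \<open>
  Choose the shift by averaging: over a fundamental box of the scaled lattice, the mean number of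
  points in the power ball is the ratio of volumes, which is exactly $2^{Rnk}$.  In coordinates
  given by a Cholesky factor of the Gram matrix the lattice is triangular, so the box tiles by
  back substitution and no determinant change of variables is needed.

  A wrong decision for a lattice difference $\Lambda$ forces
  $\alpha^2 \sum_i \|H_i \Lambda_i\|^2 \le 4 \sum_i \|p_i W_i\|^2$, where $p_i$ projects onto the
  column space of $H_i$.  By Hadamard's inequality and the AM-GM inequality the left-hand sum is at
  least $nk \, (\prod_i \det H_i^\dagger H_i)^{1/(nk)}$, and the ergodic average of
  $\log \det H_i^\dagger H_i$ bounds this from below with high probability.  Given the fading,
  the summands $\|p_i W_i\|^2$ are independent with mean $n^2$ and bounded variance, so
  Chebyshev's inequality bounds the right-hand side by $4 k (n^2 + \epsilon)$ with high
  probability.  Stirling's bound for the ball volume turns the comparison of both sides into the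
  stated rate.
\<close>

section \<open>Gram determinants of complex matrices\<close>

text \<open>The projections matter when n_r > n. The raw noise has mean energy n n_r per block,
  which would cost rate, whereas the projected noise has mean n trace(p_i) = n^2 whatever the fading
  matrix is. The resulting bad noise event does not mention the competing lattice point. So one
  event serves all competitors, no union bound over an infinite lattice arises, and the same
  estimate covers every search set between the code and the shifted lattice, every admissible shift
  and every tie-breaking.

  Origin of the rate: the root of the ball volume constant tends to pi e / n. With E the mean of log
  det H^dagger H, the squared distance per block is therefore at least about (pi e / n) P n 2^(E/n)
  / (2^(R/n) C_L), and it has to exceed 4 n^2. The 4 stems from halving a distance and squaring.
  Solving for R gives the stated bound; its strictness leaves slack for Stirling, for the ergodic
  average and for Chebyshev.

  The ergodic average is controlled from one side only and in probability, for which bounded maximal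
  sums suffice.\<close>

abbreviation (input) gram :: "complex ^ 'n ^ 'm \<Rightarrow> complex ^ 'n ^ 'n" where
  "gram A \<equiv> cadj A ** A"

lemma cadj_mult: "cadj (A ** B) = cadj B ** cadj A"
  by (simp add: cadj_def matrix_matrix_mult_def Finite_Cartesian_Product.vec_eq_iff mult.commute)

lemma cadj_cadj [simp]: "cadj (cadj A) = A"
  by (simp add: cadj_def Finite_Cartesian_Product.vec_eq_iff)

lemma cadj_mat_1 [simp]: "cadj (Finite_Cartesian_Product.mat 1) = Finite_Cartesian_Product.mat 1"
  by (auto simp: cadj_def Finite_Cartesian_Product.vec_eq_iff fun_eq_iff Finite_Cartesian_Product.mat_def)

lemma det_cadj: "Determinants.det (cadj A) = cnj (Determinants.det A)"
proof -
  have "Determinants.det (cadj A) = Determinants.det (Finite_Cartesian_Product.transpose (cadj A))"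
    by simp
  also have "Finite_Cartesian_Product.transpose (cadj A) = (\<chi> i j. cnj (A $ i $ j))"
    by (simp add: Finite_Cartesian_Product.transpose_def cadj_def Finite_Cartesian_Product.vec_eq_iff)
  also have "Determinants.det \<dots> = cnj (Determinants.det A)"
    by (simp add: Determinants.det_def)
  finally show ?thesis .
qed

lemma Re_trace_mult_cadj: "Re (Determinants.trace (A ** cadj B)) = inner A B"
  by (simp add: Determinants.trace_def matrix_matrix_mult_def cadj_def inner_vec_def inner_complex_def)

lemma inner_mult_left_cadj:
  fixes A :: "complex ^ 'n ^ 'm"
  shows "inner (A ** X) Y = inner X (cadj A ** Y)"
proof -
  have "inner (A ** X) Y = Re (Determinants.trace (A ** (X ** cadj Y)))"
    by (simp add: Re_trace_mult_cadj[symmetric] matrix_mul_assoc)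
  also have "\<dots> = Re (Determinants.trace ((X ** cadj Y) ** A))"
    by (rule arg_cong[where f = Re], rule trace_mul_sym)
  also have "\<dots> = inner X (cadj A ** Y)"
    by (simp add: Re_trace_mult_cadj[symmetric] matrix_mul_assoc cadj_mult)
  finally show ?thesis .
qed

lemma gram_diag: "gram A $ j $ j = of_real (\<Sum>i\<in>UNIV. (cmod (A $ i $ j))\<^sup>2)"
  by (simp add: matrix_matrix_mult_def cadj_def complex_norm_square[symmetric] mult.commute)

lemma norm_eq_sum_columns: "(norm (A :: complex ^ 'n ^ 'm))\<^sup>2 = (\<Sum>j\<in>UNIV. \<Sum>i\<in>UNIV. (cmod (A $ i $ j))\<^sup>2)"
proof -
  have "(norm A)\<^sup>2 = (\<Sum>i\<in>UNIV. \<Sum>j\<in>UNIV. (cmod (A $ i $ j))\<^sup>2)"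
    by (simp add: norm_vec_def L2_set_def sum_nonneg)
  then show ?thesis by (simp only: sum.swap[of _ "UNIV :: 'm set"])
qed

section \<open>Column operations and Hadamard's inequality\<close>

text \<open>Right multiplication by this matrix adds to column \<open>s\<close> the combination of
  the columns with coefficients \<open>v\<close>, a whole Gram-Schmidt step at once. As
  \<open>v\<close> has no \<open>s\<close> component, the transpose arises from the identity by
  adding to one row a combination of the others, so the determinant stays 1.\<close>

lemma det_add_columns:
  fixes v :: "complex ^ 'n"
  assumes "v $ s = 0"
  shows "Determinants.det (\<chi> a b. (if a = b then 1 else 0) + (if b = s then v $ a else 0)) = (1 :: complex)"
proof -
  let ?I = "Finite_Cartesian_Product.mat 1 :: complex ^ 'n ^ 'n"
  have row: "Finite_Cartesian_Product.row k ?I = axis k 1" for k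
    by (auto simp: Finite_Cartesian_Product.row_def Finite_Cartesian_Product.mat_def axis_def Finite_Cartesian_Product.vec_eq_iff fun_eq_iff)
  have v: "v = (\<Sum>a\<in>UNIV - {s}. v $ a *s axis a 1)"
  proof -
    have "v = (\<Sum>a\<in>UNIV. v $ a *s axis a 1)" by (rule basis_expansion[symmetric])
    also have "\<dots> = v $ s *s axis s 1 + (\<Sum>a\<in>UNIV - {s}. v $ a *s axis a 1)"
      by (rule sum.remove) auto
    finally show ?thesis using assms by simp
  qed
  have "v \<in> vec.span {Finite_Cartesian_Product.row j ?I |j. j \<noteq> s}"
    by (subst v, intro vec.span_sum vec.span_scale vec.span_base) (auto simp: row)
  from det_row_span[OF this]
  have "Determinants.det (\<chi> k. if k = s then axis s 1 + v else axis k 1) = 1"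
    unfolding row by simp
  also have "(\<chi> k. if k = s then axis s 1 + v else axis k 1) =
     Finite_Cartesian_Product.transpose (\<chi> a b. (if a = b then 1 else 0) + (if b = s then v $ a else 0))"
    by (auto simp: Finite_Cartesian_Product.transpose_def axis_def Finite_Cartesian_Product.vec_eq_iff)
  finally show ?thesis by simp
qed

text \<open>Orthogonalization without normalization: each step multiplies by a matrix of determinant
  1, and replacing a column by its component orthogonal to the earlier ones only shortens it.
  Dependent columns are allowed, since nothing is scaled to unit length.\<close>

lemma gram_schmidt_columns:
  fixes A :: "complex ^ 'n ^ 'm" and S :: "'n set"
  shows "\<exists>B :: complex ^ 'n ^ 'm. Determinants.det (gram B) = Determinants.det (gram A) \<and>
     (\<forall>j. Re (gram B $ j $ j) \<le> Re (gram A $ j $ j)) \<and>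
     (\<forall>j\<in>S. \<forall>l\<in>S. j \<noteq> l \<longrightarrow> gram B $ j $ l = 0)"
proof -
  have "finite S" by simp
  then show ?thesis
  proof (induction S rule: finite_induct)
    case empty
    show ?case by (rule exI[of _ A]) simp
  next
    case (insert s S)
    then obtain B :: "complex ^ 'n ^ 'm" where det: "Determinants.det (gram B) = Determinants.det (gram A)"
      and le: "\<And>j. Re (gram B $ j $ j) \<le> Re (gram A $ j $ j)"
      and orth: "\<And>j l. j \<in> S \<Longrightarrow> l \<in> S \<Longrightarrow> j \<noteq> l \<Longrightarrow> gram B $ j $ l = 0"
      by blast
    define q where "q j l = gram B $ j $ l" for j l
    have q: "q j l = (\<Sum>i\<in>UNIV. cnj (B $ i $ j) * B $ i $ l)" for j l
      by (simp add: q_def matrix_matrix_mult_def cadj_def)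
    have q_sym: "cnj (q j l) = q l j" for j l by (simp add: q mult.commute)
    \<comment> \<open>Projection coefficients. If column \<open>a\<close> has norm 0, the quotient
      is 0 by convention, which is right because \<open>q_zero\<close> makes the numerator vanish
      too.\<close>
    define w where "w = (\<chi> a. if a \<in> S then - q a s / q a a else 0)"
    have ws: "w $ s = 0" using insert by (simp add: w_def)
    have q_zero: "q a l = 0" if "q a a = 0" for a l
    proof -
      have "(\<Sum>i\<in>UNIV. (cmod (B $ i $ a))\<^sup>2) = 0"
        using that gram_diag[of B a] unfolding q_def[symmetric] by (simp only: of_real_eq_0_iff)
      then have "B $ i $ a = 0" for i by (simp add: sum_nonneg_eq_0_iff)
      then show ?thesis by (simp add: q)
    qed
    define E :: "complex ^ 'n ^ 'n"
      where "E = (\<chi> a b. (if a = b then 1 else 0) + (if b = s then w $ a else 0))"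
    define C where "C = B ** E"
    have C: "C $ i $ b = B $ i $ b + (if b = s then (\<Sum>a\<in>UNIV. B $ i $ a * w $ a) else 0)" for i b
      by (cases "b = s") (simp_all add: C_def E_def matrix_matrix_mult_def distrib_left sum.distrib mult_delta_right)
    have detE: "Determinants.det E = 1" unfolding E_def by (rule det_add_columns[OF ws])
    have gramC: "gram C = cadj E ** (gram B ** E)"
      by (simp add: C_def cadj_mult matrix_mul_assoc)
    have "Determinants.det (gram C) = Determinants.det (gram A)"
      unfolding gramC by (simp add: Determinants.det_mul det_cadj detE det)
    have other: "gram C $ j $ l = q j l" if "j \<noteq> s" "l \<noteq> s" for j l
      using that by (simp add: q matrix_matrix_mult_def cadj_def C)
    have new: "gram C $ j $ s = q j s + (\<Sum>a\<in>UNIV. q j a * w $ a)" if "j \<noteq> s" for j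
    proof -
      have "gram C $ j $ s = (\<Sum>i\<in>UNIV. cnj (B $ i $ j) * (B $ i $ s + (\<Sum>a\<in>UNIV. B $ i $ a * w $ a)))"
        using that by (simp add: matrix_matrix_mult_def cadj_def C)
      also have "\<dots> = q j s + (\<Sum>i\<in>UNIV. \<Sum>a\<in>UNIV. cnj (B $ i $ j) * (B $ i $ a * w $ a))"
        by (simp add: q distrib_left sum.distrib sum_distrib_left)
      also have "(\<Sum>i\<in>UNIV. \<Sum>a\<in>UNIV. cnj (B $ i $ j) * (B $ i $ a * w $ a)) = (\<Sum>a\<in>UNIV. q j a * w $ a)"
        by (subst sum.swap) (simp add: q sum_distrib_right mult.assoc)
      finally show ?thesis .
    qed
    have new0: "gram C $ j $ s = 0" if j: "j \<in> S" for j
    proof -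
      have js: "j \<noteq> s" using j insert by auto
      have "(\<Sum>a\<in>UNIV. q j a * w $ a) = q j j * w $ j"
      proof (rule sum.remove[of UNIV j, THEN trans])
        have "(\<Sum>a\<in>UNIV - {j}. q j a * w $ a) = 0"
          by (rule sum.neutral) (auto simp: w_def q_def orth[OF j])
        then show "q j j * w $ j + (\<Sum>a\<in>UNIV - {j}. q j a * w $ a) = q j j * w $ j" by simp
      qed auto
      also have "\<dots> = - q j s" using j q_zero[of j s] by (simp add: w_def)
      finally show ?thesis using new[OF js] by simp
    qed
    have sym: "gram C $ j $ l = cnj (gram C $ l $ j)" for j l
      by (simp add: matrix_matrix_mult_def cadj_def mult.commute)
    \<comment> \<open>The old column is the new one minus a combination of columns in
      \<open>S\<close>, to which the new one is orthogonal. Pythagoras then shows that the norm did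
      not grow.\<close>
    have decomp: "B $ i $ s = C $ i $ s - (\<Sum>a\<in>UNIV. C $ i $ a * w $ a)" for i
    proof -
      have "(\<Sum>a\<in>UNIV. C $ i $ a * w $ a) = (\<Sum>a\<in>UNIV. B $ i $ a * w $ a)"
        by (rule sum.cong) (auto simp: C ws)
      then show ?thesis by (simp add: C)
    qed
    have "(\<Sum>i\<in>UNIV. (cmod (C $ i $ s))\<^sup>2) \<le> (\<Sum>i\<in>UNIV. (cmod (B $ i $ s))\<^sup>2)"
    proof -
      define D where "D i = (\<Sum>a\<in>UNIV. C $ i $ a * w $ a)" for i
      have "(\<Sum>i\<in>UNIV. cnj (C $ i $ s) * D i) = (\<Sum>a\<in>UNIV. gram C $ s $ a * w $ a)"
        unfolding D_def by (simp add: sum_distrib_left, subst sum.swap)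
          (simp add: matrix_matrix_mult_def cadj_def sum_distrib_right mult.assoc)
      also have "\<dots> = 0"
        by (rule sum.neutral) (auto simp: w_def sym[of s] new0)
      finally have ortho: "(\<Sum>i\<in>UNIV. cnj (C $ i $ s) * D i) = 0" .
      have "(cmod (B $ i $ s))\<^sup>2 = (cmod (C $ i $ s))\<^sup>2 + (cmod (D i))\<^sup>2 - 2 * Re (cnj (C $ i $ s) * D i)" for i
        unfolding decomp D_def[symmetric] cmod_power2 by (simp add: power2_eq_square algebra_simps)
      then have "(\<Sum>i\<in>UNIV. (cmod (B $ i $ s))\<^sup>2) =
          (\<Sum>i\<in>UNIV. (cmod (C $ i $ s))\<^sup>2) + (\<Sum>i\<in>UNIV. (cmod (D i))\<^sup>2) - 2 * Re (\<Sum>i\<in>UNIV. cnj (C $ i $ s) * D i)"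
        by (simp add: sum.distrib sum_subtractf sum_distrib_left del: complex_cnj_mult times_complex.sel)
      then show ?thesis unfolding ortho by (simp add: sum_nonneg)
    qed
    then have "Re (gram C $ s $ s) \<le> Re (gram B $ s $ s)" by (simp only: gram_diag Re_complex_of_real)
    show ?case
    proof (intro exI[of _ C] conjI allI ballI impI)
      show "Determinants.det (gram C) = Determinants.det (gram A)" by fact
      show "Re (gram C $ j $ j) \<le> Re (gram A $ j $ j)" for j
      proof (cases "j = s")
        case True
        then show ?thesis using \<open>Re (gram C $ s $ s) \<le> Re (gram B $ s $ s)\<close> le[of s] by simp
      next
        case False
        then show ?thesis using other[of j j] le[of j] by (simp add: q_def)
      qed
      show "gram C $ j $ l = 0" if "j \<in> insert s S" "l \<in> insert s S" "j \<noteq> l" for j l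
      proof (cases "j = s \<or> l = s")
        case True
        then show ?thesis using that new0[of j] new0[of l] sym[of j l] by auto
      next
        case False
        then show ?thesis using that other[of j l] orth[of j l] by (auto simp: q_def)
      qed
    qed
  qed
qed

text \<open>The right-hand side is the product of the diagonal entries of \<open>gram A\<close>.
  Full orthogonalization makes the Gram matrix diagonal, keeps its determinant and does not increase
  its diagonal.\<close>

lemma hadamard_gram:
  fixes A :: "complex ^ 'n ^ 'm"
  shows "Re (Determinants.det (gram A)) \<le> (\<Prod>j\<in>UNIV. \<Sum>i\<in>UNIV. (cmod (A $ i $ j))\<^sup>2)"
proof -
  obtain B :: "complex ^ 'n ^ 'm" where B: "Determinants.det (gram B) = Determinants.det (gram A)"
    "\<And>j. Re (gram B $ j $ j) \<le> Re (gram A $ j $ j)" "\<And>j l. j \<noteq> l \<Longrightarrow> gram B $ j $ l = 0"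
    using gram_schmidt_columns[of A UNIV] by blast
  have "Determinants.det (gram A) = (\<Prod>j\<in>UNIV. gram B $ j $ j)"
    unfolding B(1)[symmetric] by (rule Determinants.det_diagonal) (rule B(3))
  then have "Re (Determinants.det (gram A)) = (\<Prod>j\<in>UNIV. \<Sum>i\<in>UNIV. (cmod (B $ i $ j))\<^sup>2)"
    by (simp only: gram_diag of_real_prod[symmetric] Re_complex_of_real)
  also have "\<dots> \<le> (\<Prod>j\<in>UNIV. \<Sum>i\<in>UNIV. (cmod (A $ i $ j))\<^sup>2)"
    using B(2) by (intro prod_mono) (simp add: gram_diag sum_nonneg del: of_real_sum)
  finally show ?thesis .
qed

lemma gram_det_mult:
  fixes h :: "complex ^ 'n ^ 'm"
  shows "gram_det 1 (h ** X) = gram_det 1 h * (cmod (Determinants.det X))\<^sup>2"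
proof -
  have "gram (h ** X) = cadj X ** (gram h ** X)"
    by (simp add: cadj_mult matrix_mul_assoc)
  then have "Determinants.det (gram (h ** X)) =
      Determinants.det (gram h) * (Determinants.det X * cnj (Determinants.det X))"
    by (simp add: Determinants.det_mul det_cadj)
  also have "\<dots> = Determinants.det (gram h) * of_real ((cmod (Determinants.det X))\<^sup>2)"
    by (simp only: complex_norm_square)
  finally show ?thesis by (simp add: gram_det_def)
qed

lemma gram_det_scale:
  fixes h :: "complex ^ 'n ^ 'm"
  shows "gram_det c h = c ^ CARD('n) * gram_det 1 h"
proof -
  have "c *\<^sub>R gram h = (\<chi> i. complex_of_real c *s (gram h $ i))"
    by (simp add: Finite_Cartesian_Product.vec_eq_iff) (simp add: scaleR_conv_of_real)
  then have "Determinants.det (c *\<^sub>R gram h) = of_real c ^ CARD('n) * Determinants.det (gram h)"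
    using Determinants.det_rows_mul[of "\<lambda>_. complex_of_real c" "\<lambda>i. gram h $ i"] by simp
  then show ?thesis
    by (simp add: gram_det_def of_real_power[symmetric] del: of_real_power)
qed

text \<open>Single blocks of \<open>X\<close> may have tiny determinants; only the product
  \<open>pdet k X\<close> is controlled. Hence AM-GM is applied once, to the squared norms of all
  \<open>CARD('n) * k\<close> columns, and not block by block.\<close>

lemma word_norm_faded_lower_bound:
  fixes h :: "nat \<Rightarrow> complex ^ 'n ^ 'm" and X :: "'n word"
  assumes k: "k > 0" and h: "\<And>i. i \<in> {1..k} \<Longrightarrow> gram_det 1 (h i) > 0"
  shows "real (CARD('n) * k) * ((\<Prod>i=1..k. gram_det 1 (h i)) * (cmod (pdet k X))\<^sup>2) powr (1 / real (CARD('n) * k))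
    \<le> (\<Sum>i=1..k. (norm (h i ** X i))\<^sup>2)"
proof -
  let ?c = "\<lambda>(i, j). \<Sum>a\<in>UNIV. (cmod ((h i ** X i) $ a $ j))\<^sup>2"
  let ?S = "{1..k} \<times> (UNIV :: 'n set)"
  have card: "card ?S = CARD('n) * k" by simp
  have "(\<Prod>i=1..k. gram_det 1 (h i)) * (cmod (pdet k X))\<^sup>2 =
      (\<Prod>i=1..k. gram_det 1 (h i) * (cmod (Determinants.det (X i)))\<^sup>2)"
    by (simp add: pdet_def prod.distrib prod_norm[symmetric] prod_power_distrib)
  also have "\<dots> = (\<Prod>i=1..k. Re (Determinants.det (gram (h i ** X i))))"
    by (simp add: gram_det_mult[symmetric]) (simp add: gram_det_def)
  also have "\<dots> \<le> (\<Prod>i=1..k. \<Prod>j\<in>UNIV. ?c (i, j))"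
  proof (intro prod_mono conjI)
    fix i assume "i \<in> {1..k}"
    have "0 \<le> gram_det 1 (h i) * (cmod (Determinants.det (X i)))\<^sup>2"
      using h[OF \<open>i \<in> {1..k}\<close>] by simp
    then show "0 \<le> Re (Determinants.det (gram (h i ** X i)))"
      unfolding gram_det_mult[symmetric] by (simp add: gram_det_def)
    show "Re (Determinants.det (gram (h i ** X i))) \<le> (\<Prod>j\<in>UNIV. ?c (i, j))"
      using hadamard_gram[of "h i ** X i"] by simp
  qed
  also have "\<dots> = (\<Prod>p\<in>?S. ?c p)"
    by (simp add: prod.cartesian_product)
  finally have le: "(\<Prod>i=1..k. gram_det 1 (h i)) * (cmod (pdet k X))\<^sup>2 \<le> (\<Prod>p\<in>?S. ?c p)" .
  have "((\<Prod>i=1..k. gram_det 1 (h i)) * (cmod (pdet k X))\<^sup>2) powr (1 / real (CARD('n) * k))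
      \<le> (\<Prod>p\<in>?S. ?c p) powr (1 / real (card ?S))"
    unfolding card
  proof (rule powr_mono2[OF _ _ le])
    show "0 \<le> (\<Prod>i=1..k. gram_det 1 (h i)) * (cmod (pdet k X))\<^sup>2"
      using h by (intro mult_nonneg_nonneg prod_nonneg) (auto intro: less_imp_le)
  qed simp
  also have "\<dots> \<le> (\<Sum>p\<in>?S. ?c p / real (card ?S))"
    using k by (intro arith_geom_mean) (auto intro!: sum_nonneg)
  also have "\<dots> = (\<Sum>p\<in>?S. ?c p) / real (CARD('n) * k)"
    unfolding card by (simp only: sum_divide_distrib)
  also have "(\<Sum>p\<in>?S. ?c p) = (\<Sum>i=1..k. (norm (h i ** X i))\<^sup>2)"
    unfolding norm_eq_sum_columns by (rule sum.cartesian_product[symmetric])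
  finally show ?thesis using k by (simp add: field_simps)
qed

section \<open>Orthogonal projection onto the column space\<close>

text \<open>The projection is h (h^dagger h)^(-1) h^dagger, and cyclicity reduces its trace to that
  of the n by n identity. The trace is recorded because it determines the mean energy of the
  projected noise.\<close>

lemma range_projection:
  fixes h :: "complex ^ 'n ^ 'm"
  assumes "gram_det 1 h > 0"
  obtains p :: "complex ^ 'm ^ 'm" where "cadj p = p" "p ** p = p" "p ** h = h"
    "Determinants.trace p = of_nat CARD('n)"
proof -
  let ?I = "Finite_Cartesian_Product.mat 1"
  have "Determinants.det (gram h) \<noteq> 0" using assms by (auto simp: gram_det_def)
  then have "\<exists>G. gram h ** G = ?I \<and> G ** gram h = ?I"
    unfolding invertible_det_nz[symmetric] Finite_Cartesian_Product.invertible_def .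
  then obtain G where G: "gram h ** G = ?I" "G ** gram h = ?I" by blast
  have "cadj G ** gram h = ?I"
    using arg_cong[OF G(1), of cadj] by (simp add: cadj_mult)
  \<comment> \<open>\<open>cadj G\<close> is a left inverse of the matrix of which \<open>G\<close>
    is a right inverse, so the two agree.\<close>
  then have adj: "cadj G = G"
    by (metis G(1) matrix_mul_assoc matrix_mul_lid matrix_mul_rid)
  define p where "p = h ** (G ** cadj h)"
  show thesis
  proof (rule that[of p])
    show "cadj p = p" by (simp add: p_def cadj_mult adj matrix_mul_assoc)
    show ph: "p ** h = h"
      using G(2) by (simp add: p_def matrix_mul_assoc[symmetric])
    show "p ** p = p"
      using ph by (simp add: p_def matrix_mul_assoc)
    have "Determinants.trace p = Determinants.trace ((G ** cadj h) ** h)"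
      unfolding p_def by (rule trace_mul_sym)
    also have "(G ** cadj h) ** h = ?I" using G(2) by (simp add: matrix_mul_assoc)
    finally show "Determinants.trace p = of_nat CARD('n)" by (simp add: trace_I)
  qed
qed

text \<open>Noise orthogonal to the range of \<open>h\<close> shifts the metric of all candidates
  equally, so only the projected part can mislead the decoder.\<close>

lemma inner_projection:
  assumes "cadj p = p" "p ** h = h"
  shows "inner W (h ** X) = inner (p ** W) (h ** X)"
proof -
  have "inner (p ** W) (h ** X) = inner W (p ** (h ** X))"
    using inner_mult_left_cadj[of p W "h ** X"] assms(1) by simp
  then show ?thesis using assms(2) by (simp add: matrix_mul_assoc)
qed

lemma norm_projection:
  assumes "cadj p = p" "p ** p = p"
  shows "(norm (p ** W))\<^sup>2 = inner (p ** W) W" "norm (p ** W) \<le> norm W"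
proof -
  have "inner (p ** W) (p ** W) = inner (p ** (p ** W)) W"
    using inner_mult_left_cadj[of p "p ** W" W] assms(1) by simp
  also have "\<dots> = inner (p ** W) W" using assms(2) by (simp add: matrix_mul_assoc)
  finally show eq: "(norm (p ** W))\<^sup>2 = inner (p ** W) W" by (simp add: power2_norm_eq_inner)
  then have "norm (p ** W) * norm (p ** W) \<le> norm (p ** W) * norm W"
    using norm_cauchy_schwarz[of "p ** W" W] by (simp add: power2_eq_square)
  then show "norm (p ** W) \<le> norm W"
    by (cases "norm (p ** W) = 0") auto
qed

section \<open>Lattices and admissible shifts\<close>

text \<open>Induction by Schur complement: eliminating coordinate 0 leaves \<open>G'\<close>, which
  is again positive definite.\<close>

lemma cholesky:
  fixes G :: "nat \<Rightarrow> nat \<Rightarrow> real"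
  assumes sym: "\<And>i j. i < d \<Longrightarrow> j < d \<Longrightarrow> G i j = G j i"
    and pos: "\<And>c. (\<exists>j<d. c j \<noteq> 0) \<Longrightarrow> (\<Sum>i<d. \<Sum>j<d. c i * c j * G i j) > 0"
  shows "\<exists>R. (\<forall>j l. j < l \<longrightarrow> R j l = 0) \<and> (\<forall>j<d. R j j > 0) \<and>
           (\<forall>i<d. \<forall>j<d. G i j = (\<Sum>l<d. R i l * R j l))"
  using assms
proof (induction d arbitrary: G)
  case 0
  show ?case by (rule exI[of _ "\<lambda>_ _. 0"]) simp
next
  case (Suc d)
  define g where "g = G 0 0"
  have "(\<Sum>i<Suc d. \<Sum>j<Suc d. (if i = 0 then 1 else 0) * (if j = 0 then 1 else 0) * G i j) > 0"
    by (rule Suc.prems(2)) auto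
  then have g: "g > 0"
    by (simp add: sum.lessThan_Suc_shift g_def del: sum.lessThan_Suc)
  define G' where "G' i j = G (Suc i) (Suc j) - G (Suc i) 0 * G (Suc j) 0 / g" for i j
  have "\<exists>R. (\<forall>j l. j < l \<longrightarrow> R j l = 0) \<and> (\<forall>j<d. R j j > 0) \<and>
           (\<forall>i<d. \<forall>j<d. G' i j = (\<Sum>l<d. R i l * R j l))"
  proof (rule Suc.IH)
    show "G' i j = G' j i" if "i < d" "j < d" for i j
      using that Suc.prems(1)[of "Suc i" "Suc j"] by (simp add: G'_def mult.commute)
    fix c :: "nat \<Rightarrow> real"
    assume c: "\<exists>j<d. c j \<noteq> 0"
    define s where "s = (\<Sum>j<d. c j * G (Suc j) 0)"
    \<comment> \<open>The entry \<open>- s / g\<close> minimizes the form in coordinate 0 and leaves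
      exactly the correction \<open>s * s / g\<close> that \<open>G'\<close> subtracts.\<close>
    define c' where "c' j = (case j of 0 \<Rightarrow> - s / g | Suc j \<Rightarrow> c j)" for j
    have s': "(\<Sum>j<d. c j * G 0 (Suc j)) = s"
      unfolding s_def by (rule sum.cong) (use Suc.prems(1) in auto)
    from c obtain j where "j < d" "c j \<noteq> 0" by blast
    then have "Suc j < Suc d \<and> c' (Suc j) \<noteq> 0" by (simp add: c'_def)
    then have "0 < (\<Sum>i<Suc d. \<Sum>j<Suc d. c' i * c' j * G i j)"
      by (intro Suc.prems(2)) blast
    also have "\<dots> = (\<Sum>j<Suc d. c' 0 * c' j * G 0 j) + (\<Sum>i<d. \<Sum>j<Suc d. c i * c' j * G (Suc i) j)"
      by (subst sum.lessThan_Suc_shift) (simp add: c'_def)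
    also have "(\<Sum>j<Suc d. c' 0 * c' j * G 0 j) = (s/g)^2 * g - s / g * s"
      by (subst sum.lessThan_Suc_shift)
        (simp add: c'_def g_def power2_eq_square s'[symmetric] sum_distrib_left sum_divide_distrib sum_negf mult_ac)
    also have "\<dots> = 0"
      using g by (simp add: field_simps power2_eq_square)
    also have "(\<Sum>i<d. \<Sum>j<Suc d. c i * c' j * G (Suc i) j) =
        (\<Sum>i<d. c i * G (Suc i) 0 * (- s/g) + (\<Sum>j<d. c i * c j * G (Suc i) (Suc j)))"
      by (subst sum.lessThan_Suc_shift) (simp add: c'_def mult_ac)
    also have "\<dots> = - (s * s / g) + (\<Sum>i<d. \<Sum>j<d. c i * c j * G (Suc i) (Suc j))"
      unfolding sum.distrib sum_distrib_right[symmetric] s_def[symmetric] by simp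
    also have "s * s / g = (\<Sum>i<d. \<Sum>j<d. c i * c j * (G (Suc i) 0 * G (Suc j) 0 / g))"
      by (simp add: s_def sum_product sum_divide_distrib mult_ac)
    finally show "(\<Sum>i<d. \<Sum>j<d. c i * c j * G' i j) > 0"
      by (simp add: G'_def right_diff_distrib sum_subtractf)
  qed
  then obtain R where R: "\<And>j l. j < l \<Longrightarrow> R j l = 0" "\<And>j. j < d \<Longrightarrow> R j j > 0"
     "\<And>i j. i < d \<Longrightarrow> j < d \<Longrightarrow> G' i j = (\<Sum>l<d. R i l * R j l)"
    by blast
  define S where "S i l = (case l of 0 \<Rightarrow> G i 0 / sqrt g
      | Suc l' \<Rightarrow> (case i of 0 \<Rightarrow> 0 | Suc i' \<Rightarrow> R i' l'))" for i l
  show ?case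
  proof (intro exI[of _ S] conjI allI impI)
    show "S j l = 0" if "j < l" for j l
      using that R(1) by (auto simp: S_def split: nat.split)
    show "S j j > 0" if "j < Suc d" for j
      using that R(2) g by (auto simp: S_def g_def[symmetric] split: nat.split)
    fix i j assume ij: "i < Suc d" "j < Suc d"
    have "(\<Sum>l<Suc d. S i l * S j l) = G i 0 * G j 0 / g + (\<Sum>l<d. S i (Suc l) * S j (Suc l))"
      using g by (subst sum.lessThan_Suc_shift) (simp add: S_def)
    also have "\<dots> = G i j"
    proof (cases i)
      case 0
      then show ?thesis using g Suc.prems(1)[OF ij] ij by (simp add: S_def g_def)
    next
      case (Suc i')
      show ?thesis
      proof (cases j)
        case 0
        then show ?thesis using g Suc.prems(1)[OF ij] ij by (simp add: S_def g_def)
      next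
        case (Suc j')
        then show ?thesis using \<open>i = Suc i'\<close> ij R(3)[of i' j'] by (simp add: S_def G'_def)
      qed
    qed
    finally show "G i j = (\<Sum>l<Suc d. S i l * S j l)" by simp
  qed
qed

lemma det_cholesky:
  fixes R :: "nat \<Rightarrow> nat \<Rightarrow> real"
  assumes "\<And>j l. j < l \<Longrightarrow> R j l = 0"
    and "\<And>i j. i < d \<Longrightarrow> j < d \<Longrightarrow> G i j = (\<Sum>l<d. R i l * R j l)"
  shows "Determinant.det (Matrix.mat d d (\<lambda>(i, j). G i j)) = (\<Prod>j<d. R j j)\<^sup>2"
proof -
  let ?R = "Matrix.mat d d (\<lambda>(i, j). R i j)"
  have "Matrix.mat d d (\<lambda>(i, j). G i j) = ?R * transpose_mat ?R"
    by (rule eq_matI) (simp_all add: assms(2) scalar_prod_def lessThan_atLeast0)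
  then have "Determinant.det (Matrix.mat d d (\<lambda>(i, j). G i j)) = Determinant.det ?R * Determinant.det ?R"
    by (simp add: Determinant.det_mult[of _ d] Determinant.det_transpose[of _ d])
  also have "Determinant.det ?R = prod_list (diag_mat ?R)"
    by (rule det_lower_triangular[of d]) (simp_all add: assms(1))
  also have "\<dots> = (\<Prod>j<d. R j j)"
    by (simp add: prod_list_diag_prod lessThan_atLeast0)
  finally show ?thesis by (simp add: power2_eq_square)
qed

text \<open>
  Back substitution, with one predicate per row so as to cover both solving over the reals and
  rounding to integers.
\<close>

lemma triangular_system:
  fixes R :: "nat \<Rightarrow> nat \<Rightarrow> real"
  assumes low: "\<And>j l. j < l \<Longrightarrow> R j l = 0"
    and solve: "\<And>l s. l < d \<Longrightarrow> \<exists>z\<in>A. Q l (s + R l l * z)"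
  shows "\<exists>z. (\<forall>j<d. z j \<in> A) \<and> (\<forall>l<d. Q l (\<Sum>j<d. R j l * z j))"
proof -
  have "\<exists>z. (\<forall>j. d - m \<le> j \<and> j < d \<longrightarrow> z j \<in> A) \<and>
          (\<forall>l. d - m \<le> l \<and> l < d \<longrightarrow> Q l (\<Sum>j<d. R j l * z j))" if "m \<le> d" for m
    using that
  proof (induction m)
    case 0
    then show ?case by auto
  next
    case (Suc m)
    then obtain z where z: "\<And>j. d - m \<le> j \<Longrightarrow> j < d \<Longrightarrow> z j \<in> A"
      "\<And>l. d - m \<le> l \<Longrightarrow> l < d \<Longrightarrow> Q l (\<Sum>j<d. R j l * z j)" by auto
    define p where "p = d - Suc m"
    have p: "p < d" "d - m = Suc p" using Suc.prems by (auto simp: p_def)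
    obtain x where x: "x \<in> A" "Q p ((\<Sum>j\<in>{..<d}-{p}. R j p * z j) + R p p * x)"
      using solve[OF p(1)] by blast
    have upd: "(\<Sum>j<d. R j l * (z(p := x)) j) = (\<Sum>j\<in>{..<d}-{p}. R j l * z j) + R p l * x" for l
      using p(1) by (simp add: sum.remove[of _ p])
    have same: "(\<Sum>j<d. R j l * (z(p := x)) j) = (\<Sum>j<d. R j l * z j)" if "p < l" for l
      unfolding upd using p(1) low[OF that] by (simp add: sum.remove[of _ p])
    show ?case
    proof (intro exI[of _ "z(p := x)"] conjI allI impI)
      show "(z(p := x)) j \<in> A" if "d - Suc m \<le> j \<and> j < d" for j
        using that x(1) z(1)[of j] p p_def by auto
      show "Q l (\<Sum>j<d. R j l * (z(p := x)) j)" if l: "d - Suc m \<le> l \<and> l < d" for l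
      proof (cases "l = p")
        case True
        then show ?thesis using upd x(2) by simp
      next
        case False
        then have "p < l" using l p_def by auto
        then show ?thesis using same z(2)[of l] l p by auto
      qed
    qed
  qed
  from this[of d] show ?thesis by simp
qed

text \<open>Equation \<open>l\<close> involves only the unknowns from \<open>l\<close> on, so a
  bound propagates backwards from the last unknown. This makes the lattice points in a bounded
  region finite, both for the averaging and for the code.\<close>

lemma triangular_bounded:
  fixes R :: "nat \<Rightarrow> nat \<Rightarrow> real"
  assumes low: "\<And>j l. j < l \<Longrightarrow> R j l = 0"
    and diag: "\<And>j. j < d \<Longrightarrow> R j j > 0"
  shows "\<exists>b. \<forall>z. (\<forall>l<d. \<bar>\<Sum>j<d. R j l * z j\<bar> \<le> \<rho>) \<longrightarrow> (\<forall>j<d. \<bar>z j\<bar> \<le> b)"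
proof -
  have "\<exists>b. \<forall>z. (\<forall>l<d. \<bar>\<Sum>j<d. R j l * z j\<bar> \<le> \<rho>) \<longrightarrow>
          (\<forall>j. d - m \<le> j \<and> j < d \<longrightarrow> \<bar>z j\<bar> \<le> b)" if "m \<le> d" for m
    using that
  proof (induction m)
    case 0
    then show ?case by auto
  next
    case (Suc m)
    then obtain b where b: "\<And>z j. (\<And>l. l < d \<Longrightarrow> \<bar>\<Sum>j<d. R j l * z j\<bar> \<le> \<rho>) \<Longrightarrow>
        d - m \<le> j \<Longrightarrow> j < d \<Longrightarrow> \<bar>z j\<bar> \<le> b" by (metis Suc_leD)
    define p where "p = d - Suc m"
    have p: "p < d" "d - m = Suc p" using Suc.prems by (auto simp: p_def)
    \<comment> \<open>Equation \<open>p\<close> solved for \<open>z p\<close>: terms before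
      \<open>p\<close> vanish, those after it are bounded through the previous \<open>b\<close>. Its
      absolute value appears because \<open>b\<close> may be negative as long as it bounds
      nothing.\<close>
    define b' where "b' = max b ((\<rho> + (\<Sum>j<d. \<bar>R j p\<bar> * \<bar>b\<bar>)) / R p p)"
    show ?case
    proof (intro exI[of _ b'] allI impI)
      fix z j assume z: "\<forall>l<d. \<bar>\<Sum>j<d. R j l * z j\<bar> \<le> \<rho>" and j: "d - Suc m \<le> j \<and> j < d"
      have zb: "\<bar>z j\<bar> \<le> b" if "p < j" "j < d" for j
        using b[of z j] z that p by auto
      show "\<bar>z j\<bar> \<le> b'"
      proof (cases "j = p")
        case False
        then show ?thesis using zb[of j] j p_def by (auto simp: b'_def)
      next
        case True
        have "(\<Sum>j<d. R j p * z j) = R p p * z p + (\<Sum>j\<in>{..<d}-{p}. R j p * z j)"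
          using p(1) by (simp add: sum.remove[of _ p])
        moreover have "\<bar>\<Sum>j\<in>{..<d}-{p}. R j p * z j\<bar> \<le> (\<Sum>j\<in>{..<d}-{p}. \<bar>R j p\<bar> * \<bar>b\<bar>)"
        proof (rule order_trans[OF sum_abs], rule sum_mono)
          fix j assume "j \<in> {..<d}-{p}"
          then show "\<bar>R j p * z j\<bar> \<le> \<bar>R j p\<bar> * \<bar>b\<bar>"
            using low[of j p] zb[of j] by (cases "j < p") (auto simp: abs_mult intro!: mult_left_mono)
        qed
        moreover have "\<dots> \<le> (\<Sum>j<d. \<bar>R j p\<bar> * \<bar>b\<bar>)"
          by (rule sum_mono2) auto
        moreover have "\<bar>\<Sum>j<d. R j p * z j\<bar> \<le> \<rho>" using z p(1) by blast
        ultimately have "\<bar>R p p * z p\<bar> \<le> \<rho> + (\<Sum>j<d. \<bar>R j p\<bar> * \<bar>b\<bar>)" by linarith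
        then have "\<bar>z p\<bar> \<le> (\<rho> + (\<Sum>j<d. \<bar>R j p\<bar> * \<bar>b\<bar>)) / R p p"
          using diag[OF p(1)] by (simp add: abs_mult field_simps)
        then show ?thesis using True by (auto simp: b'_def)
      qed
    qed
  qed
  from this[of d] show ?thesis by simp
qed

section \<open>Counting lattice points in a ball by averaging\<close>

lemma distr_translation_PiM_lborel:
  fixes t :: "nat \<Rightarrow> real"
  assumes "finite J"
  shows "distr (\<Pi>\<^sub>M j\<in>J. lborel) (\<Pi>\<^sub>M j\<in>J. lborel) (\<lambda>x. \<lambda>j\<in>J. x j + t j) = (\<Pi>\<^sub>M j\<in>J. lborel)"
proof -
  interpret product_sigma_finite "\<lambda>_::nat. lborel :: real measure" ..
  show ?thesis
  proof (rule PiM_eqI[OF assms])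
    fix A :: "nat \<Rightarrow> real set"
    assume A: "\<And>i. i \<in> J \<Longrightarrow> A i \<in> sets lborel"
    have "(\<lambda>x. \<lambda>j\<in>J. x j + t j) -` Pi\<^sub>E J A \<inter> space (\<Pi>\<^sub>M j\<in>J. lborel) = (\<Pi>\<^sub>E j\<in>J. (\<lambda>x. x + t j) -` A j)"
      by (auto simp: space_PiM PiE_iff)
    then have "emeasure (distr (\<Pi>\<^sub>M j\<in>J. lborel) (\<Pi>\<^sub>M j\<in>J. lborel) (\<lambda>x. \<lambda>j\<in>J. x j + t j)) (Pi\<^sub>E J A) =
       emeasure (\<Pi>\<^sub>M j\<in>J. lborel) (\<Pi>\<^sub>E j\<in>J. (\<lambda>x. x + t j) -` A j)"
      using assms A by (subst emeasure_distr) auto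
    also have "\<dots> = (\<Prod>j\<in>J. emeasure lborel ((\<lambda>x. x + t j) -` A j))"
      using A by (intro emeasure_PiM assms) (auto intro: measurable_sets_borel[of _ borel])
    also have "\<dots> = (\<Prod>j\<in>J. emeasure lborel (A j))"
    proof (rule prod.cong[OF refl])
      fix j assume "j \<in> J"
      have "emeasure lborel (A j) = emeasure (distr lborel borel ((+) (t j))) (A j)"
        by (simp only: lborel_distr_plus)
      also have "\<dots> = emeasure lborel ((\<lambda>x. x + t j) -` A j)"
        using A[OF \<open>j \<in> J\<close>] by (subst emeasure_distr) (auto simp: add.commute vimage_def)
      finally show "emeasure lborel ((\<lambda>x. x + t j) -` A j) = emeasure lborel (A j)" by simp
    qed
    finally show "emeasure (distr (\<Pi>\<^sub>M j\<in>J. lborel) (\<Pi>\<^sub>M j\<in>J. lborel) (\<lambda>x. \<lambda>j\<in>J. x j + t j)) (Pi\<^sub>E J A)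
        = (\<Prod>j\<in>J. emeasure lborel (A j))" .
  qed simp
qed

lemma int_abs_le_ceiling:
  assumes "\<bar>real_of_int z\<bar> \<le> b"
  shows "-\<lceil>b\<rceil> \<le> z \<and> z \<le> \<lceil>b\<rceil>"
proof -
  have "real_of_int z \<le> real_of_int \<lceil>b\<rceil>" "real_of_int (- z) \<le> real_of_int \<lceil>b\<rceil>"
    using assms le_of_int_ceiling[of b] unfolding abs_le_iff of_int_minus by linarith+
  then show ?thesis unfolding of_int_le_iff by simp
qed

text \<open>Blichfeldt's principle: moving each piece of the ball back into the box turns its volume
  into the integral, over offsets in the box, of the number of lattice translates landing in the
  ball, and the best offset is at least as good as the mean. \<open>Z\<close> is extensional so that
  distinct coefficient vectors will yield distinct codewords.\<close>

lemma lattice_averaging: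
  fixes R :: "nat \<Rightarrow> nat \<Rightarrow> real"
  assumes low: "\<And>j l. j < l \<Longrightarrow> R j l = 0"
    and diag: "\<And>j. j < d \<Longrightarrow> R j j > 0"
    and r: "r > 0" and \<alpha>: "\<alpha> > 0"
  shows "\<exists>u Z. finite Z \<and> Z \<subseteq> extensional {..<d} \<and>
    (\<forall>z\<in>Z. (\<Sum>l<d. (u l + \<alpha> * (\<Sum>j<d. R j l * real_of_int (z j)))\<^sup>2) \<le> r\<^sup>2) \<and>
    unit_ball_vol (real d) * r ^ d \<le> real (card Z) * (\<alpha> ^ d * (\<Prod>j<d. R j j))"
proof -
  interpret product_sigma_finite "\<lambda>_::nat. lborel :: real measure" ..
  define N where "N = (\<Pi>\<^sub>M l\<in>{..<d}. (lborel :: real measure))"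
  define Ball where "Ball = {f. sqrt (\<Sum>l<d. (f l)\<^sup>2) \<le> r} \<inter> space N"
  define Box where "Box = (\<Pi>\<^sub>E l\<in>{..<d}. {0..<\<alpha> * R l l})"
  define \<Lambda> where "\<Lambda> z l = \<alpha> * (\<Sum>j<d. R j l * real_of_int (z j))" for z l
  define \<tau> where "\<tau> z u = (\<lambda>l\<in>{..<d}. u l + \<Lambda> z l)" for z :: "nat \<Rightarrow> int" and u
  \<comment> \<open>A coordinate of a ball point minus a box point is at most \<open>r\<close> plus
    one side of the box; the sum of all sides gives one bound for every coordinate.\<close>
  define \<rho> where "\<rho> = (r + (\<Sum>l<d. \<alpha> * R l l)) / \<alpha>"
  have "\<exists>b. \<forall>z. (\<forall>l<d. \<bar>\<Sum>j<d. R j l * z j\<bar> \<le> \<rho>) \<longrightarrow> (\<forall>j<d. \<bar>z j\<bar> \<le> b)"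
    by (rule triangular_bounded) (fact low diag)+
  then obtain b where b': "\<forall>z. (\<forall>l<d. \<bar>\<Sum>j<d. R j l * z j\<bar> \<le> \<rho>) \<longrightarrow> (\<forall>j<d. \<bar>z j\<bar> \<le> b)" ..
  have b: "\<bar>z j\<bar> \<le> b" if "\<And>l. l < d \<Longrightarrow> \<bar>\<Sum>j<d. R j l * z j\<bar> \<le> \<rho>" "j < d" for z j
    using b'[rule_format, of z j] that by blast
  define Z where "Z = (\<Pi>\<^sub>E j\<in>{..<d}. {-\<lceil>b\<rceil>..\<lceil>b\<rceil>})"
  have finZ: "finite Z" unfolding Z_def by (intro finite_PiE) auto
  have N_sets: "Ball \<in> sets N" "Box \<in> sets N"
  proof -
    have "Ball = {f \<in> space N. sqrt (\<Sum>l<d. (f l)\<^sup>2) \<le> r}" by (auto simp: Ball_def)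
    then show "Ball \<in> sets N" unfolding N_def by simp
    show "Box \<in> sets N" unfolding Box_def N_def by (intro sets_PiM_I_finite) auto
  qed
  have \<tau>_meas: "\<tau> z \<in> N \<rightarrow>\<^sub>M N" for z unfolding \<tau>_def N_def by measurable
  \<comment> \<open>Rounding down coordinate by coordinate, from the last to the first, leaves a
    remainder of \<open>y\<close> in the box.\<close>
  have cover: "\<exists>z\<in>Z. \<exists>u\<in>Box. y = \<tau> z u" if y: "y \<in> Ball" for y
  proof -
    have "\<exists>z. (\<forall>j<d. z j \<in> \<int>) \<and>
       (\<forall>l<d. y l - \<alpha> * (\<Sum>j<d. R j l * z j) \<in> {0..<\<alpha> * R l l})"
    proof (rule triangular_system[OF low])
      fix l s assume l: "l < d"
      let ?a = "\<alpha> * R l l" and ?x = "y l - \<alpha> * s"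
      have a: "?a > 0" using \<alpha> diag[OF l] by simp
      have "of_int \<lfloor>?x / ?a\<rfloor> \<le> ?x / ?a" "?x / ?a < of_int \<lfloor>?x / ?a\<rfloor> + 1" by linarith+
      then have "of_int \<lfloor>?x / ?a\<rfloor> * ?a \<le> ?x" "?x < (of_int \<lfloor>?x / ?a\<rfloor> + 1) * ?a"
        using a by (simp_all only: pos_le_divide_eq pos_divide_less_eq)
      then show "\<exists>z\<in>\<int>. y l - \<alpha> * (s + R l l * z) \<in> {0..<\<alpha> * R l l}"
        by (intro bexI[of _ "of_int \<lfloor>?x / ?a\<rfloor>"]) (auto simp: algebra_simps)
    qed
    then obtain z where z: "\<And>j. j < d \<Longrightarrow> z j \<in> \<int>"
      "\<And>l. l < d \<Longrightarrow> y l - \<alpha> * (\<Sum>j<d. R j l * z j) \<in> {0..<\<alpha> * R l l}" by blast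
    define w where "w = (\<lambda>j\<in>{..<d}. \<lfloor>z j\<rfloor>)"
    have w: "real_of_int (w j) = z j" if "j < d" for j
      using z(1)[OF that] that by (auto simp: w_def elim: Ints_cases)
    have yl: "\<bar>y l\<bar> \<le> r" if "l < d" for l
    proof -
      have "(y l)\<^sup>2 \<le> (\<Sum>l<d. (y l)\<^sup>2)" using that by (intro member_le_sum) auto
      then have "sqrt ((y l)\<^sup>2) \<le> sqrt (\<Sum>l<d. (y l)\<^sup>2)" by (rule real_sqrt_le_mono)
      then show ?thesis using y by (simp add: Ball_def)
    qed
    have "\<bar>z j\<bar> \<le> b" if "j < d" for j
    proof (rule b[OF _ that])
      fix l assume l: "l < d"
      have "\<alpha> * R l l \<le> (\<Sum>l<d. \<alpha> * R l l)"
        using l \<alpha> diag by (intro member_le_sum) (auto intro: less_imp_le)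
      then have "\<bar>\<alpha> * (\<Sum>j<d. R j l * z j)\<bar> \<le> r + (\<Sum>l<d. \<alpha> * R l l)"
        using z(2)[OF l] yl[OF l] by (auto simp: abs_le_iff)
      then show "\<bar>\<Sum>j<d. R j l * z j\<bar> \<le> \<rho>"
        using \<alpha> by (simp add: \<rho>_def abs_mult field_simps)
    qed
    then have "-\<lceil>b\<rceil> \<le> w j \<and> w j \<le> \<lceil>b\<rceil>" if "j < d" for j
      using int_abs_le_ceiling[of "w j" b] w[OF that] that by simp
    then have "w \<in> Z"
      by (auto simp: Z_def w_def PiE_iff)
    define u where "u = (\<lambda>l\<in>{..<d}. y l - \<alpha> * (\<Sum>j<d. R j l * z j))"
    have "u \<in> Box" using z(2) by (auto simp: u_def Box_def)
    moreover have "y = \<tau> w u"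
      using y w by (auto simp: \<tau>_def u_def \<Lambda>_def Ball_def N_def space_PiM PiE_iff extensional_def fun_eq_iff)
    ultimately show ?thesis using \<open>w \<in> Z\<close> by blast
  qed
  define S where "S u = {z \<in> Z. \<tau> z u \<in> Ball}" for u
  have fin: "finite ((\<lambda>u. card (S u)) ` Box)"
    by (rule finite_subset[of _ "{..card Z}"]) (auto simp: S_def intro!: card_mono finZ)
  have "(\<lambda>l\<in>{..<d}. 0) \<in> Box" using \<alpha> diag by (auto simp: Box_def)
  then have "(\<lambda>u. card (S u)) ` Box \<noteq> {}" by blast
  with fin have "Max ((\<lambda>u. card (S u)) ` Box) \<in> (\<lambda>u. card (S u)) ` Box"
    by (rule Max_in)
  then obtain u where u_Max: "u \<in> Box" "card (S u) = Max ((\<lambda>u. card (S u)) ` Box)" by (auto elim!: imageE)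
  have u: "card (S v) \<le> card (S u)" if "v \<in> Box" for v
    unfolding u_Max(2) by (rule Max_ge[OF fin imageI[OF that]])
  define T where "T z = {y \<in> Ball. \<exists>u\<in>Box. y = \<tau> z u}" for z
  have T_sets: "T z \<in> sets N" for z
  proof -
    define \<sigma> where "\<sigma> y = (\<lambda>l\<in>{..<d}. y l - \<Lambda> z l)" for y
    have \<sigma>_meas: "\<sigma> \<in> N \<rightarrow>\<^sub>M N" unfolding \<sigma>_def N_def by measurable
    have "T z = Ball \<inter> (\<sigma> -` Box \<inter> space N)"
    proof (intro Set.set_eqI iffI)
      fix y assume "y \<in> T z"
      then obtain u where "y \<in> Ball" "u \<in> Box" "y = \<tau> z u" by (auto simp: T_def)
      moreover have "\<sigma> (\<tau> z u) = u" using \<open>u \<in> Box\<close>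
        by (auto simp: \<sigma>_def \<tau>_def Box_def PiE_iff extensional_def fun_eq_iff)
      ultimately show "y \<in> Ball \<inter> (\<sigma> -` Box \<inter> space N)" by (auto simp: Ball_def)
    next
      fix y assume y: "y \<in> Ball \<inter> (\<sigma> -` Box \<inter> space N)"
      then have "y = \<tau> z (\<sigma> y)"
        by (auto simp: \<sigma>_def \<tau>_def N_def space_PiM PiE_iff extensional_def fun_eq_iff)
      then show "y \<in> T z" using y unfolding T_def by blast
    qed
    then show ?thesis
      using N_sets \<sigma>_meas by (auto intro!: sets.Int measurable_sets)
  qed
  have shift: "emeasure N (T z) = emeasure N {u \<in> Box. \<tau> z u \<in> Ball}" for z
  proof -
    have inj: "v = u" if "u \<in> Box" "v \<in> space N" "\<tau> z v = \<tau> z u" for u v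
    proof
      fix l
      from fun_cong[OF that(3), of l] show "v l = u l"
        using that(1,2) by (cases "l < d") (auto simp: \<tau>_def N_def Box_def space_PiM PiE_iff extensional_def)
    qed
    have "emeasure N (T z) = emeasure (distr N N (\<tau> z)) (T z)"
      unfolding \<tau>_def N_def by (subst distr_translation_PiM_lborel) simp_all
    also have "\<dots> = emeasure N (\<tau> z -` T z \<inter> space N)"
      by (intro emeasure_distr \<tau>_meas T_sets)
    also have "\<tau> z -` T z \<inter> space N = {u \<in> Box. \<tau> z u \<in> Ball}"
    proof (intro Set.set_eqI iffI)
      fix v assume v: "v \<in> \<tau> z -` T z \<inter> space N"
      then obtain u where "u \<in> Box" "\<tau> z v = \<tau> z u" "\<tau> z v \<in> Ball" by (auto simp: T_def)
      then show "v \<in> {u \<in> Box. \<tau> z u \<in> Ball}" using inj[of u v] v by auto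
    next
      fix v assume "v \<in> {u \<in> Box. \<tau> z u \<in> Ball}"
      then show "v \<in> \<tau> z -` T z \<inter> space N"
        using sets.sets_into_space[OF N_sets(2)] unfolding T_def by blast
    qed
    finally show ?thesis .
  qed
  have meas': "{u \<in> Box. \<tau> z u \<in> Ball} \<in> sets N" for z
  proof -
    have "{u \<in> Box. \<tau> z u \<in> Ball} = Box \<inter> (\<tau> z -` Ball \<inter> space N)"
      using sets.sets_into_space[OF N_sets(2)] by auto
    then show ?thesis using N_sets \<tau>_meas by (auto intro!: sets.Int measurable_sets)
  qed
  \<comment> \<open>The pieces only have to cover: subadditivity bounds the volume of the ball from
    above, which is the direction wanted.\<close>
  have "Ball = (\<Union>z\<in>Z. T z)"
    using cover by (auto simp: T_def)
  then have "emeasure N Ball \<le> (\<Sum>z\<in>Z. emeasure N (T z))"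
    using emeasure_subadditive_finite[OF finZ, of T N] T_sets by auto
  also have "\<dots> = (\<Sum>z\<in>Z. \<integral>\<^sup>+u. indicator {u \<in> Box. \<tau> z u \<in> Ball} u \<partial>N)"
    unfolding shift using meas' by simp
  also have "\<dots> = (\<integral>\<^sup>+u. (\<Sum>z\<in>Z. indicator {u \<in> Box. \<tau> z u \<in> Ball} u) \<partial>N)"
    using meas' by (subst nn_integral_sum) auto
  also have "\<dots> \<le> (\<integral>\<^sup>+v. of_nat (card (S u)) * indicator Box v \<partial>N)"
  proof (rule nn_integral_mono)
    fix v assume "v \<in> space N"
    have "(\<Sum>z\<in>Z. indicator {u \<in> Box. \<tau> z u \<in> Ball} v) = (of_nat (card (S v)) * indicator Box v :: ennreal)"
      using finZ by (auto simp: indicator_def S_def sum.If_cases Int_def)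
    also have "\<dots> \<le> of_nat (card (S u)) * indicator Box v"
      using u[of v] by (auto simp: indicator_def)
    finally show "(\<Sum>z\<in>Z. indicator {u \<in> Box. \<tau> z u \<in> Ball} v) \<le> (of_nat (card (S u)) * indicator Box v :: ennreal)" .
  qed
  also have "\<dots> = of_nat (card (S u)) * emeasure N Box"
    using N_sets by (simp add: nn_integral_cmult)
  also have "emeasure N Box = (\<Prod>l<d. ennreal (\<alpha> * R l l))"
  proof -
    have "emeasure lborel {0..<\<alpha> * R l l} = ennreal (\<alpha> * R l l)" if "l < d" for l
    proof -
      have "0 \<le> \<alpha> * R l l" using \<alpha> diag[OF that] by simp
      then show ?thesis by simp
    qed
    then show ?thesis unfolding N_def Box_def by (subst emeasure_PiM) auto
  qed
  also have "\<dots> = ennreal (\<alpha> ^ d * (\<Prod>l<d. R l l))"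
    using \<alpha> diag by (subst prod_ennreal) (auto simp: prod.distrib intro!: less_imp_le)
  also have "emeasure N Ball = ennreal (unit_ball_vol (real d) * r ^ d)"
    unfolding Ball_def N_def using emeasure_cball_aux[of "{..<d}" r] r by simp
  finally have "ennreal (unit_ball_vol (real d) * r ^ d) \<le>
      ennreal (real (card (S u)) * (\<alpha> ^ d * (\<Prod>l<d. R l l)))"
    using \<alpha> diag by (simp add: ennreal_mult' ennreal_of_nat_eq_real_of_nat)
  then have "unit_ball_vol (real d) * r ^ d \<le> real (card (S u)) * (\<alpha> ^ d * (\<Prod>l<d. R l l))"
  proof (subst (asm) ennreal_le_iff)
    show "0 \<le> real (card (S u)) * (\<alpha> ^ d * (\<Prod>l<d. R l l))"
      by (intro mult_nonneg_nonneg prod_nonneg) (use \<alpha> diag in \<open>auto simp: less_imp_le\<close>)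
  qed
  moreover have "(\<Sum>l<d. (u l + \<alpha> * (\<Sum>j<d. R j l * real_of_int (z j)))\<^sup>2) \<le> r\<^sup>2" if "z \<in> S u" for z
  proof -
    have "sqrt (\<Sum>l<d. (u l + \<Lambda> z l)\<^sup>2) \<le> r"
      using that by (simp add: S_def Ball_def \<tau>_def)
    then show ?thesis by (simp add: \<Lambda>_def sqrt_le_D)
  qed
  moreover have "finite (S u)"
    unfolding S_def using finZ by simp
  moreover have "S u \<subseteq> extensional {..<d}"
    by (auto simp: S_def Z_def PiE_iff)
  ultimately show ?thesis by blast
qed

section \<open>Lattice bases and their triangular coordinates\<close>

lemma word_inner_eq: "word_inner k X Y = (\<Sum>i=1..k. inner (X i) (Y i))"
  by (simp add: word_inner_def Re_trace_mult_cadj)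

lemma word_norm_combination:
  "(word_norm k (\<lambda>i. \<Sum>j<d. c j *\<^sub>R B j i))\<^sup>2 = (\<Sum>i<d. \<Sum>j<d. c i * c j * word_inner k (B i) (B j))"
proof -
  have "(word_norm k (\<lambda>i. \<Sum>j<d. c j *\<^sub>R B j i))\<^sup>2 = (\<Sum>m=1..k. inner (\<Sum>i<d. c i *\<^sub>R B i m) (\<Sum>j<d. c j *\<^sub>R B j m))"
    by (simp add: word_norm_def sum_nonneg power2_norm_eq_inner)
  also have "\<dots> = (\<Sum>m=1..k. \<Sum>i<d. \<Sum>j<d. c i * c j * inner (B i m) (B j m))"
    by (simp only: inner_sum_left) (simp add: inner_sum_right sum_distrib_left mult_ac)
  also have "\<dots> = (\<Sum>i<d. \<Sum>j<d. \<Sum>m=1..k. c i * c j * inner (B i m) (B j m))"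
    by (subst sum.swap, intro sum.cong refl, rule sum.swap)
  finally show ?thesis by (simp add: word_inner_eq sum_distrib_left)
qed

text \<open>Independence makes the Gram form positive definite. Its Cholesky factor sends
  coefficient vectors to coordinates in which \<open>word_norm\<close> is Euclidean and the covolume
  is a product of diagonal entries.\<close>

lemma lattice_basis_triangular:
  fixes B :: "nat \<Rightarrow> 'n::finite word"
  assumes "lattice_basis k d B L"
  obtains R where "\<And>j l. j < l \<Longrightarrow> R j l = 0" "\<And>j. j < d \<Longrightarrow> R j j > 0"
    "\<And>c. (word_norm k (\<lambda>i. \<Sum>j<d. c j *\<^sub>R B j i))\<^sup>2 = (\<Sum>l<d. (\<Sum>j<d. R j l * c j)\<^sup>2)"
    "lattice_vol k d B = (\<Prod>j<d. R j j)"
proof -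
  let ?G = "\<lambda>i j. word_inner k (B i) (B j)"
  have B: "\<And>j i. j < d \<Longrightarrow> i \<notin> {1..k} \<Longrightarrow> B j i = 0"
    and ind: "\<And>c. (\<And>i. (\<Sum>j<d. c j *\<^sub>R B j i) = 0) \<Longrightarrow> \<forall>j<d. c j = 0"
    using assms by (auto simp: lattice_basis_def words_def)
  have "\<exists>R. (\<forall>j l. j < l \<longrightarrow> R j l = 0) \<and> (\<forall>j<d. R j j > 0) \<and>
           (\<forall>i<d. \<forall>j<d. ?G i j = (\<Sum>l<d. R i l * R j l))"
  proof (rule cholesky)
    show "?G i j = ?G j i" for i j by (simp add: word_inner_eq inner_commute)
    fix c :: "nat \<Rightarrow> real" assume c: "\<exists>j<d. c j \<noteq> 0"
    have "(word_norm k (\<lambda>i. \<Sum>j<d. c j *\<^sub>R B j i))\<^sup>2 \<noteq> 0"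
    proof
      assume "(word_norm k (\<lambda>i. \<Sum>j<d. c j *\<^sub>R B j i))\<^sup>2 = 0"
      then have 0: "(\<Sum>j<d. c j *\<^sub>R B j i) = 0" if "i \<in> {1..k}" for i
        using that by (simp add: word_norm_def sum_nonneg sum_nonneg_eq_0_iff)
      \<comment> \<open>The norm sees only the blocks in \<open>{1..k}\<close>, but basis words
        vanish elsewhere, so the whole combination is zero.\<close>
      have "(\<Sum>j<d. c j *\<^sub>R B j i) = 0" for i
        by (cases "i \<in> {1..k}") (use 0 B in auto)
      then show False using ind c by blast
    qed
    then show "(\<Sum>i<d. \<Sum>j<d. c i * c j * ?G i j) > 0"
      unfolding word_norm_combination[symmetric] by (simp add: less_le)
  qed
  then obtain R where R: "\<And>j l. j < l \<Longrightarrow> R j l = 0" "\<And>j. j < d \<Longrightarrow> R j j > 0"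
    "\<And>i j. i < d \<Longrightarrow> j < d \<Longrightarrow> ?G i j = (\<Sum>l<d. R i l * R j l)" by blast
  show thesis
  proof (rule that[of R, OF R(1,2)])
    fix c
    have "(\<Sum>l<d. (\<Sum>j<d. R j l * c j)\<^sup>2) = (\<Sum>l<d. \<Sum>i<d. \<Sum>j<d. c i * c j * (R i l * R j l))"
      by (simp add: power2_eq_square sum_product mult_ac)
    also have "\<dots> = (\<Sum>i<d. \<Sum>l<d. \<Sum>j<d. c i * c j * (R i l * R j l))"
      by (rule sum.swap)
    also have "\<dots> = (\<Sum>i<d. \<Sum>j<d. \<Sum>l<d. c i * c j * (R i l * R j l))"
      by (intro sum.cong refl sum.swap)
    also have "\<dots> = (\<Sum>i<d. \<Sum>j<d. c i * c j * ?G i j)"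
      by (intro sum.cong refl) (simp add: R(3) sum_distrib_left)
    finally show "(word_norm k (\<lambda>i. \<Sum>j<d. c j *\<^sub>R B j i))\<^sup>2 = (\<Sum>l<d. (\<Sum>j<d. R j l * c j)\<^sup>2)"
      by (simp add: word_norm_combination)
  next
    have "0 \<le> (\<Prod>j<d. R j j)" using R(2) by (intro prod_nonneg) (auto intro: less_imp_le)
    then show "lattice_vol k d B = (\<Prod>j<d. R j j)"
      unfolding lattice_vol_def by (subst det_cholesky[OF R(1,3)]) auto
  qed
qed

lemma word_norm_eq_L2_set: "word_norm k X = L2_set (\<lambda>i. norm (X i)) {1..k}"
  by (simp add: word_norm_def L2_set_def)

lemma word_norm_triangle: "word_norm k (\<lambda>i. X i + Y i) \<le> word_norm k X + word_norm k Y"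
proof -
  have "word_norm k (\<lambda>i. X i + Y i) \<le> L2_set (\<lambda>i. norm (X i) + norm (Y i)) {1..k}"
    unfolding word_norm_eq_L2_set by (intro L2_set_mono norm_triangle_ineq) auto
  also have "\<dots> \<le> word_norm k X + word_norm k Y"
    unfolding word_norm_eq_L2_set by (rule L2_set_triangle_ineq)
  finally show ?thesis .
qed

text \<open>Coefficient sequences that differ only from \<open>d\<close> on give the same word.
  Extensionality fixes those values, which makes the parametrization injective
  (\<open>lattice_basis_inj\<close>) and its domain countable.\<close>

lemma lattice_basis_eq_image:
  assumes "lattice_basis k d B L"
  shows "L = (\<lambda>z i. \<Sum>j<d. real_of_int (z j) *\<^sub>R B j i) ` (\<Pi>\<^sub>E j\<in>{..<d}. UNIV)"
proof -
  let ?Y = "\<lambda>z i. \<Sum>j<d. real_of_int (z j) *\<^sub>R B j i"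
  have L: "L = {?Y z | z. True}" using assms by (simp add: lattice_basis_def)
  show ?thesis
  proof (intro Set.set_eqI iffI)
    fix X assume "X \<in> L"
    then obtain z where "X = ?Y z" unfolding L by blast
    then have "X = ?Y (restrict z {..<d})" by simp
    then show "X \<in> ?Y ` (\<Pi>\<^sub>E j\<in>{..<d}. UNIV)" by (intro image_eqI[where x = "restrict z {..<d}"]) simp_all
  next
    fix X assume "X \<in> ?Y ` (\<Pi>\<^sub>E j\<in>{..<d}. UNIV)"
    then show "X \<in> L" unfolding L by blast
  qed
qed

lemma lattice_basis_inj:
  assumes "lattice_basis k d B L"
  shows "inj_on (\<lambda>z i. \<Sum>j<d. real_of_int (z j) *\<^sub>R B j i) (\<Pi>\<^sub>E j\<in>{..<d}. UNIV)"
proof (rule inj_onI)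
  fix z w :: "nat \<Rightarrow> int"
  assume zw: "z \<in> (\<Pi>\<^sub>E j\<in>{..<d}. UNIV)" "w \<in> (\<Pi>\<^sub>E j\<in>{..<d}. UNIV)"
    and eq: "(\<lambda>i. \<Sum>j<d. real_of_int (z j) *\<^sub>R B j i) = (\<lambda>i. \<Sum>j<d. real_of_int (w j) *\<^sub>R B j i)"
  have 0: "(\<Sum>j<d. real_of_int (z j - w j) *\<^sub>R B j i) = 0" for i
    using fun_cong[OF eq, of i] by (simp add: scaleR_diff_left sum_subtractf)
  have "(\<forall>i. (\<Sum>j<d. c j *\<^sub>R B j i) = 0) \<longrightarrow> (\<forall>j<d. c j = 0)" for c :: "nat \<Rightarrow> real"
    using assms by (simp add: lattice_basis_def)
  from this[of "\<lambda>j. real_of_int (z j - w j)"] have "\<forall>j<d. real_of_int (z j - w j) = 0"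
    using 0 by blast
  then show "z = w" using zw by (intro PiE_ext) auto
qed

lemma lattice_basis_countable:
  assumes "lattice_basis k d B L"
  shows "countable L"
  unfolding lattice_basis_eq_image[OF assms] by (intro countable_image countable_PiE) auto

lemma lattice_basis_words:
  assumes "lattice_basis k d B L"
  shows "L \<subseteq> words k"
  using assms by (auto simp: lattice_basis_def words_def)

lemma lattice_basis_diff:
  assumes "lattice_basis k d B L" "X \<in> L" "Y \<in> L"
  shows "(\<lambda>i. X i - Y i) \<in> L"
proof -
  from assms obtain z w where "X = (\<lambda>i. \<Sum>j<d. real_of_int (z j) *\<^sub>R B j i)"
    "Y = (\<lambda>i. \<Sum>j<d. real_of_int (w j) *\<^sub>R B j i)"
    by (auto simp: lattice_basis_def)
  then have "(\<lambda>i. X i - Y i) = (\<lambda>i. \<Sum>j<d. real_of_int (z j - w j) *\<^sub>R B j i)"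
    by (simp add: scaleR_diff_left sum_subtractf)
  moreover have "L = {\<lambda>i. \<Sum>j<d. real_of_int (z j) *\<^sub>R B j i | z. True}"
    using assms(1) by (simp add: lattice_basis_def)
  ultimately show ?thesis by (simp only: mem_Collect_eq) (rule exI[of _ "\<lambda>j. z j - w j"], simp)
qed

text \<open>Finiteness matters twice: an infinite set has \<open>card\<close> 0 and could not
  witness admissibility, and the codeword is drawn uniformly.\<close>

lemma finite_lattice_code:
  assumes basis: "lattice_basis k d B L" and \<alpha>: "\<alpha> > 0"
  shows "finite (lattice_code k P \<alpha> X L)"
proof -
  obtain R where low: "\<And>j l. j < l \<Longrightarrow> R j l = 0" and diag: "\<And>j. j < d \<Longrightarrow> R j j > 0"
    and norm: "\<And>c. (word_norm k (\<lambda>i. \<Sum>j<d. c j *\<^sub>R B j i))\<^sup>2 = (\<Sum>l<d. (\<Sum>j<d. R j l * c j)\<^sup>2)"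
    by (rule lattice_basis_triangular[OF basis]) (rule that)
  \<comment> \<open>Triangle inequality: a codeword minus the shift, divided by the scale, has norm
    at most \<open>\<rho>\<close>.\<close>
  define \<rho> where "\<rho> = (sqrt (P * real k * real CARD('a)) + word_norm k (\<lambda>i. - X i)) / \<alpha>"
  have "\<exists>b. \<forall>z. (\<forall>l<d. \<bar>\<Sum>j<d. R j l * z j\<bar> \<le> \<rho>) \<longrightarrow> (\<forall>j<d. \<bar>z j\<bar> \<le> b)"
    by (rule triangular_bounded) (fact low diag)+
  then obtain b where b: "\<forall>z. (\<forall>l<d. \<bar>\<Sum>j<d. R j l * z j\<bar> \<le> \<rho>) \<longrightarrow> (\<forall>j<d. \<bar>z j\<bar> \<le> b)" ..
  define Z where "Z = (\<Pi>\<^sub>E j\<in>{..<d}. {-\<lceil>b\<rceil>..\<lceil>b\<rceil>})"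
  have "finite Z" unfolding Z_def by (intro finite_PiE) auto
  moreover have "lattice_code k P \<alpha> X L \<subseteq> (\<lambda>z i. X i + \<alpha> *\<^sub>R (\<Sum>j<d. real_of_int (z j) *\<^sub>R B j i)) ` Z"
  proof
    fix W assume W: "W \<in> lattice_code k P \<alpha> X L"
    then obtain z where z: "z \<in> (\<Pi>\<^sub>E j\<in>{..<d}. UNIV)"
      and W_eq: "W = (\<lambda>i. X i + \<alpha> *\<^sub>R (\<Sum>j<d. real_of_int (z j) *\<^sub>R B j i))"
      unfolding lattice_code_def shifted_lattice_def lattice_basis_eq_image[OF basis] by blast
    let ?Y = "\<lambda>i. \<Sum>j<d. real_of_int (z j) *\<^sub>R B j i"
    have "word_norm k (\<lambda>i. \<alpha> *\<^sub>R ?Y i) = \<alpha> * word_norm k ?Y"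
      using \<alpha> by (simp add: word_norm_def power_mult_distrib sum_distrib_left[symmetric] real_sqrt_mult)
    moreover have "word_norm k (\<lambda>i. \<alpha> *\<^sub>R ?Y i) \<le> word_norm k W + word_norm k (\<lambda>i. - X i)"
      using word_norm_triangle[of k W "\<lambda>i. - X i"] by (simp add: W_eq)
    moreover have "word_norm k W \<le> sqrt (P * real k * real CARD('a))"
      using W by (simp add: lattice_code_def)
    ultimately have Y: "word_norm k ?Y \<le> \<rho>"
      using \<alpha> by (simp add: \<rho>_def field_simps)
    have "\<bar>\<Sum>j<d. R j l * z j\<bar> \<le> \<rho>" if "l < d" for l
    proof -
      have "(\<Sum>j<d. R j l * z j)\<^sup>2 \<le> (word_norm k ?Y)\<^sup>2"
        unfolding norm using that by (intro member_le_sum) auto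
      then have "\<bar>\<Sum>j<d. R j l * z j\<bar> \<le> word_norm k ?Y"
        unfolding abs_le_square_iff[symmetric] by (simp add: word_norm_eq_L2_set)
      then show ?thesis using Y by simp
    qed
    then have zb: "\<bar>real_of_int (z j)\<bar> \<le> b" if "j < d" for j
      using b[THEN spec, of "\<lambda>j. real_of_int (z j)"] that by simp
    have "-\<lceil>b\<rceil> \<le> z j \<and> z j \<le> \<lceil>b\<rceil>" if "j < d" for j
      by (rule int_abs_le_ceiling[OF zb[OF that]])
    then have "z \<in> Z" using z by (auto simp: Z_def PiE_iff)
    then show "W \<in> (\<lambda>z i. X i + \<alpha> *\<^sub>R (\<Sum>j<d. real_of_int (z j) *\<^sub>R B j i)) ` Z"
      using W_eq by blast
  qed
  ultimately show ?thesis by (meson finite_imageI finite_subset)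
qed

lemma lattice_vol_pos:
  assumes "lattice_basis k d B L"
  shows "lattice_vol k d B > 0"
proof -
  obtain R :: "nat \<Rightarrow> nat \<Rightarrow> real"
    where "\<And>j. j < d \<Longrightarrow> R j j > 0" "lattice_vol k d B = (\<Prod>j<d. R j j)"
    by (rule lattice_basis_triangular[OF assms]) (rule that)
  then show ?thesis by (auto intro!: prod_pos)
qed

section \<open>The code scale and existence of admissible shifts\<close>

lemma code_scale_pos:
  assumes "n > 0" "k > 0" "P > 0" "V > 0"
  shows "code_scale n k P R V > 0"
  using assms by (simp add: code_scale_def ball_const_def)

text \<open>The right-hand side is the volume of the ball of radius sqrt(P n k), and the power of
  the scale times \<open>V\<close> is the covolume of the scaled lattice. The scale is the one for
  which their ratio is 2^(R n k).\<close>

lemma code_scale_power: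
  assumes "n > 0" "k > 0" "P > 0" "V > 0"
  shows "code_scale n k P R V ^ (2 * n\<^sup>2 * k) * V * 2 powr (R * real n * real k) =
     ball_const n k * P ^ (n\<^sup>2 * k)"
proof -
  define m where "m = n\<^sup>2 * k"
  have m: "m > 0" using assms by (simp add: m_def)
  have root: "(x powr (1 / real m)) ^ m = x" if "x > 0" for x :: real
    using that m by (simp add: powr_realpow[symmetric] powr_powr)
  have "R / real n * real m = R * real n * real k"
    using assms(1) by (simp add: m_def power2_eq_square)
  then have rate: "(2 powr (R / real n)) ^ m = 2 powr (R * real n * real k)"
    by (simp add: powr_realpow[symmetric] powr_powr)
  have C: "ball_const n k > 0" using assms by (simp add: ball_const_def)
  have "code_scale n k P R V ^ (2 * n\<^sup>2 * k) = ((code_scale n k P R V)\<^sup>2) ^ m"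
    by (simp add: m_def power_mult[symmetric] mult.assoc)
  also have "(code_scale n k P R V)\<^sup>2 = ball_const n k powr (1 / real m) * P / (2 powr (R / real n) * V powr (1 / real m))"
    using assms C by (simp add: code_scale_def m_def)
  also have "\<dots> ^ m = ball_const n k * P ^ m / (2 powr (R * real n * real k) * V)"
    by (simp add: power_divide power_mult_distrib root C assms(4) rate)
  finally show ?thesis using assms(4) by (simp add: m_def)
qed

lemma admissible_shift_exists:
  fixes B :: "nat \<Rightarrow> 'n::finite word"
  defines "n \<equiv> CARD('n)"
  assumes basis: "lattice_basis k (2 * n\<^sup>2 * k) B L" and k: "k > 0" and P: "P > 0"
  shows "\<exists>X. admissible_shift k P R (code_scale n k P R (lattice_vol k (2 * n\<^sup>2 * k) B)) L X"
proof -
  define d where "d = 2 * n\<^sup>2 * k"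
  define V where "V = lattice_vol k d B"
  define \<alpha> where "\<alpha> = code_scale n k P R V"
  define r where "r = sqrt (P * real k * real n)"
  have n: "n > 0" by (simp add: n_def)
  have basis: "lattice_basis k d B L" using basis by (simp add: d_def)
  have V: "V > 0" using lattice_vol_pos[OF basis] by (simp add: V_def)
  have \<alpha>: "\<alpha> > 0" unfolding \<alpha>_def by (intro code_scale_pos n k P V)
  have r: "r > 0" using n k P by (simp add: r_def)
  obtain T where low: "\<And>j l. j < l \<Longrightarrow> T j l = 0" and diag: "\<And>j. j < d \<Longrightarrow> T j j > 0"
    and norm: "\<And>c. (word_norm k (\<lambda>i. \<Sum>j<d. c j *\<^sub>R B j i))\<^sup>2 = (\<Sum>l<d. (\<Sum>j<d. T j l * c j)\<^sup>2)"
    and lattice_vol: "lattice_vol k d B = (\<Prod>j<d. T j j)"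
    by (rule lattice_basis_triangular[OF basis]) (rule that)
  then have vol: "V = (\<Prod>j<d. T j j)" by (simp add: V_def)
  obtain u Z where Z: "finite Z" "Z \<subseteq> extensional {..<d}"
    "\<And>z. z \<in> Z \<Longrightarrow> (\<Sum>l<d. (u l + \<alpha> * (\<Sum>j<d. T j l * real_of_int (z j)))\<^sup>2) \<le> r\<^sup>2"
    and card: "unit_ball_vol (real d) * r ^ d \<le> real (card Z) * (\<alpha> ^ d * V)"
    unfolding vol using lattice_averaging[where R = T and d = d and r = r and \<alpha> = \<alpha>, OF low diag r \<alpha>] by blast
  \<comment> \<open>The averaging delivers the offset in triangular coordinates; solving the system
    over the reals pulls it back to a word.\<close>
  have "\<exists>c. (\<forall>j<d. c j \<in> UNIV) \<and> (\<forall>l<d. (\<Sum>j<d. T j l * c j) = u l)"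
  proof (rule triangular_system[OF low])
    fix l and s :: real assume "l < d"
    then show "\<exists>z\<in>UNIV. s + T l l * z = u l"
      using diag[of l] by (intro bexI[of _ "(u l - s) / T l l"]) auto
  qed
  then obtain c where c: "\<And>l. l < d \<Longrightarrow> (\<Sum>j<d. T j l * c j) = u l" by blast
  define X where "X = (\<lambda>i. \<Sum>j<d. c j *\<^sub>R B j i)"
  have X: "X \<in> words k" using basis by (auto simp: X_def words_def lattice_basis_def)
  let ?Y = "\<lambda>z i. \<Sum>j<d. real_of_int (z j) *\<^sub>R B j i"
  define C where "C = lattice_code k P \<alpha> X L"
  have finC: "finite C" unfolding C_def by (rule finite_lattice_code[OF basis \<alpha>])
  have sub: "(\<lambda>z i. X i + \<alpha> *\<^sub>R ?Y z i) ` Z \<subseteq> C"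
  proof safe
    fix z assume z: "z \<in> Z"
    have "z \<in> (\<Pi>\<^sub>E j\<in>{..<d}. UNIV)" using z Z(2) by (auto simp: PiE_iff)
    then have "?Y z \<in> L" unfolding lattice_basis_eq_image[OF basis] by blast
    moreover have "(word_norm k (\<lambda>i. X i + \<alpha> *\<^sub>R ?Y z i))\<^sup>2 \<le> r\<^sup>2"
    proof -
      have "(\<lambda>i. X i + \<alpha> *\<^sub>R ?Y z i) = (\<lambda>i. \<Sum>j<d. (c j + \<alpha> * real_of_int (z j)) *\<^sub>R B j i)"
        by (simp add: X_def scaleR_add_left sum.distrib scaleR_sum_right)
      moreover have "(\<Sum>j<d. T j l * (c j + \<alpha> * real_of_int (z j))) = u l + \<alpha> * (\<Sum>j<d. T j l * real_of_int (z j))"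
        if "l < d" for l
        unfolding c[OF that, symmetric] sum_distrib_left sum.distrib[symmetric]
        by (rule sum.cong) (simp_all add: algebra_simps)
      ultimately show ?thesis using Z(3)[OF z] by (simp add: norm)
    qed
    then have "word_norm k (\<lambda>i. X i + \<alpha> *\<^sub>R ?Y z i) \<le> r"
      using r by (simp add: power2_le_iff_abs_le abs_le_iff)
    ultimately show "(\<lambda>i. X i + \<alpha> *\<^sub>R ?Y z i) \<in> C"
      using X lattice_basis_words[OF basis]
      by (auto simp: C_def lattice_code_def shifted_lattice_def r_def n_def words_def)
  qed
  have "inj_on (\<lambda>z i. X i + \<alpha> *\<^sub>R ?Y z i) Z"
  proof (rule inj_onI)
    fix z w assume zw: "z \<in> Z" "w \<in> Z" "(\<lambda>i. X i + \<alpha> *\<^sub>R ?Y z i) = (\<lambda>i. X i + \<alpha> *\<^sub>R ?Y w i)"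
    have "?Y z = ?Y w" using zw(3) \<alpha> by (simp add: fun_eq_iff)
    then show "z = w"
      using inj_onD[OF lattice_basis_inj[OF basis], of z w] zw(1,2) Z(2) by (auto simp: PiE_iff)
  qed
  then have "card Z \<le> card C" using card_inj_on_le[OF _ sub finC] by blast
  then have card_le: "real (card Z) * (\<alpha> ^ d * V) \<le> real (card C) * (\<alpha> ^ d * V)"
    using \<alpha> V by (intro mult_right_mono) auto
  have vol_eq: "unit_ball_vol (real d) * r ^ d = 2 powr (R * real n * real k) * (\<alpha> ^ d * V)"
  proof -
    have "d = 2 * (n\<^sup>2 * k)" by (simp add: d_def)
    then have "unit_ball_vol (real d) = pi ^ (n\<^sup>2 * k) / fact (n\<^sup>2 * k)"
      using unit_ball_vol_even[of "n\<^sup>2 * k"] by simp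
    moreover have "r ^ d = (P * real k * real n) ^ (n\<^sup>2 * k)"
      using P unfolding \<open>d = 2 * (n\<^sup>2 * k)\<close> power_mult by (simp add: r_def)
    ultimately have "unit_ball_vol (real d) * r ^ d = ball_const n k * P ^ (n\<^sup>2 * k)"
      by (simp add: ball_const_def power_mult_distrib mult_ac)
    also have "\<dots> = \<alpha> ^ d * V * 2 powr (R * real n * real k)"
      unfolding \<alpha>_def d_def by (rule code_scale_power[OF n k P V, symmetric])
    finally show ?thesis by (simp add: mult_ac)
  qed
  have "2 powr (R * real n * real k) * (\<alpha> ^ d * V) \<le> real (card C) * (\<alpha> ^ d * V)"
    by (rule order_trans[OF card[unfolded vol_eq] card_le])
  then have "2 powr (R * real n * real k) \<le> real (card C)"
    by (rule mult_right_le_imp_le) (simp add: \<alpha> V)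
  then show ?thesis
    using X by (intro exI[of _ X]) (simp add: admissible_shift_def C_def \<alpha>_def V_def d_def n_def)
qed

section \<open>Measurable minimum distance decoders\<close>

lemma continuous_on_matrix_mult:
  fixes X :: "complex ^ 'n ^ 'm"
  shows "continuous_on UNIV (\<lambda>h :: complex ^ 'm ^ 'r. h ** X)"
  unfolding matrix_matrix_mult_def
  by (intro continuous_on_vec_lambda continuous_intros)

text \<open>As the search set is countable, the first minimizer in an enumeration is a measurable
  choice. Where no minimizer exists the output falls back to the first element.\<close>

lemma minimum_distance_decoder_exists:
  fixes S :: "'n::finite word set"
  assumes S: "countable S" "S \<noteq> {}"
  shows "\<exists>D :: ('n, 'r::finite) decoder. minimum_distance_decoder k S D"
proof -
  define N :: "((nat \<Rightarrow> complex ^ 'n ^ 'r) \<times> (nat \<Rightarrow> complex ^ 'n ^ 'r)) measure"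
    where "N = (\<Pi>\<^sub>M i\<in>{1..k}. borel) \<Otimes>\<^sub>M (\<Pi>\<^sub>M i\<in>{1..k}. borel)"
  define \<mu> where "\<mu> q X = decoding_metric k (fst q) (snd q) X"
    for q :: "(nat \<Rightarrow> complex ^ 'n ^ 'r) \<times> (nat \<Rightarrow> complex ^ 'n ^ 'r)" and X
  \<comment> \<open>For finite \<open>S\<close> the enumeration repeats elements, which taking the
    \<open>LEAST\<close> index tolerates.\<close>
  define e where "e = from_nat_into S"
  have e: "e j \<in> S" for j by (simp add: e_def from_nat_into S(2))
  have e_surj: "\<exists>j. X = e j" if "X \<in> S" for X
    using that S(1) unfolding e_def by (metis from_nat_into_surj)
  have meas: "(\<lambda>q. \<mu> q X) \<in> borel_measurable N" for X
  proof -
    have mult: "(\<lambda>h :: complex ^ 'n ^ 'r. h ** X i) \<in> borel \<rightarrow>\<^sub>M borel" for i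
      by (intro borel_measurable_continuous_onI continuous_on_matrix_mult)
    have "(\<lambda>q. (norm (snd q i - fst q i ** X i))\<^sup>2) \<in> borel_measurable N" if "i \<in> {1..k}" for i
    proof -
      have "(\<lambda>q. fst q i) \<in> N \<rightarrow>\<^sub>M borel" "(\<lambda>q. snd q i) \<in> N \<rightarrow>\<^sub>M borel"
        using that unfolding N_def by measurable
      from measurable_compose[OF this(1) mult] this(2) show ?thesis by measurable
    qed
    then show ?thesis unfolding \<mu>_def decoding_metric_def by (rule borel_measurable_sum)
  qed
  define best where "best q j \<longleftrightarrow> (\<forall>l. \<mu> q (e j) \<le> \<mu> q (e l))" for q j
  define D where "D q = (if \<exists>j. best q j then e (LEAST j. best q j) else e 0)" for q
  have best_meas: "Measurable.pred N (\<lambda>q. best q j)" for j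
    unfolding best_def using meas by measurable
  have idx: "(\<lambda>q. if \<exists>j. best q j then (LEAST j. best q j) else 0) \<in> N \<rightarrow>\<^sub>M count_space UNIV"
    using best_meas by measurable
  have "D \<in> N \<rightarrow>\<^sub>M count_space S"
  proof -
    have "D = (\<lambda>q. e (if \<exists>j. best q j then (LEAST j. best q j) else 0))"
      by (rule ext) (simp add: D_def)
    moreover have "e \<in> count_space UNIV \<rightarrow>\<^sub>M count_space S" using e by simp
    ultimately show ?thesis using measurable_compose[OF idx, of e] by (simp only:)
  qed
  moreover have "is_arg_min (decoding_metric k h Y) (\<lambda>X'. X' \<in> S) (D (h, Y))"
    if "is_arg_min (decoding_metric k h Y) (\<lambda>X'. X' \<in> S) X" for h Y X
  proof -
    from that have X: "X \<in> S" "\<And>W. W \<in> S \<Longrightarrow> \<mu> (h, Y) X \<le> \<mu> (h, Y) W"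
      by (auto simp: is_arg_min_def \<mu>_def not_less)
    obtain j where "X = e j" using e_surj[OF X(1)] by blast
    then have j: "best (h, Y) j" using X e by (auto simp: best_def)
    define m where "m = (LEAST j. best (h, Y) j)"
    have best_m: "best (h, Y) m" unfolding m_def using j by (rule LeastI)
    have D_eq: "D (h, Y) = e m" using j by (auto simp: D_def m_def)
    show ?thesis
      unfolding is_arg_min_def not_ex
    proof (intro conjI allI)
      show "D (h, Y) \<in> S" using D_eq e by simp
      fix W
      show "\<not> (W \<in> S \<and> decoding_metric k h Y W < decoding_metric k h Y (D (h, Y)))"
      proof
        assume W: "W \<in> S \<and> decoding_metric k h Y W < decoding_metric k h Y (D (h, Y))"
        obtain l where "W = e l" using e_surj W by blast
        then have "decoding_metric k h Y (e m) \<le> decoding_metric k h Y W"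
          using best_m by (simp add: best_def \<mu>_def)
        then show False using W D_eq by simp
      qed
    qed
  qed
  ultimately show ?thesis
    unfolding minimum_distance_decoder_def N_def by (intro exI[of _ D]) blast
qed

section \<open>Averages of ergodic processes\<close>

text \<open>
  Garsia's argument: \<open>F n x\<close> below is the maximum of the first \<open>n\<close> ergodic sums and \<open>0\<close>.  If these
  maxima were unbounded almost surely, then $F_{n+1} - F_n \circ T$, whose integral is nonnegative,
  would converge dominatedly to \<open>g\<close>.
\<close>

lemma bounded_birkhoff_sums:
  fixes g :: "'a \<Rightarrow> real"
  assumes "prob_space N" and T: "T \<in> N \<rightarrow>\<^sub>M N" "distr N N T = N"
    and ergodic: "\<And>A. A \<in> sets N \<Longrightarrow> T -` A \<inter> space N = A \<Longrightarrow> measure N A \<in> {0, 1}"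
    and g: "integrable N g" "(\<integral>x. g x \<partial>N) < 0"
  shows "AE x in N. bdd_above (range (\<lambda>n. \<Sum>i<n. g ((T ^^ i) x)))"
proof -
  interpret prob_space N by fact
  \<comment> \<open>The sums at \<open>x\<close> are \<open>g x\<close> plus the sums at
    \<open>T x\<close>, so this recursion produces their running maximum with 0.\<close>
  define F where "F = rec_nat (\<lambda>_. 0) (\<lambda>_ f x. max 0 (g x + f (T x)))"
  have F0: "F 0 x = 0" and FS: "F (Suc n) x = max 0 (g x + F n (T x))" for n x
    by (simp_all add: F_def)
  have F_nonneg: "F n x \<ge> 0" for n x by (cases n) (simp_all add: F0 FS)
  have F_mono: "F n x \<le> F (Suc n) x" for n x
  proof (induction n arbitrary: x)
    case (Suc n)
    show ?case unfolding FS[of n x] FS[of "Suc n" x] using Suc[of "T x"] by (intro max.mono) auto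
  qed (simp add: F0 F_nonneg)
  have S_le: "(\<Sum>i<n. g ((T ^^ i) x)) \<le> F n x" for n x
  proof (induction n arbitrary: x)
    case (Suc n)
    have "(\<Sum>i<Suc n. g ((T ^^ i) x)) = g x + (\<Sum>i<n. g ((T ^^ i) (T x)))"
      by (simp add: sum.lessThan_Suc_shift funpow_swap1 del: sum.lessThan_Suc)
    then show ?case using Suc[of "T x"] by (simp add: FS)
  qed (simp add: F0)
  have comp: "integrable N (\<lambda>x. f (T x)) \<and> (\<integral>x. f (T x) \<partial>N) = (\<integral>x. f x \<partial>N)"
    if "integrable N f" for f :: "'a \<Rightarrow> real"
    using integrable_distr_eq[OF T(1), of f] integral_distr[OF T(1), of f] that T(2) by simp
  have F_int: "integrable N (F n)" for n
  proof (induction n)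
    case 0
    then show ?case by (simp add: F0)
  next
    case (Suc n)
    have "integrable N (\<lambda>x. max 0 (g x + F n (T x)))"
      using comp[OF Suc] g by (intro integrable_max Bochner_Integration.integrable_add) auto
    then show ?case by (simp add: FS[abs_def])
  qed
  have F_meas [measurable]: "F n \<in> borel_measurable N" for n
    using F_int by (rule borel_measurable_integrable)
  define A where "A = {x \<in> space N. \<forall>b::nat. \<exists>n. F n x > real b}"
  have A_sets: "A \<in> sets N" unfolding A_def by measurable
  have bdd: "x \<notin> A \<longleftrightarrow> (\<exists>b. \<forall>n. F n x \<le> b)" if "x \<in> space N" for x
  proof
    assume "x \<notin> A"
    then show "\<exists>b. \<forall>n. F n x \<le> b" using that by (force simp: A_def not_less)
  next
    assume "\<exists>b. \<forall>n. F n x \<le> b"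
    then obtain b where b: "\<And>n. F n x \<le> b" by blast
    obtain m :: nat where "b \<le> real m" using real_arch_simple by blast
    then have "\<not> F n x > real m" for n using b[of n] by linarith
    then show "x \<notin> A" by (auto simp: A_def)
  qed
  \<comment> \<open>The ergodicity hypothesis concerns strictly invariant sets, so invariance is
    shown pointwise: the maxima at \<open>x\<close> and at \<open>T x\<close> differ essentially by
    the finite number \<open>g x\<close> and are bounded together.\<close>
  have "T -` A \<inter> space N = A"
  proof -
    have "x \<in> A \<longleftrightarrow> T x \<in> A" if x: "x \<in> space N" for x
    proof -
      have Tx: "T x \<in> space N" using measurable_space[OF T(1) x] .
      have "(\<exists>b. \<forall>n. F n x \<le> b) \<longleftrightarrow> (\<exists>b. \<forall>n. F n (T x) \<le> b)"
      proof (intro iffI; elim exE)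
        fix b assume b: "\<forall>n. F n x \<le> b"
        have "F n (T x) \<le> b - g x" for n using b[rule_format, of "Suc n"] by (simp add: FS)
        then show "\<exists>b. \<forall>n. F n (T x) \<le> b" by blast
      next
        fix b assume b: "\<forall>n. F n (T x) \<le> b"
        have "F n x \<le> max 0 (g x + b)" for n
          using b by (cases n) (auto simp: FS F0 max_def intro: order_trans)
        then show "\<exists>b. \<forall>n. F n x \<le> b" by blast
      qed
      then show ?thesis using bdd[OF x] bdd[OF Tx] by blast
    qed
    then show ?thesis using sets.sets_into_space[OF A_sets] measurable_space[OF T(1)] by blast
  qed
  then have "measure N A \<in> {0, 1}" by (rule ergodic[OF A_sets])
  moreover have "measure N A \<noteq> 1"
  proof
    assume "measure N A = 1"
    then have "AE x in N. x \<in> A" using A_sets by (simp add: prob_eq_1)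
    then have TA: "AE x in N. T x \<in> A"
      by (intro AE_distrD[OF T(1)]) (simp only: T(2))
    define D where "D n x = F (Suc n) x - F n (T x)" for n x
    \<comment> \<open>As \<open>F n (T x)\<close> is nonnegative, \<open>D n x\<close> lies between
      \<open>g x\<close> and \<open>max 0 (g x)\<close>, hence is dominated by the absolute value of
      \<open>g x\<close>. It equals \<open>g x\<close> once \<open>F n (T x)\<close> has passed
      \<open>- g x\<close>.\<close>
    have D: "D n x = max (- F n (T x)) (g x)" for n x by (auto simp: D_def FS max_def)
    have "(\<lambda>n. \<integral>x. D n x \<partial>N) \<longlonglongrightarrow> (\<integral>x. g x \<partial>N)"
    proof (rule integral_dominated_convergence[where w = "\<lambda>x. \<bar>g x\<bar>"])
      show "AE x in N. (\<lambda>n. D n x) \<longlonglongrightarrow> g x"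
        using TA
      proof eventually_elim
        case (elim x)
        obtain m :: nat where m: "- g x \<le> real m" using real_arch_simple by blast
        from elim obtain n0 where n0: "F n0 (T x) > real m" unfolding A_def by blast
        have "F n (T x) \<ge> F n0 (T x)" if "n \<ge> n0" for n
          using that by (rule lift_Suc_mono_le[of "\<lambda>n. F n (T x)", rotated]) (rule F_mono)
        then have "D n x = g x" if "n \<ge> n0" for n
          using order_trans[OF less_imp_le[OF n0]] that m unfolding D by (force intro!: max_absorb2)
        then show ?case
          by (intro tendsto_eventually) (auto simp: eventually_sequentially intro!: exI[of _ n0])
      qed
      show "AE x in N. norm (D n x) \<le> \<bar>g x\<bar>" for n
        using F_nonneg by (auto simp: D max_def)
      show "D n \<in> borel_measurable N" for n unfolding D_def using T(1) by measurable
    qed (use g in auto)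
    moreover have "(\<integral>x. D n x \<partial>N) \<ge> 0" for n
    proof -
      have "(\<integral>x. D n x \<partial>N) = (\<integral>x. F (Suc n) x \<partial>N) - (\<integral>x. F n x \<partial>N)"
        unfolding D_def using comp[OF F_int[of n]] F_int[of "Suc n"] by simp
      moreover have "(\<integral>x. F n x \<partial>N) \<le> (\<integral>x. F (Suc n) x \<partial>N)"
        by (intro integral_mono F_int F_mono)
      ultimately show ?thesis by simp
    qed
    ultimately have "(\<integral>x. g x \<partial>N) \<ge> 0" by (intro LIMSEQ_le_const) auto
    then show False using g(2) by simp
  qed
  ultimately have "prob A = 0" by simp
  then have "AE x in N. x \<notin> A" using A_sets by (simp add: prob_eq_0)
  with AE_space show ?thesis
  proof eventually_elim
    case (elim x)
    then obtain b where "\<And>n. F n x \<le> b" using bdd by blast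
    then show ?case
      by (intro bdd_aboveI2[of _ _ b]) (rule order_trans[OF S_le])
  qed
qed

section \<open>Shift invariance and ergodic averages of a stationary process\<close>

lemma seq_shift_measurable:
  assumes "\<And>i. i \<in> I \<Longrightarrow> i + 1 \<in> I"
  shows "seq_shift I \<in> (\<Pi>\<^sub>M i\<in>I. borel) \<rightarrow>\<^sub>M (\<Pi>\<^sub>M i\<in>I. borel)"
  unfolding seq_shift_def using assms by (intro measurable_restrict measurable_component_singleton)

text \<open>Passes from tuples, in which stationarity is phrased, to finite index sets.
  \<open>t = 1\<close> serves the invariance of the law under the shift, and a one-element
  \<open>J\<close> the equality of marginals.\<close>

lemma stationary_process_cylinder:
  fixes X :: "int \<Rightarrow> 'a \<Rightarrow> 'b::topological_space"
  assumes "stationary_process M I X" and X: "\<And>i. i \<in> I \<Longrightarrow> X i \<in> borel_measurable M"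
    and J: "finite J" "J \<subseteq> I" "\<And>j. j \<in> J \<Longrightarrow> j + t \<in> I"
    and A: "\<And>j. j \<in> J \<Longrightarrow> A j \<in> sets borel"
  shows "emeasure M {\<omega> \<in> space M. \<forall>j\<in>J. X (j + t) \<omega> \<in> A j} = emeasure M {\<omega> \<in> space M. \<forall>j\<in>J. X j \<omega> \<in> A j}"
proof -
  define m where "m = card J"
  obtain f where "bij_betw f {0..<m} J"
    using ex_bij_betw_nat_finite[OF J(1)] unfolding m_def by blast
  then have f: "f ` {..<m} = J" by (auto simp: bij_betw_def lessThan_atLeast0)
  then have fJ: "f j \<in> J" if "j < m" for j using that by blast
  have ball_J: "(\<forall>j\<in>J. Q j) \<longleftrightarrow> (\<forall>j<m. Q (f j))" for Q using f by blast
  let ?N = "\<Pi>\<^sub>M j\<in>{..<m}. (borel :: 'b measure)"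
  let ?E = "\<Pi>\<^sub>E j\<in>{..<m}. A (f j)"
  have E: "?E \<in> sets ?N" using A fJ by (intro sets_PiM_I_finite) auto
  have eq: "emeasure (distr M ?N (\<lambda>\<omega>. \<lambda>j\<in>{..<m}. X (f j + s) \<omega>)) ?E =
      emeasure M {\<omega> \<in> space M. \<forall>j\<in>J. X (j + s) \<omega> \<in> A j}" if s: "\<And>j. j \<in> J \<Longrightarrow> j + s \<in> I" for s
  proof -
    have "(\<lambda>\<omega>. \<lambda>j\<in>{..<m}. X (f j + s) \<omega>) \<in> M \<rightarrow>\<^sub>M ?N"
      using fJ s X by (intro measurable_restrict) auto
    moreover have "(\<lambda>\<omega>. \<lambda>j\<in>{..<m}. X (f j + s) \<omega>) -` ?E \<inter> space M = {\<omega> \<in> space M. \<forall>j\<in>J. X (j + s) \<omega> \<in> A j}"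
      unfolding ball_J by (intro Set.set_eqI) (simp add: PiE_iff Ball_def conj_commute)
    ultimately show ?thesis by (simp add: emeasure_distr E)
  qed
  have "distr M ?N (\<lambda>\<omega>. \<lambda>j\<in>{..<m}. X (f j + t) \<omega>) = distr M ?N (\<lambda>\<omega>. \<lambda>j\<in>{..<m}. X (f j) \<omega>)"
    using assms(1) fJ J unfolding stationary_process_def by blast
  then show ?thesis using eq[of t] eq[of 0] J by auto
qed

lemma stationary_process_shift:
  fixes X :: "int \<Rightarrow> 'a \<Rightarrow> 'b::topological_space"
  assumes "prob_space M" "stationary_process M I X" and X: "\<And>i. i \<in> I \<Longrightarrow> X i \<in> borel_measurable M"
    and I: "\<And>i. i \<in> I \<Longrightarrow> i + 1 \<in> I"
  defines "N \<equiv> distr M (\<Pi>\<^sub>M i\<in>I. borel) (\<lambda>\<omega>. \<lambda>i\<in>I. X i \<omega>)"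
  shows "distr N N (seq_shift I) = N"
proof -
  let ?P = "\<Pi>\<^sub>M i\<in>I. (borel :: 'b measure)"
  have meas: "(\<lambda>\<omega>. \<lambda>i\<in>I. X i \<omega>) \<in> M \<rightarrow>\<^sub>M ?P" using X by (intro measurable_restrict)
  have T: "seq_shift I \<in> ?P \<rightarrow>\<^sub>M ?P" by (rule seq_shift_measurable[OF I])
  interpret prob_space M by fact
  have "distr N N (seq_shift I) = distr N ?P (seq_shift I)"
    by (rule distr_cong) (simp_all add: N_def)
  also have "\<dots> = distr M ?P (\<lambda>\<omega>. seq_shift I (\<lambda>i\<in>I. X i \<omega>))"
    unfolding N_def distr_distr[OF T meas] by (simp add: comp_def)
  also have "\<dots> = N"
  proof (rule measure_eqI_PiM_infinite)
    fix A and J :: "int set"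
    assume J: "finite J" "J \<subseteq> I" and A: "\<And>i. i \<in> J \<Longrightarrow> A i \<in> sets (borel :: 'b measure)"
    let ?E = "prod_emb I (\<lambda>_. borel) J (Pi\<^sub>E J A)"
    have E: "?E \<in> sets ?P" using J A by (intro sets_PiM_I) auto
    have 1: "(\<lambda>\<omega>. \<lambda>i\<in>I. X i \<omega>) -` ?E \<inter> space M = {\<omega> \<in> space M. \<forall>j\<in>J. X j \<omega> \<in> A j}"
      using J by (auto simp: prod_emb_def PiE_iff extensional_def subset_eq)
    have 2: "(\<lambda>\<omega>. seq_shift I (\<lambda>i\<in>I. X i \<omega>)) -` ?E \<inter> space M = {\<omega> \<in> space M. \<forall>j\<in>J. X (j + 1) \<omega> \<in> A j}"
      using J I by (auto simp: prod_emb_def PiE_iff extensional_def seq_shift_def subset_eq)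
    show "emeasure (distr M ?P (\<lambda>\<omega>. seq_shift I (\<lambda>i\<in>I. X i \<omega>))) ?E = emeasure N ?E"
      unfolding N_def emeasure_distr[OF meas E]
        emeasure_distr[OF measurable_compose[OF meas T] E] 1 2
      using J I by (intro stationary_process_cylinder[OF assms(2) X _ _ _ A]) auto
  next
    show "finite_measure (distr M ?P (\<lambda>\<omega>. seq_shift I (\<lambda>i\<in>I. X i \<omega>)))"
      by (intro prob_space.finite_measure prob_space_distr measurable_compose[OF meas T])
  qed (simp_all add: N_def)
  finally show ?thesis .
qed

text \<open>For \<open>c'\<close> strictly between \<open>c\<close> and the mean, the sums of
  \<open>c' - \<phi>\<close> are almost surely bounded, by a \<open>b\<close> depending on the
  sample. The gap (c' - c) k eventually exceeds \<open>b\<close>, and dominated convergence turns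
  this almost sure statement into a vanishing probability.\<close>

lemma ergodic_average_lower_bound:
  fixes X :: "int \<Rightarrow> 'a \<Rightarrow> 'b::topological_space" and \<phi> :: "'b \<Rightarrow> real"
  assumes "prob_space M" "stationary_process M I X" "ergodic_process M I X"
    and X: "\<And>i. i \<in> I \<Longrightarrow> X i \<in> borel_measurable M"
    and I: "\<And>i. i \<in> I \<Longrightarrow> i + 1 \<in> I" "1 \<in> I"
    and \<phi>: "\<phi> \<in> borel_measurable borel" "integrable M (\<lambda>\<omega>. \<phi> (X 1 \<omega>))"
    and c: "c < (\<integral>\<omega>. \<phi> (X 1 \<omega>) \<partial>M)"
  shows "(\<lambda>k. measure M {\<omega> \<in> space M. (\<Sum>i=1..k. \<phi> (X (int i) \<omega>)) < c * real k}) \<longlonglongrightarrow> 0"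
proof -
  let ?P = "\<Pi>\<^sub>M i\<in>I. (borel :: 'b measure)"
  let ?X = "\<lambda>\<omega>. \<lambda>i\<in>I. X i \<omega>"
  define N where "N = distr M ?P ?X"
  define T where "T = (seq_shift I :: (int \<Rightarrow> 'b) \<Rightarrow> int \<Rightarrow> 'b)"
  interpret prob_space M by fact
  have meas: "?X \<in> M \<rightarrow>\<^sub>M ?P" using X by (intro measurable_restrict)
  obtain c' where c': "c < c'" "c' < (\<integral>\<omega>. \<phi> (X 1 \<omega>) \<partial>M)" using dense[OF c] by blast
  define g where "g x = c' - \<phi> (x 1)" for x :: "int \<Rightarrow> 'b"
  have g_meas: "g \<in> borel_measurable ?P"
    unfolding g_def using \<phi>(1) I(2) by measurable
  have gX: "g (?X \<omega>) = c' - \<phi> (X 1 \<omega>)" for \<omega> using I(2) by (simp add: g_def)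
  have I_int: "1 + int i \<in> I" for i
  proof (induction i)
    case (Suc i)
    then show ?case using I(1)[of "1 + int i"] by (simp add: ac_simps)
  qed (simp add: I(2))
  have "AE x in N. bdd_above (range (\<lambda>n. \<Sum>i<n. g ((T ^^ i) x)))"
  proof (rule bounded_birkhoff_sums)
    show "prob_space N" unfolding N_def by (intro prob_space_distr meas)
    show "T \<in> N \<rightarrow>\<^sub>M N" unfolding N_def T_def using seq_shift_measurable[OF I(1)] by simp
    show "distr N N T = N" unfolding N_def T_def
      by (rule stationary_process_shift[OF assms(1,2) X I(1)])
    show "integrable N g" unfolding N_def using \<phi>(2)
      by (subst integrable_distr_eq[OF meas g_meas]) (simp add: gX)
    have "(\<integral>x. g x \<partial>N) = (\<integral>\<omega>. c' - \<phi> (X 1 \<omega>) \<partial>M)"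
      unfolding N_def by (subst integral_distr[OF meas g_meas]) (simp add: gX)
    then show "(\<integral>x. g x \<partial>N) < 0" using \<phi>(2) c'(2) by (simp add: prob_space)
    fix A assume "A \<in> sets N" "T -` A \<inter> space N = A"
    then show "measure N A \<in> {0, 1}"
      using assms(3) unfolding ergodic_process_def N_def T_def by simp
  qed
  then have "AE \<omega> in M. bdd_above (range (\<lambda>n. \<Sum>i<n. g ((T ^^ i) (?X \<omega>))))"
    unfolding N_def by (rule AE_distrD[OF meas])
  \<comment> \<open>Extensionality is what the case \<open>i = 0\<close> asks for: there
    \<open>x\<close> must equal its own restriction to \<open>I\<close>.\<close>
  moreover have iter: "(T ^^ i) x = (\<lambda>j\<in>I. x (j + int i))" if "x \<in> extensional I" for i x
  proof (induction i)
    case 0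
    then show ?case using that by (auto simp: extensional_def fun_eq_iff)
  next
    case (Suc i)
    then show ?case using I(1) by (auto simp: T_def seq_shift_def fun_eq_iff ac_simps)
  qed
  have sum_eq: "(\<Sum>i<n. g ((T ^^ i) (?X \<omega>))) = c' * real n - (\<Sum>i=1..n. \<phi> (X (int i) \<omega>))" for n \<omega>
  proof -
    have "(\<Sum>i<n. g ((T ^^ i) (?X \<omega>))) = (\<Sum>i<n. c' - \<phi> (X (int (Suc i)) \<omega>))"
      using I(2) I_int by (intro sum.cong) (auto simp: iter g_def ac_simps)
    also have "\<dots> = c' * real n - (\<Sum>i<n. \<phi> (X (int (Suc i)) \<omega>))"
      by (simp add: sum_subtractf)
    also have "(\<Sum>i<n. \<phi> (X (int (Suc i)) \<omega>)) = (\<Sum>i=1..n. \<phi> (X (int i) \<omega>))"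
      by (rule sum.reindex_bij_witness[of _ "\<lambda>i. i - 1" Suc]) auto
    finally show ?thesis .
  qed
  define E where "E k = {\<omega> \<in> space M. (\<Sum>i=1..k. \<phi> (X (int i) \<omega>)) < c * real k}" for k
  have \<phi>X: "(\<lambda>\<omega>. \<phi> (X (int i) \<omega>)) \<in> borel_measurable M" if "i \<in> {1..k}" for i k
  proof -
    have "int i \<in> I" using I_int[of "i - 1"] that by (simp add: of_nat_diff)
    then show ?thesis using measurable_compose[OF X \<phi>(1)] by blast
  qed
  then have E_sets: "E k \<in> sets M" for k unfolding E_def by measurable
  have "(\<lambda>k. \<integral>\<omega>. indicator (E k) \<omega> \<partial>M) \<longlonglongrightarrow> (\<integral>\<omega>. 0 \<partial>M :: real)"
  proof (rule integral_dominated_convergence[where w = "\<lambda>_. 1"])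
    show "AE \<omega> in M. (\<lambda>k. indicator (E k) \<omega> :: real) \<longlonglongrightarrow> 0"
      using calculation
    proof eventually_elim
      case (elim \<omega>)
      then obtain b where b: "\<And>n. c' * real n - (\<Sum>i=1..n. \<phi> (X (int i) \<omega>)) \<le> b"
        unfolding sum_eq bdd_above_def by blast
      obtain m :: nat where m: "b < real m * (c' - c)"
        using ex_less_of_nat_mult[of "c' - c" b] c'(1) by auto
      have "\<omega> \<notin> E k" if "k \<ge> m" for k
      proof
        assume "\<omega> \<in> E k"
        then have "real k * (c' - c) < b" using b[of k] by (simp add: E_def algebra_simps)
        moreover have "real m * (c' - c) \<le> real k * (c' - c)"
          using that c'(1) by (intro mult_right_mono) auto
        ultimately show False using m by linarith
      qed
      then show ?case
        by (intro tendsto_eventually) (auto simp: eventually_sequentially intro!: exI[of _ m])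
    qed
  qed (use E_sets in \<open>auto simp: indicator_def\<close>)
  then show ?thesis unfolding E_def[symmetric] using E_sets by simp
qed

section \<open>Projected Gaussian noise\<close>

text \<open>The fourth moment makes squared noise norms square integrable, as Chebyshev requires;
  mean zero removes the correlation of different entries; the second moment is 1/2 from each of the
  real and imaginary parts.\<close>

lemma complex_normal_moments:
  shows "prob_space complex_normal"
    and "integrable complex_normal (\<lambda>z. (cmod z) ^ 4)"
    and "integrable complex_normal (\<lambda>z. z)" and "(\<integral>z. z \<partial>complex_normal) = 0"
    and "(\<integral>z. (cmod z)\<^sup>2 \<partial>complex_normal) = 1"
proof -
  define \<nu> where "\<nu> = density lborel (\<lambda>x. ennreal (normal_density 0 (1 / sqrt 2) x))"
  define Q where "Q = \<nu> \<Otimes>\<^sub>M \<nu>"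
  interpret \<nu>: prob_space \<nu> unfolding \<nu>_def by (rule prob_space_normal_density) simp
  interpret Q: pair_prob_space \<nu> \<nu> ..
  have sets_\<nu> [measurable_cong]: "sets \<nu> = sets borel" by (simp add: \<nu>_def)
  have meas [measurable]: "(\<lambda>(x, y). Complex x y) \<in> borel_measurable Q"
    unfolding Q_def Complex_eq by measurable
  have cn: "complex_normal = distr Q borel (\<lambda>(x, y). Complex x y)"
    by (simp add: complex_normal_def Q_def \<nu>_def)
  show P: "prob_space complex_normal"
    unfolding cn Q_def by (rule Q.prob_space_distr) (use meas in \<open>simp add: Q_def\<close>)
  have mom: "integrable \<nu> (\<lambda>x. x ^ m)" for m
    unfolding \<nu>_def using integrable_normal_moment[of "1 / sqrt 2" 0 m]
    by (subst integrable_real_density) auto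
  have mom1: "(\<integral>x. x \<partial>\<nu>) = 0"
    unfolding \<nu>_def using integral_normal_moment_nz_1[of "1 / sqrt 2" 0]
    by (subst integral_real_density) auto
  have mom2: "(\<integral>x. x\<^sup>2 \<partial>\<nu>) = 1 / 2"
    unfolding \<nu>_def using integral_normal_moment_even[of "1 / sqrt 2" 0 1]
    by (subst integral_real_density) (auto simp: power_divide)
  have dfst: "distr Q \<nu> fst = \<nu>"
    unfolding Q_def by (rule \<nu>.distr_pair_fst)
  have dsnd: "distr Q \<nu> snd = \<nu>"
  proof -
    have "distr Q \<nu> snd = distr (distr Q Q (\<lambda>(x, y). (y, x))) \<nu> snd"
      unfolding Q_def by (subst Q.distr_pair_swap[symmetric]) (rule refl)
    also have "\<dots> = distr Q \<nu> fst"
      unfolding Q_def by (subst distr_distr) (auto simp: comp_def case_prod_beta)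
    finally show ?thesis using dfst by simp
  qed
  have fst: "integrable Q (\<lambda>p. f (fst p))" "(\<integral>p. f (fst p) \<partial>Q) = (\<integral>x. f x \<partial>\<nu>)"
    and snd: "integrable Q (\<lambda>p. f (snd p))" "(\<integral>p. f (snd p) \<partial>Q) = (\<integral>x. f x \<partial>\<nu>)"
    if "integrable \<nu> f" for f :: "real \<Rightarrow> real"
  proof -
    have m: "fst \<in> Q \<rightarrow>\<^sub>M \<nu>" "snd \<in> Q \<rightarrow>\<^sub>M \<nu>" unfolding Q_def by simp_all
    have "f \<in> borel_measurable \<nu>" using that by (rule borel_measurable_integrable)
    then show "integrable Q (\<lambda>p. f (fst p))" "(\<integral>p. f (fst p) \<partial>Q) = (\<integral>x. f x \<partial>\<nu>)"
      "integrable Q (\<lambda>p. f (snd p))" "(\<integral>p. f (snd p) \<partial>Q) = (\<integral>x. f x \<partial>\<nu>)"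
      using integrable_distr_eq[OF m(1), of f] integral_distr[OF m(1), of f]
        integrable_distr_eq[OF m(2), of f] integral_distr[OF m(2), of f] that dfst dsnd by simp_all
  qed
  have id: "integrable \<nu> (\<lambda>x. x)" using mom[of 1] by simp
  show "integrable complex_normal (\<lambda>z. (cmod z) ^ 4)"
    unfolding cn
  proof (subst integrable_distr_eq[OF meas])
    show "integrable Q (\<lambda>p. cmod (case p of (x, y) \<Rightarrow> Complex x y) ^ 4)"
    proof (rule Bochner_Integration.integrable_bound)
      show "integrable Q (\<lambda>p. 2 * (fst p) ^ 4 + 2 * (snd p) ^ 4)"
        using fst(1)[OF mom[of 4]] snd(1)[OF mom[of 4]] by simp
      show "AE p in Q. norm (cmod (case p of (x, y) \<Rightarrow> Complex x y) ^ 4) \<le> norm (2 * (fst p) ^ 4 + 2 * (snd p) ^ 4)"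
      proof (rule AE_I2)
        fix p :: "real \<times> real"
        obtain x y where p: "p = (x, y)" by (rule prod.exhaust)
        have "cmod (Complex x y) ^ 4 = (x\<^sup>2 + y\<^sup>2)\<^sup>2"
          by (simp add: cmod_def power4_eq_xxxx power2_eq_square mult.assoc[symmetric])
        also have "\<dots> \<le> 2 * x ^ 4 + 2 * y ^ 4"
          using sum_squares_ge_zero[of "x\<^sup>2 - y\<^sup>2" 0]
          by (simp add: power2_eq_square power4_eq_xxxx algebra_simps)
        finally show "norm (cmod (case p of (x, y) \<Rightarrow> Complex x y) ^ 4) \<le> norm (2 * (fst p) ^ 4 + 2 * (snd p) ^ 4)"
          by (simp add: p)
      qed
    qed (use meas in measurable)
  qed simp
  have eq: "(\<lambda>(x, y). Complex x y) = (\<lambda>p. complex_of_real (fst p) + \<i> * complex_of_real (snd p))"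
    by (auto simp: fun_eq_iff Complex_eq)
  have int: "integrable Q (\<lambda>p. complex_of_real (fst p) + \<i> * complex_of_real (snd p))"
    using fst(1)[OF id] snd(1)[OF id] by simp
  show "integrable complex_normal (\<lambda>z. z)"
    unfolding cn using int by (subst integrable_distr_eq[OF meas]) (simp_all add: eq)
  show "(\<integral>z. z \<partial>complex_normal) = 0"
    unfolding cn using fst[OF id] snd[OF id] mom1
    by (subst integral_distr[OF meas]) (simp_all add: eq)
  show "(\<integral>z. (cmod z)\<^sup>2 \<partial>complex_normal) = 1"
    unfolding cn using fst[OF mom[of 2]] snd[OF mom[of 2]] mom2
    by (subst integral_distr[OF meas]) (auto simp: cmod_power2 case_prod_beta)
qed

lemma sets_complex_normal [measurable_cong]: "sets complex_normal = sets borel"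
  by (simp add: complex_normal_def)

section \<open>Independence and moments of the noise blocks\<close>

context
  fixes k :: nat and N :: "(nat \<times> 'r::finite \<times> 'n::finite \<Rightarrow> complex) measure"
  assumes N_def: "N = noise k"
begin

lemma prob_space_noise: "prob_space N"
  unfolding N_def noise_def by (intro prob_space_PiM complex_normal_moments(1))

lemma noise_component:
  assumes "e \<in> {1..k} \<times> UNIV"
  shows "(\<lambda>w. w e) \<in> N \<rightarrow>\<^sub>M complex_normal" "distr N complex_normal (\<lambda>w. w e) = complex_normal"
proof -
  interpret product_prob_space "\<lambda>_. complex_normal" "{1..k} \<times> (UNIV :: ('r \<times> 'n) set)"
    by (rule product_prob_spaceI) (rule complex_normal_moments(1))
  show "(\<lambda>w. w e) \<in> N \<rightarrow>\<^sub>M complex_normal"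
    unfolding N_def noise_def using assms by measurable
  show "distr N complex_normal (\<lambda>w. w e) = complex_normal"
    unfolding N_def noise_def using assms by (rule PiM_component)
qed

lemma noise_measurable:
  assumes "e \<in> {1..k} \<times> UNIV"
  shows "(\<lambda>w. w e) \<in> borel_measurable N"
  using noise_component(1)[OF assms] by (simp only: measurable_cong_sets[OF refl sets_complex_normal])

lemma noise_coordinate:
  fixes f :: "complex \<Rightarrow> 'b::{banach, second_countable_topology}"
  assumes "e \<in> {1..k} \<times> UNIV" "f \<in> borel_measurable borel"
  shows "integrable N (\<lambda>w. f (w e)) \<longleftrightarrow> integrable complex_normal f"
    and "(\<integral>w. f (w e) \<partial>N) = (\<integral>z. f z \<partial>complex_normal)"
proof -
  have "f \<in> borel_measurable complex_normal" using assms(2) by simp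
  from integrable_distr_eq[OF noise_component(1)[OF assms(1)] this]
    integral_distr[OF noise_component(1)[OF assms(1)] this]
  show "integrable N (\<lambda>w. f (w e)) \<longleftrightarrow> integrable complex_normal f"
    "(\<integral>w. f (w e) \<partial>N) = (\<integral>z. f z \<partial>complex_normal)"
    by (simp_all add: noise_component(2)[OF assms(1)])
qed

text \<open>Coordinates of a product space are independent. The work lies in passing from
  \<open>complex_normal\<close> to \<open>borel\<close> as the target, which has the same measurable
  sets.\<close>

lemma noise_indep: "prob_space.indep_vars N (\<lambda>_. borel) (\<lambda>e w. w e) ({1..k} \<times> UNIV)"
\<comment> \<open>The characterization of independence by product laws asks for a nonempty index
  set.\<close>
proof (cases "k = 0")
  case True
  interpret prob_space N by (rule prob_space_noise)
  show ?thesis using True by (simp add: indep_vars_def indep_sets_def)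
next
  case False
  interpret prob_space N by (rule prob_space_noise)
  let ?E = "{1..k} \<times> (UNIV :: ('r \<times> 'n) set)"
  have ne: "?E \<noteq> {}" using False by auto
  have rv: "(\<lambda>w. w e) \<in> borel_measurable N" if "e \<in> ?E" for e
    using that by (rule noise_measurable)
  have "distr N (\<Pi>\<^sub>M e\<in>?E. borel) (\<lambda>w. \<lambda>e\<in>?E. w e) = distr N N (\<lambda>w. w)"
  proof (rule distr_cong)
    show "sets (\<Pi>\<^sub>M e\<in>?E. borel) = sets N"
      unfolding N_def noise_def by (intro sets_PiM_cong) (simp_all add: sets_complex_normal)
    show "(\<lambda>e\<in>?E. w e) = w" if "w \<in> space N" for w
      using that unfolding N_def noise_def space_PiM by (intro restrict_PiE_iff[THEN iffD1] ext) (auto simp: PiE_iff extensional_def)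
  qed simp
  also have "\<dots> = N" by (rule distr_id)
  also have "N = (\<Pi>\<^sub>M e\<in>?E. distr N borel (\<lambda>w. w e))"
  proof -
    have "distr N borel (\<lambda>w. w e) = complex_normal" if "e \<in> ?E" for e
    proof -
      have "distr N borel (\<lambda>w. w e) = distr N complex_normal (\<lambda>w. w e)"
        by (rule distr_cong) (simp_all add: sets_complex_normal)
      then show ?thesis using noise_component(2)[OF that] by simp
    qed
    then have "(\<Pi>\<^sub>M e\<in>?E. distr N borel (\<lambda>w. w e)) = (\<Pi>\<^sub>M e\<in>?E. complex_normal)"
      by (intro PiM_cong) auto
    then show ?thesis unfolding N_def noise_def by simp
  qed
  finally show ?thesis
    using indep_vars_iff_distr_eq_PiM'[OF ne, where M' = "\<lambda>_. borel" and X = "\<lambda>e w. w e"] rv by simp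
qed

lemma noise_covariance:
  assumes "i \<in> {1..k}"
  shows "integrable N (\<lambda>w. w (i, c, b) * cnj (w (i, a, b)))"
    and "(\<integral>w. w (i, c, b) * cnj (w (i, a, b)) \<partial>N) = (if a = c then 1 else 0)"
proof -
  interpret prob_space N by (rule prob_space_noise)
  have E: "(i, x, b) \<in> {1..k} \<times> (UNIV :: ('r \<times> 'n) set)" for x using assms by simp
  have "integrable N (\<lambda>w. w (i, c, b) * cnj (w (i, a, b))) \<and>
    (\<integral>w. w (i, c, b) * cnj (w (i, a, b)) \<partial>N) = (if a = c then 1 else 0)"
  proof (cases "a = c")
    case True
    interpret cn: prob_space complex_normal by (rule complex_normal_moments(1))
    have "integrable complex_normal (\<lambda>z. ((cmod z)\<^sup>2)\<^sup>2)"
      using complex_normal_moments(2) by (simp add: power_mult[symmetric])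
    then have "integrable complex_normal (\<lambda>z. (cmod z)\<^sup>2)"
      by (rule cn.square_integrable_imp_integrable[rotated]) measurable
    then have "integrable N (\<lambda>w. (cmod (w (i, c, b)))\<^sup>2)" "(\<integral>w. (cmod (w (i, c, b)))\<^sup>2 \<partial>N) = 1"
      using noise_coordinate[OF E, of "\<lambda>z. (cmod z)\<^sup>2" c] complex_normal_moments(5) by simp_all
    then show ?thesis
      using True by (simp add: complex_norm_square[symmetric] del: of_real_power)
  next
    case False
    \<comment> \<open>Only one of the two entries is conjugated, so that the product over
      \<open>?J\<close> is the mixed moment.\<close>
    define X where "X e w = (if e = (i, a, b) then cnj (w e) else w e)" for e and w :: "nat \<times> 'r \<times> 'n \<Rightarrow> complex"
    let ?J = "{(i, c, b), (i, a, b)}"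
    have "indep_vars (\<lambda>_. borel) (\<lambda>e w. w e) ?J"
      by (rule indep_vars_subset[OF noise_indep]) (use assms in auto)
    then have ind: "indep_vars (\<lambda>_. borel) X ?J"
      unfolding X_def
    proof (rule indep_vars_compose2[where Y = "\<lambda>e z. if e = (i, a, b) then cnj z else z"])
      have "cnj \<in> borel_measurable borel"
        by (intro borel_measurable_continuous_onI continuous_intros)
      then show "(\<lambda>z. if e = (i, a, b) then cnj z else z) \<in> borel_measurable borel" for e
        by (cases "e = (i, a, b)") simp_all
    qed
    have id: "(\<lambda>z :: complex. z) \<in> borel_measurable borel" by simp
    have z: "integrable N (\<lambda>w. w (i, x, b))" "(\<integral>w. w (i, x, b) \<partial>N) = 0" for x
      by (rule noise_coordinate(1)[OF E id, THEN iffD2, OF complex_normal_moments(3)])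
        (rule trans[OF noise_coordinate(2)[OF E id] complex_normal_moments(4)])
    have int: "integrable N (X e)" if "e \<in> ?J" for e
      using that z(1) False unfolding X_def by auto
    have "integrable N (\<lambda>w. \<Prod>e\<in>?J. X e w)"
      by (rule indep_vars_integrable[OF _ ind int]) auto
    moreover have "(\<integral>w. (\<Prod>e\<in>?J. X e w) \<partial>N) = (\<Prod>e\<in>?J. \<integral>w. X e w \<partial>N)"
      by (rule indep_vars_lebesgue_integral[OF _ ind int]) auto
    ultimately show ?thesis using False z(2) by (simp add: X_def)
  qed
  then show "integrable N (\<lambda>w. w (i, c, b) * cnj (w (i, a, b)))"
    and "(\<integral>w. w (i, c, b) * cnj (w (i, a, b)) \<partial>N) = (if a = c then 1 else 0)" by simp_all
qed

text \<open>The number of entries is squared in \<open>C\<close>: one factor comes from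
  Cauchy-Schwarz for the sum of squares, the other from summing the fourth moments.\<close>

lemma noise_block_fourth_moment:
  fixes i
  defines "C \<equiv> (real (CARD('r) * CARD('n)))\<^sup>2 * (\<integral>z. (cmod z) ^ 4 \<partial>complex_normal)"
  assumes i: "i \<in> {1..k}"
  shows "integrable N (\<lambda>w. (norm (noise_block w i)) ^ 4)"
    and "(\<integral>w. (norm (noise_block w i)) ^ 4 \<partial>N) \<le> C"
proof -
  let ?U = "UNIV :: ('r \<times> 'n) set"
  let ?g = "\<lambda>w. real (card ?U) * (\<Sum>p\<in>?U. (cmod (w (i, p))) ^ 4)"
  have int: "integrable N (\<lambda>w. (cmod (w (i, p))) ^ 4)" "(\<integral>w. (cmod (w (i, p))) ^ 4 \<partial>N) = (\<integral>z. (cmod z) ^ 4 \<partial>complex_normal)" for p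
    using noise_coordinate[of "(i, p)" "\<lambda>z. (cmod z) ^ 4"] complex_normal_moments(2) i by simp_all
  have sq: "(norm (noise_block w i))\<^sup>2 = (\<Sum>p\<in>?U. (cmod (w (i, p)))\<^sup>2)" for w :: "nat \<times> 'r \<times> 'n \<Rightarrow> complex"
  proof -
    have "(norm (noise_block w i))\<^sup>2 = (\<Sum>a\<in>UNIV. \<Sum>b\<in>UNIV. (cmod (w (i, a, b)))\<^sup>2)"
      by (simp add: norm_vec_def L2_set_def sum_nonneg noise_block_def)
    also have "\<dots> = (\<Sum>p\<in>?U. (cmod (w (i, p)))\<^sup>2)"
      by (subst sum.cartesian_product) (simp add: UNIV_Times_UNIV case_prod_beta)
    finally show ?thesis .
  qed
  have four: "(norm (noise_block w i)) ^ 4 = (\<Sum>p\<in>?U. (cmod (w (i, p)))\<^sup>2)\<^sup>2" for w :: "nat \<times> 'r \<times> 'n \<Rightarrow> complex"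
    unfolding sq[symmetric] by (simp add: power_mult[symmetric])
  have bound: "(norm (noise_block w i)) ^ 4 \<le> ?g w" for w :: "nat \<times> 'r \<times> 'n \<Rightarrow> complex"
    unfolding four using sum_squared_le_sum_of_squares[of "\<lambda>p. (cmod (w (i, p)))\<^sup>2" ?U]
    by (simp add: power_mult[symmetric] mult.commute)
  have coord: "(\<lambda>w. w (i, p)) \<in> borel_measurable N" for p
    using i by (intro noise_measurable) simp
  have g_int: "integrable N ?g" using int(1) by simp
  show block_int: "integrable N (\<lambda>w. (norm (noise_block w i)) ^ 4)"
  proof (rule Bochner_Integration.integrable_bound[OF g_int])
    show "(\<lambda>w. (norm (noise_block w i)) ^ 4) \<in> borel_measurable N"
      unfolding four using coord by measurable
    show "AE w in N. norm ((norm (noise_block w i)) ^ 4) \<le> norm (?g w)"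
      using bound by (intro AE_I2) (simp add: abs_of_nonneg sum_nonneg)
  qed
  have "(\<integral>w. (norm (noise_block w i)) ^ 4 \<partial>N) \<le> (\<integral>w. ?g w \<partial>N)"
    by (intro integral_mono block_int g_int bound)
  also have "\<dots> = C"
    using int by (simp add: C_def power2_eq_square)
  finally show "(\<integral>w. (norm (noise_block w i)) ^ 4 \<partial>N) \<le> C" .
qed

text \<open>White noise projected by \<open>p\<close> has expected energy trace(p) in each of its n
  columns, together n^2. The bound on the second moment comes from the fact that a projection
  shortens; it is the same for all \<open>p\<close>, hence uniform over the fading.\<close>

lemma projected_noise_moments:
  fixes p :: "complex ^ 'r ^ 'r"
  defines "C \<equiv> (real (CARD('r) * CARD('n)))\<^sup>2 * (\<integral>z. (cmod z) ^ 4 \<partial>complex_normal)"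
    and "Z \<equiv> \<lambda>i w. (norm (p ** noise_block w i :: complex ^ 'n ^ 'r))\<^sup>2"
  assumes i: "i \<in> {1..k}"
    and p: "cadj p = p" "p ** p = p" "Determinants.trace p = of_nat CARD('n)"
  shows "integrable N (Z i)" "integrable N (\<lambda>w. (Z i w)\<^sup>2)"
    "(\<integral>w. Z i w \<partial>N) = (real CARD('n))\<^sup>2" "(\<integral>w. (Z i w)\<^sup>2 \<partial>N) \<le> C"
proof -
  interpret prob_space N by (rule prob_space_noise)
  \<comment> \<open>A complex quadratic form with real part \<open>Z i\<close>, to which the complex
    covariances apply directly.\<close>
  define f where "f w = (\<Sum>a\<in>UNIV. \<Sum>b\<in>UNIV. \<Sum>c\<in>UNIV. p $ a $ c * (w (i, c, b) * cnj (w (i, a, b))))"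
    for w :: "nat \<times> 'r \<times> 'n \<Rightarrow> complex"
  have Z: "Z i w = Re (f w)" for w
  proof -
    have "Z i w = inner (p ** noise_block w i) (noise_block w i :: complex ^ 'n ^ 'r)"
      unfolding Z_def by (rule norm_projection(1)[OF p(1,2)])
    also have "\<dots> = (\<Sum>a\<in>UNIV. \<Sum>b\<in>UNIV. Re ((\<Sum>c\<in>UNIV. p $ a $ c * w (i, c, b)) * cnj (w (i, a, b))))"
      by (simp add: inner_vec_def inner_complex_def matrix_matrix_mult_def noise_block_def)
    also have "\<dots> = Re (f w)"
      by (simp only: f_def Re_sum sum_distrib_right mult.assoc)
    finally show ?thesis .
  qed
  have f_int: "integrable N f"
    unfolding f_def using noise_covariance(1)[OF i] by auto
  have "(\<integral>w. f w \<partial>N) = (\<Sum>a\<in>UNIV. \<Sum>b\<in>(UNIV :: 'n set). \<Sum>c\<in>UNIV. p $ a $ c * (if a = c then 1 else 0))"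
    unfolding f_def using noise_covariance[OF i] by (simp add: integral_sum)
  also have "\<dots> = of_nat CARD('n) * Determinants.trace p"
    by (simp add: Determinants.trace_def mult_delta_right sum_distrib_left)
  also have "\<dots> = of_nat (CARD('n) * CARD('n))"
    by (simp add: p(3))
  finally have "(\<integral>w. f w \<partial>N) = of_nat (CARD('n) * CARD('n))" .
  then show "(\<integral>w. Z i w \<partial>N) = (real CARD('n))\<^sup>2"
    unfolding Z using integral_bounded_linear[OF bounded_linear_Re f_int] by (simp add: power2_eq_square)
  show Z_int: "integrable N (Z i)"
    unfolding Z[abs_def] using f_int by simp
  have Z4: "(Z i w)\<^sup>2 \<le> (norm (noise_block w i :: complex ^ 'n ^ 'r)) ^ 4" for w
  proof -
    have "(Z i w)\<^sup>2 = (norm (p ** noise_block w i :: complex ^ 'n ^ 'r)) ^ 4"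
      by (simp add: Z_def power_mult[symmetric])
    also have "\<dots> \<le> (norm (noise_block w i :: complex ^ 'n ^ 'r)) ^ 4"
      by (intro power_mono norm_projection(2)[OF p(1,2)]) simp
    finally show ?thesis .
  qed
  show Z2_int: "integrable N (\<lambda>w. (Z i w)\<^sup>2)"
  proof (rule Bochner_Integration.integrable_bound[OF noise_block_fourth_moment(1)[OF i]])
    show "(\<lambda>w. (Z i w)\<^sup>2) \<in> borel_measurable N"
      using borel_measurable_integrable[OF Z_int] by measurable
    show "AE w in N. norm ((Z i w)\<^sup>2) \<le> norm (norm (noise_block w i :: complex ^ 'n ^ 'r) ^ 4)"
      using Z4 by simp
  qed
  have "(\<integral>w. (Z i w)\<^sup>2 \<partial>N) \<le> (\<integral>w. (norm (noise_block w i :: complex ^ 'n ^ 'r)) ^ 4 \<partial>N)"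
    by (intro integral_mono Z2_int noise_block_fourth_moment(1)[OF i] Z4)
  also have "\<dots> \<le> C" unfolding C_def by (rule noise_block_fourth_moment(2)[OF i])
  finally show "(\<integral>w. (Z i w)\<^sup>2 \<partial>N) \<le> C" .
qed

section \<open>Concentration of the projected noise\<close>

lemma projected_noise_indep:
  fixes p :: "nat \<Rightarrow> complex ^ 'r ^ 'r"
  shows "prob_space.indep_vars N (\<lambda>_. borel)
    (\<lambda>i w. (norm (p i ** noise_block w i :: complex ^ 'n ^ 'r))\<^sup>2) {1..k}"
proof -
  interpret prob_space N by (rule prob_space_noise)
  \<comment> \<open>The \<open>i\<close>-th summand written as a function of the noise entries of
    block \<open>i\<close> alone; disjoint groups of independent entries stay independent.\<close>
  define Y where "Y i v = (\<Sum>b\<in>(UNIV :: 'n set). \<Sum>a\<in>UNIV. (cmod (\<Sum>c\<in>UNIV. p i $ a $ c * v (i, c, b)))\<^sup>2)"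
    for i and v :: "nat \<times> 'r \<times> 'n \<Rightarrow> complex"
  let ?K = "\<lambda>i. {i} \<times> (UNIV :: ('r \<times> 'n) set)"
  have "indep_vars (\<lambda>i. PiM (?K i) (\<lambda>_. borel)) (\<lambda>i w. restrict (\<lambda>e. w e) (?K i)) {1..k}"
    by (rule indep_vars_restrict[OF noise_indep]) (auto simp: disjoint_family_on_def)
  then have "indep_vars (\<lambda>_. borel) (\<lambda>i w. Y i (restrict (\<lambda>e. w e) (?K i))) {1..k}"
  proof (rule indep_vars_compose2)
    fix i assume "i \<in> {1..k}"
    have "(\<lambda>v. v (i, c, b)) \<in> borel_measurable (PiM (?K i) (\<lambda>_. borel :: complex measure))" for c b
      by (rule measurable_component_singleton) simp
    then show "Y i \<in> PiM (?K i) (\<lambda>_. borel) \<rightarrow>\<^sub>M borel"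
      unfolding Y_def by measurable
  qed
  also have "(\<lambda>i w. Y i (restrict (\<lambda>e. w e) (?K i))) =
      (\<lambda>i w. (norm (p i ** noise_block w i :: complex ^ 'n ^ 'r))\<^sup>2)"
    by (intro ext) (simp add: norm_eq_sum_columns Y_def matrix_matrix_mult_def noise_block_def)
  finally show ?thesis .
qed

lemma projected_noise_sets:
  fixes p :: "nat \<Rightarrow> complex ^ 'r ^ 'r"
  shows "{w \<in> space N. (\<Sum>i=1..k. (norm (p i ** noise_block w i :: complex ^ 'n ^ 'r))\<^sup>2) \<ge> c} \<in> sets N"
proof -
  interpret prob_space N by (rule prob_space_noise)
  have "(\<lambda>w. (norm (p i ** noise_block w i :: complex ^ 'n ^ 'r))\<^sup>2) \<in> borel_measurable N" if "i \<in> {1..k}" for i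
    using projected_noise_indep[of p] that by (simp add: indep_vars_def)
  then have "(\<lambda>w. \<Sum>i=1..k. (norm (p i ** noise_block w i :: complex ^ 'n ^ 'r))\<^sup>2) \<in> borel_measurable N"
    by (rule borel_measurable_sum)
  then show ?thesis by measurable
qed

text \<open>Chebyshev for the centred sum: cross terms vanish, so the variance grows like k and the
  squared deviation like k^2. The bound is the same for all choices of projections, hence for all
  fading states.\<close>

lemma projected_noise_tail:
  fixes p :: "nat \<Rightarrow> complex ^ 'r ^ 'r"
  defines "C \<equiv> (real (CARD('r) * CARD('n)))\<^sup>2 * (\<integral>z. (cmod z) ^ 4 \<partial>complex_normal)"
  assumes k: "k > 0" and \<epsilon>: "\<epsilon> > 0"
    and p: "\<And>i. i \<in> {1..k} \<Longrightarrow> cadj (p i) = p i" "\<And>i. i \<in> {1..k} \<Longrightarrow> p i ** p i = p i"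
      "\<And>i. i \<in> {1..k} \<Longrightarrow> Determinants.trace (p i) = of_nat CARD('n)"
  shows "measure N {w \<in> space N. (\<Sum>i=1..k. (norm (p i ** noise_block w i :: complex ^ 'n ^ 'r))\<^sup>2)
      \<ge> real k * ((real CARD('n))\<^sup>2 + \<epsilon>)} \<le> C / (real k * \<epsilon>\<^sup>2)"
proof -
  interpret prob_space N by (rule prob_space_noise)
  define Z where "Z i w = (norm (p i ** noise_block w i :: complex ^ 'n ^ 'r))\<^sup>2" for i w
  define \<mu> where "\<mu> = (real CARD('n))\<^sup>2"
  define Y where "Y i w = Z i w - \<mu>" for i w
  have Z: "integrable N (Z i)" "integrable N (\<lambda>w. (Z i w)\<^sup>2)"
      "(\<integral>w. Z i w \<partial>N) = \<mu>" "(\<integral>w. (Z i w)\<^sup>2 \<partial>N) \<le> C" if i: "i \<in> {1..k}" for i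
    using projected_noise_moments[OF i p(1)[OF i] p(2)[OF i] p(3)[OF i]]
    unfolding Z_def \<mu>_def C_def by simp_all
  have Z_ind: "indep_vars (\<lambda>_. borel) Z {1..k}"
    using projected_noise_indep[of p] unfolding Z_def .
  have Y_ind: "indep_vars (\<lambda>_. borel) Y {1..k}"
    unfolding Y_def by (rule indep_vars_compose2[OF Z_ind]) simp
  have Y_int: "integrable N (Y i)" and Y_mean: "(\<integral>w. Y i w \<partial>N) = 0" if "i \<in> {1..k}" for i
    using Z(1,3)[OF that] unfolding Y_def by (simp_all add: prob_space)
  have Y2_int: "integrable N (\<lambda>w. (Y i w)\<^sup>2)" and Y2: "(\<integral>w. (Y i w)\<^sup>2 \<partial>N) \<le> C" if "i \<in> {1..k}" for i
  proof -
    note Zi = Z[OF that]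
    have eq: "(\<lambda>w. (Y i w)\<^sup>2) = (\<lambda>w. (Z i w)\<^sup>2 - 2 * \<mu> * Z i w + \<mu>\<^sup>2)"
      by (simp add: Y_def fun_eq_iff power2_eq_square algebra_simps)
    show "integrable N (\<lambda>w. (Y i w)\<^sup>2)" unfolding eq using Zi by simp
    have "(\<integral>w. (Y i w)\<^sup>2 \<partial>N) = (\<integral>w. (Z i w)\<^sup>2 \<partial>N) - \<mu>\<^sup>2"
      unfolding eq using Zi by (simp add: prob_space power2_eq_square)
    also have "\<dots> \<le> C" using Zi(4) zero_le_power2[of \<mu>] by linarith
    finally show "(\<integral>w. (Y i w)\<^sup>2 \<partial>N) \<le> C" .
  qed
  have cov: "integrable N (\<lambda>w. Y i w * Y j w) \<and> (\<integral>w. Y i w * Y j w \<partial>N) = 0"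
    if "i \<in> {1..k}" "j \<in> {1..k}" "i \<noteq> j" for i j
  proof -
    have ind: "indep_vars (\<lambda>_. borel) Y {i, j}"
      by (rule indep_vars_subset[OF Y_ind]) (use that in auto)
    have int: "integrable N (Y l)" if "l \<in> {i, j}" for l
      using Y_int that \<open>i \<in> {1..k}\<close> \<open>j \<in> {1..k}\<close> by auto
    have "integrable N (\<lambda>w. \<Prod>l\<in>{i, j}. Y l w)"
      by (rule indep_vars_integrable[OF _ ind int]) auto
    moreover have "(\<integral>w. (\<Prod>l\<in>{i, j}. Y l w) \<partial>N) = (\<Prod>l\<in>{i, j}. \<integral>w. Y l w \<partial>N)"
      by (rule indep_vars_lebesgue_integral[OF _ ind int]) auto
    ultimately show ?thesis using that Y_mean[OF that(1)] by simp
  qed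
  let ?S = "\<lambda>w. \<Sum>i=1..k. Y i w"
  have sq: "(?S w)\<^sup>2 = (\<Sum>i=1..k. \<Sum>j=1..k. Y i w * Y j w)" for w
    by (simp add: power2_eq_square sum_product)
  have prod_int: "integrable N (\<lambda>w. Y i w * Y j w)" if "i \<in> {1..k}" "j \<in> {1..k}" for i j
    using cov[OF that] Y2_int[OF that(1)] by (cases "i = j") (simp_all add: power2_eq_square)
  have S2_int: "integrable N (\<lambda>w. (?S w)\<^sup>2)"
    unfolding sq by (intro Bochner_Integration.integrable_sum prod_int)
  have "(\<integral>w. (?S w)\<^sup>2 \<partial>N) = (\<Sum>i=1..k. \<Sum>j=1..k. \<integral>w. Y i w * Y j w \<partial>N)"
    unfolding sq
    by (subst Bochner_Integration.integral_sum, intro Bochner_Integration.integrable_sum prod_int)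
      (auto intro!: sum.cong Bochner_Integration.integral_sum prod_int)
  also have "\<dots> = (\<Sum>i=1..k. \<integral>w. (Y i w)\<^sup>2 \<partial>N)"
  proof (rule sum.cong[OF refl])
    fix i assume i: "i \<in> {1..k}"
    have "(\<Sum>j=1..k. \<integral>w. Y i w * Y j w \<partial>N) = (\<Sum>j=1..k. if j = i then \<integral>w. (Y i w)\<^sup>2 \<partial>N else 0)"
      by (rule sum.cong) (use cov[OF i] in \<open>auto simp: power2_eq_square\<close>)
    then show "(\<Sum>j=1..k. \<integral>w. Y i w * Y j w \<partial>N) = (\<integral>w. (Y i w)\<^sup>2 \<partial>N)"
      using i by simp
  qed
  also have "\<dots> \<le> (\<Sum>i=1..k. C)" by (rule sum_mono) (rule Y2)
  finally have var: "(\<integral>w. (?S w)\<^sup>2 \<partial>N) \<le> real k * C" by simp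
  have S_meas: "?S \<in> borel_measurable N"
    using Y_int by (intro borel_measurable_sum borel_measurable_integrable) auto
  have S_eq: "?S w = (\<Sum>i=1..k. Z i w) - real k * \<mu>" for w
    by (simp add: Y_def sum_subtractf)
  have "measure N {w \<in> space N. (\<Sum>i=1..k. Z i w) \<ge> real k * (\<mu> + \<epsilon>)} \<le>
      measure N {w \<in> space N. \<bar>?S w\<bar> \<ge> real k * \<epsilon>}"
  proof (rule finite_measure_mono)
    show "{w \<in> space N. (\<Sum>i=1..k. Z i w) \<ge> real k * (\<mu> + \<epsilon>)} \<subseteq> {w \<in> space N. \<bar>?S w\<bar> \<ge> real k * \<epsilon>}"
      unfolding S_eq by (auto simp: algebra_simps)
    show "{w \<in> space N. \<bar>?S w\<bar> \<ge> real k * \<epsilon>} \<in> sets N" using S_meas by measurable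
  qed
  also have "\<dots> \<le> (\<integral>w. (?S w)\<^sup>2 \<partial>N) / (real k * \<epsilon>)\<^sup>2"
    by (rule second_moment_method[OF S_meas S2_int]) (use k \<epsilon> in simp)
  also have "\<dots> \<le> real k * C / (real k * \<epsilon>)\<^sup>2"
    by (rule divide_right_mono[OF var]) simp
  also have "\<dots> = C / (real k * \<epsilon>\<^sup>2)"
    using k by (simp add: power_mult_distrib power2_eq_square)
  finally show ?thesis unfolding Z_def \<mu>_def .
qed

end

section \<open>Error probability\<close>

text \<open>The right-hand side is the integral of ln from 1 to m + 1. With x = m + 1 the induction
  step amounts to (x + 1)(ln (x + 1) - ln x) >= 1, which is ln y <= y - 1 at y = x / (x +
  1).\<close>

lemma ln_fact_upper_bound: "ln (fact m) \<le> (real m + 1) * ln (real m + 1) - real m"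
proof (induction m)
  case (Suc m)
  let ?x = "real m + 1"
  have "ln (?x / (?x + 1)) \<le> ?x / (?x + 1) - 1"
    by (intro ln_le_minus_one) auto
  also have "?x / (?x + 1) - 1 = - (1 / (?x + 1))" by (simp add: field_simps)
  also have "ln (?x / (?x + 1)) = ln ?x - ln (?x + 1)" by (simp add: ln_div)
  finally have "1 / (?x + 1) \<le> ln (?x + 1) - ln ?x" by simp
  then have "(?x + 1) * (1 / (?x + 1)) \<le> (?x + 1) * (ln (?x + 1) - ln ?x)"
    by (rule mult_left_mono) simp
  then have step: "1 \<le> (?x + 1) * ln (?x + 1) - (?x + 1) * ln ?x"
    by (simp add: right_diff_distrib)
  have "fact (Suc m) = ?x * (fact m :: real)" by (simp add: algebra_simps)
  then have "ln (fact (Suc m)) = ln (?x * fact m)" by (rule arg_cong)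
  also have "\<dots> = ln ?x + ln (fact m)" by (rule ln_mult_pos) auto
  also have "\<dots> \<le> ln ?x + (?x * ln ?x - real m)" using Suc.IH by simp
  also have "\<dots> \<le> (?x + 1) * ln (?x + 1) - ?x"
    using step by (simp add: algebra_simps)
  finally show ?case by (simp add: algebra_simps)
qed simp

text \<open>With m = n^2 k the base pi n k is pi m / n, and the m-th root of m! is at most m / e up
  to a factor tending to 1. Dividing yields the limit pi e / n as a lower bound.\<close>

lemma ball_const_root_lower_bound:
  assumes n: "n > 0" and c: "c < pi * exp 1 / real n"
  shows "eventually (\<lambda>k. c < ball_const n k powr (1 / real (n\<^sup>2 * k))) sequentially"
proof -
  define b where "b m = pi / real n * (real m * exp (- (((real m + 1) * ln (real m + 1) - real m) / real m)))" for m :: nat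
  have "(\<lambda>m::nat. real m * exp (- (((real m + 1) * ln (real m + 1) - real m) / real m))) \<longlonglongrightarrow> exp 1"
    by real_asymp
  then have "b \<longlonglongrightarrow> pi / real n * exp 1" unfolding b_def by (intro tendsto_mult tendsto_const)
  moreover have "filterlim (\<lambda>k. n\<^sup>2 * k) sequentially sequentially"
    by (rule filterlim_subseq) (use n in \<open>auto simp: strict_mono_def\<close>)
  ultimately have "(\<lambda>k. b (n\<^sup>2 * k)) \<longlonglongrightarrow> pi / real n * exp 1"
    by (rule filterlim_compose)
  then have "eventually (\<lambda>k. c < b (n\<^sup>2 * k)) sequentially"
    using c by (intro order_tendstoD(1)) auto
  then show ?thesis using eventually_gt_at_top[of 0]
  proof eventually_elim
    case (elim k)
    define m where "m = n\<^sup>2 * k"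
    have m: "m > 0" using n elim by (simp add: m_def)
    have base: "pi * real n * real k = pi / real n * real m"
      using n by (simp add: m_def power2_eq_square)
    have "ball_const n k = (pi / real n * real m) ^ m / fact m"
      unfolding ball_const_def base by (simp add: m_def)
    then have "ball_const n k powr (1 / real m) = ((pi / real n * real m) ^ m) powr (1 / real m) / fact m powr (1 / real m)"
      using n by (simp add: powr_divide)
    also have "((pi / real n * real m) ^ m) powr (1 / real m) = pi / real n * real m"
      using n m by (simp add: powr_realpow[symmetric] powr_powr del: times_divide_eq_left)
    also have "fact m powr (1 / real m) \<le> exp (((real m + 1) * ln (real m + 1) - real m) / real m)"
      using ln_fact_upper_bound[of m] m by (simp add: powr_def divide_right_mono)
    then have "pi / real n * real m / fact m powr (1 / real m) \<ge>
        pi / real n * real m / exp (((real m + 1) * ln (real m + 1) - real m) / real m)"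
      by (intro divide_left_mono) auto
    also have "pi / real n * real m / exp (((real m + 1) * ln (real m + 1) - real m) / real m) = b m"
      by (simp add: b_def exp_minus field_simps)
    finally show ?case using elim by (simp add: m_def)
  qed
qed

section \<open>From noise events to the error probability\<close>

lemma continuous_on_gram_det: "continuous_on UNIV (gram_det c :: complex ^ 'n ^ 'm \<Rightarrow> real)"
proof -
  have "gram_det c A = Re (\<Sum>p | p permutes UNIV. of_int (sign p) *
      (\<Prod>i\<in>UNIV. c *\<^sub>R (\<Sum>a\<in>UNIV. cnj (A $ a $ i) * A $ a $ p i)))" for A :: "complex ^ 'n ^ 'm"
    by (simp add: gram_det_def Determinants.det_def matrix_matrix_mult_def cadj_def)
  then show ?thesis
    by (subst continuous_on_cong[OF refl]) (auto intro!: continuous_intros)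
qed

lemma borel_measurable_gram_det: "gram_det c \<in> borel_measurable borel"
  by (intro borel_measurable_continuous_onI continuous_on_gram_det)

text \<open>Fubini, with the noise integrated first, then the fading, then the codeword: a noise
  slice has measure at most \<open>b\<close> for fading in \<open>G\<close> and at most 1
  otherwise.\<close>

lemma error_prob_le:
  fixes D :: "('n::finite, 'r::finite) decoder" and H :: "int \<Rightarrow> 'a \<Rightarrow> complex ^ 'n ^ 'r"
  assumes M: "prob_space M" and C: "finite C" "C \<noteq> {}" and G: "G \<in> sets M" and b: "b \<ge> 0"
    and slice: "\<And>X \<omega>. X \<in> C \<Longrightarrow> \<omega> \<in> G \<Longrightarrow>
      measure (noise k) {w \<in> space (noise k).
        D (channel_state k H \<omega>, channel_output k (channel_state k H \<omega>) X w) \<noteq> X} \<le> b"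
  shows "error_prob M H k C D \<le> b + measure M (space M - G)"
proof -
  define U where "U = uniform_count_measure C"
  define N where "N = (noise k :: (nat \<times> 'r \<times> 'n \<Rightarrow> complex) measure)"
  interpret M: prob_space M by fact
  interpret U: prob_space U unfolding U_def by (rule prob_space_uniform_count_measure[OF C])
  interpret N: prob_space N by (rule prob_space_noise[OF N_def])
  interpret MN: pair_prob_space M N ..
  interpret UMN: pair_prob_space U "M \<Otimes>\<^sub>M N" ..
  define A where "A = {(X, \<omega>, w) \<in> space (U \<Otimes>\<^sub>M (M \<Otimes>\<^sub>M N)).
        D (channel_state k H \<omega>, channel_output k (channel_state k H \<omega>) X w) \<noteq> X}"
  have err: "error_prob M H k C D = measure (U \<Otimes>\<^sub>M (M \<Otimes>\<^sub>M N)) A"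
    by (simp add: error_prob_def A_def U_def N_def Let_def)
  let ?B = "b + measure M (space M - G)"
  have B: "?B \<ge> 0" using b by simp
  \<comment> \<open>No measurability of the error event is needed: \<open>measure\<close> is 0 on nonmeasurable sets.\<close>
  show ?thesis
  proof (cases "A \<in> sets (U \<Otimes>\<^sub>M (M \<Otimes>\<^sub>M N))")
    case False
    then show ?thesis unfolding err using B by (simp add: measure_notin_sets)
  next
    case True
    have inner: "emeasure (M \<Otimes>\<^sub>M N) (Pair X -` A) \<le> ennreal ?B" if X: "X \<in> space U" for X
    proof -
      have XC: "X \<in> C" using X by (simp add: U_def space_uniform_count_measure)
      have "emeasure (M \<Otimes>\<^sub>M N) (Pair X -` A) = (\<integral>\<^sup>+\<omega>. emeasure N (Pair \<omega> -` (Pair X -` A)) \<partial>M)"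
        by (rule N.emeasure_pair_measure_alt[OF sets_Pair1[OF True]])
      also have "\<dots> \<le> (\<integral>\<^sup>+\<omega>. ennreal b + indicator (space M - G) \<omega> \<partial>M)"
      proof (rule nn_integral_mono)
        fix \<omega> assume \<omega>: "\<omega> \<in> space M"
        show "emeasure N (Pair \<omega> -` (Pair X -` A)) \<le> ennreal b + indicator (space M - G) \<omega>"
        proof (cases "\<omega> \<in> G")
          case True
          have "Pair \<omega> -` (Pair X -` A) = {w \<in> space N.
              D (channel_state k H \<omega>, channel_output k (channel_state k H \<omega>) X w) \<noteq> X}"
            using X \<omega> by (auto simp: A_def space_pair_measure)
          then have "emeasure N (Pair \<omega> -` (Pair X -` A)) \<le> ennreal b"
            using slice[OF XC True, folded N_def] by (simp add: N.emeasure_eq_measure ennreal_leI)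
          then show ?thesis using True by simp
        next
          case False
          have "emeasure N (Pair \<omega> -` (Pair X -` A)) \<le> 1" by (rule N.emeasure_le_1)
          then show ?thesis using False \<omega> by (simp add: add_increasing)
        qed
      qed
      also have "\<dots> = ennreal b + emeasure M (space M - G)"
        using G by (subst nn_integral_add) (auto simp: M.emeasure_space_1)
      also have "\<dots> = ennreal ?B"
        using b by (simp add: M.emeasure_eq_measure ennreal_plus)
      finally show ?thesis .
    qed
    have "emeasure (U \<Otimes>\<^sub>M (M \<Otimes>\<^sub>M N)) A = (\<integral>\<^sup>+X. emeasure (M \<Otimes>\<^sub>M N) (Pair X -` A) \<partial>U)"
      by (rule MN.P.emeasure_pair_measure_alt[OF True])
    also have "\<dots> \<le> (\<integral>\<^sup>+X. ennreal ?B \<partial>U)"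
      by (rule nn_integral_mono) (rule inner)
    also have "\<dots> = ennreal ?B" by (simp add: U.emeasure_space_1)
    finally show ?thesis
      unfolding err UMN.P.emeasure_eq_measure using B by (simp add: ennreal_le_iff)
  qed
qed

text \<open>Here \<open>\<alpha>\<close> times \<open>Y\<close> is a competitor minus the
  transmitted word. Expanding \<open>err\<close> bounds the energy of the faded difference by twice
  its inner product with the noise, in which the noise may be projected; half of the energy is then
  absorbed into the left side.\<close>

lemma decoding_error_forces_noise:
  fixes h W :: "nat \<Rightarrow> complex ^ 'n ^ 'r" and Y :: "'n word" and p :: "nat \<Rightarrow> complex ^ 'r ^ 'r"
  assumes k: "k > 0"
    and h: "\<And>i. i \<in> {1..k} \<Longrightarrow> gram_det 1 (h i) > 0"
      "c * real k \<le> (\<Sum>i=1..k. log 2 (gram_det 1 (h i)))"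
    and p: "\<And>i. i \<in> {1..k} \<Longrightarrow> cadj (p i) = p i" "\<And>i. i \<in> {1..k} \<Longrightarrow> p i ** h i = h i"
    and Y: "cmod (pdet k Y) \<ge> 1"
    and err: "(\<Sum>i=1..k. (norm (W i - h i ** (\<alpha> *\<^sub>R Y i)))\<^sup>2) \<le> (\<Sum>i=1..k. (norm (W i))\<^sup>2)"
  shows "\<alpha>\<^sup>2 * (real CARD('n) * real k * 2 powr (c / real CARD('n))) \<le> 4 * (\<Sum>i=1..k. (norm (p i ** W i))\<^sup>2)"
proof -
  let ?n = "real CARD('n)"
  have n: "?n > 0" by simp
  define V where "V i = h i ** (\<alpha> *\<^sub>R Y i)" for i
  have V: "V i = \<alpha> *\<^sub>R (h i ** Y i)" for i
    by (simp add: V_def matrix_matrix_mult_def Finite_Cartesian_Product.vec_eq_iff scaleR_sum_right)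
  have prod: "(\<Prod>i=1..k. gram_det 1 (h i)) = 2 powr (\<Sum>i=1..k. log 2 (gram_det 1 (h i)))"
    using h(1) by (subst powr_sum) auto
  \<comment> \<open>The geometric mean runs over n k columns, and c / n = c k / (n k).\<close>
  have "2 powr (c / ?n) = (2 powr (c * real k)) powr (1 / real (CARD('n) * k))"
    using k by (simp add: powr_powr)
  also have "\<dots> \<le> (\<Prod>i=1..k. gram_det 1 (h i)) powr (1 / real (CARD('n) * k))"
    unfolding prod using h(2) by (intro powr_mono2) auto
  also have "\<dots> \<le> ((\<Prod>i=1..k. gram_det 1 (h i)) * (cmod (pdet k Y))\<^sup>2) powr (1 / real (CARD('n) * k))"
  proof (rule powr_mono2)
    have 0: "0 \<le> (\<Prod>i=1..k. gram_det 1 (h i))" unfolding prod by simp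
    show "0 \<le> (\<Prod>i=1..k. gram_det 1 (h i))" by fact
    have "1 \<le> (cmod (pdet k Y))\<^sup>2" using Y by (simp add: one_le_power)
    then show "(\<Prod>i=1..k. gram_det 1 (h i)) \<le> (\<Prod>i=1..k. gram_det 1 (h i)) * (cmod (pdet k Y))\<^sup>2"
      using mult_left_mono[OF _ 0, of 1] by simp
  qed simp
  finally have "?n * real k * 2 powr (c / ?n) \<le>
      real (CARD('n) * k) * ((\<Prod>i=1..k. gram_det 1 (h i)) * (cmod (pdet k Y))\<^sup>2) powr (1 / real (CARD('n) * k))"
    by (simp add: mult_left_mono)
  also have "\<dots> \<le> (\<Sum>i=1..k. (norm (h i ** Y i))\<^sup>2)"
    by (rule word_norm_faded_lower_bound[OF k h(1)])
  finally have "\<alpha>\<^sup>2 * (?n * real k * 2 powr (c / ?n)) \<le> \<alpha>\<^sup>2 * (\<Sum>i=1..k. (norm (h i ** Y i))\<^sup>2)"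
    by (rule mult_left_mono) simp
  also have "\<dots> = (\<Sum>i=1..k. (norm (V i))\<^sup>2)"
    by (simp add: V power_mult_distrib sum_distrib_left)
  also have "\<dots> \<le> 4 * (\<Sum>i=1..k. (norm (p i ** W i))\<^sup>2)"
  proof -
    have step: "(norm (V i))\<^sup>2 / 2 \<le> (norm (W i - V i))\<^sup>2 - (norm (W i))\<^sup>2 + 2 * (norm (p i ** W i))\<^sup>2"
      if i: "i \<in> {1..k}" for i
    proof -
      have "inner (W i) (V i) = inner (p i ** W i) (V i)"
        unfolding V_def by (rule inner_projection[OF p(1)[OF i] p(2)[OF i]])
      \<comment> \<open>AM-GM: $2 \langle p W, V \rangle \le 2 \|p W\|^2 + \|V\|^2 / 2$\<close>
      moreover have "0 \<le> (norm (2 *\<^sub>R (p i ** W i) - V i))\<^sup>2" by simp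
      ultimately show ?thesis
        by (simp only: power2_norm_eq_inner) (simp add: inner_diff_left inner_diff_right inner_commute)
    qed
    have "(\<Sum>i=1..k. (norm (V i))\<^sup>2) / 2 \<le>
        (\<Sum>i=1..k. (norm (W i - V i))\<^sup>2 - (norm (W i))\<^sup>2 + 2 * (norm (p i ** W i))\<^sup>2)"
      unfolding sum_divide_distrib by (rule sum_mono) (rule step)
    also have "\<dots> = (\<Sum>i=1..k. (norm (W i - V i))\<^sup>2) - (\<Sum>i=1..k. (norm (W i))\<^sup>2) + 2 * (\<Sum>i=1..k. (norm (p i ** W i))\<^sup>2)"
      by (simp add: sum.distrib sum_subtractf sum_distrib_left)
    also have "\<dots> \<le> 2 * (\<Sum>i=1..k. (norm (p i ** W i))\<^sup>2)"
      using err by (simp add: V_def)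
    finally show ?thesis by simp
  qed
  finally show ?thesis .
qed

text \<open>Outside one noise event the transmitted word is the strict minimizer over
  \<open>S\<close>. This settles together the existence of a minimizer over an infinite
  \<open>S\<close>, its uniqueness and the tie-breaking, so any minimum distance decoder must output
  that word.\<close>

lemma decoder_slice_bound:
  fixes D :: "('n::finite, 'r::finite) decoder" and h :: "nat \<Rightarrow> complex ^ 'n ^ 'r"
    and B :: "nat \<Rightarrow> 'n word"
  defines "m \<equiv> (real CARD('n))\<^sup>2"
    and "C\<^sub>4 \<equiv> (real (CARD('r) * CARD('n)))\<^sup>2 * (\<integral>z. (cmod z) ^ 4 \<partial>complex_normal)"
  assumes k: "k > 0" and basis: "lattice_basis k d B L" and min: "det_min k L = 1"
    and D: "minimum_distance_decoder k S D"
    and S: "X \<in> S" "S \<subseteq> shifted_lattice \<alpha> X\<^sub>R L" and \<alpha>: "\<alpha> > 0"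
    and h: "h \<in> extensional {1..k}" "\<And>i. i \<in> {1..k} \<Longrightarrow> gram_det 1 (h i) > 0"
      "c * real k \<le> (\<Sum>i=1..k. log 2 (gram_det 1 (h i)))"
    and \<epsilon>: "\<epsilon> > 0" "4 * (m + \<epsilon>) \<le> \<alpha>\<^sup>2 * real CARD('n) * 2 powr (c / real CARD('n))"
  shows "measure (noise k) {w \<in> space (noise k). D (h, channel_output k h X w) \<noteq> X} \<le> C\<^sub>4 / (real k * \<epsilon>\<^sup>2)"
proof -
  define N where "N = (noise k :: (nat \<times> 'r \<times> 'n \<Rightarrow> complex) measure)"
  interpret N: prob_space N by (rule prob_space_noise[OF N_def])
  have "\<exists>p :: complex ^ 'r ^ 'r. cadj p = p \<and> p ** p = p \<and> p ** h i = h i \<and>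
      Determinants.trace p = of_nat CARD('n)" if "i \<in> {1..k}" for i
    using range_projection[OF h(2)[OF that]] by metis
  then obtain p :: "nat \<Rightarrow> complex ^ 'r ^ 'r" where p: "\<And>i. i \<in> {1..k} \<Longrightarrow> cadj (p i) = p i"
    "\<And>i. i \<in> {1..k} \<Longrightarrow> p i ** p i = p i" "\<And>i. i \<in> {1..k} \<Longrightarrow> p i ** h i = h i"
    "\<And>i. i \<in> {1..k} \<Longrightarrow> Determinants.trace (p i) = of_nat CARD('n)"
    by metis
  let ?bad = "{w \<in> space N. (\<Sum>i=1..k. (norm (p i ** noise_block w i :: complex ^ 'n ^ 'r))\<^sup>2) \<ge> real k * (m + \<epsilon>)}"
  have "{w \<in> space N. D (h, channel_output k h X w) \<noteq> X} \<subseteq> ?bad"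
  proof safe
    fix w assume w: "w \<in> space N" "D (h, channel_output k h X w) \<noteq> X"
    define Y where "Y = channel_output k h X w"
    have Y: "Y \<in> {1..k} \<rightarrow>\<^sub>E UNIV" by (simp add: Y_def channel_output_def)
    have hE: "h \<in> {1..k} \<rightarrow>\<^sub>E UNIV" using h(1) by (simp add: PiE_def)
    obtain \<Lambda> where \<Lambda>: "\<Lambda> \<in> L" "X = (\<lambda>i. X\<^sub>R i + \<alpha> *\<^sub>R \<Lambda> i)"
      using S by (auto simp: shifted_lattice_def)
    show "real k * (m + \<epsilon>) \<le> (\<Sum>i=1..k. (norm (p i ** noise_block w i :: complex ^ 'n ^ 'r))\<^sup>2)"
    proof (rule ccontr)
      assume small: "\<not> ?thesis"
      have strict: "decoding_metric k h Y X < decoding_metric k h Y X'" if X': "X' \<in> S" "X' \<noteq> X" for X'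
      proof (rule ccontr)
        assume ge: "\<not> ?thesis"
        obtain \<Lambda>' where \<Lambda>': "\<Lambda>' \<in> L" "X' = (\<lambda>i. X\<^sub>R i + \<alpha> *\<^sub>R \<Lambda>' i)"
          using X'(1) S(2) by (auto simp: shifted_lattice_def)
        define \<Delta> where "\<Delta> = (\<lambda>i. \<Lambda>' i - \<Lambda> i)"
        have "\<Delta> \<in> L - {\<lambda>_. 0}"
          using lattice_basis_diff[OF basis \<Lambda>'(1) \<Lambda>(1)] X'(2) \<Lambda>(2) \<Lambda>'(2)
          by (auto simp: \<Delta>_def fun_eq_iff)
        then have "det_min k L \<le> cmod (pdet k \<Delta>)"
          unfolding det_min_def by (intro cINF_lower bdd_belowI2[where m = 0]) auto
        then have pdet: "cmod (pdet k \<Delta>) \<ge> 1" using min by simp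
        have "Y i - h i ** X i = noise_block w i" if "i \<in> {1..k}" for i
          using that by (simp add: Y_def channel_output_def)
        moreover have "Y i - h i ** X' i = noise_block w i - h i ** (\<alpha> *\<^sub>R \<Delta> i)" if "i \<in> {1..k}" for i
        proof -
          have "X' i = X i + \<alpha> *\<^sub>R \<Delta> i"
            by (simp add: \<Lambda>(2) \<Lambda>'(2) \<Delta>_def scaleR_diff_right)
          then show ?thesis
            using that by (simp add: Y_def channel_output_def matrix_add_ldistrib)
        qed
        ultimately have "(\<Sum>i=1..k. (norm (noise_block w i - h i ** (\<alpha> *\<^sub>R \<Delta> i)))\<^sup>2) \<le>
            (\<Sum>i=1..k. (norm (noise_block w i :: complex ^ 'n ^ 'r))\<^sup>2)"
          using ge by (simp add: decoding_metric_def)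
        from decoding_error_forces_noise[OF k h(2,3) p(1,3) pdet this]
        have "\<alpha>\<^sup>2 * (real CARD('n) * real k * 2 powr (c / real CARD('n)))
            \<le> 4 * (\<Sum>i=1..k. (norm (p i ** noise_block w i :: complex ^ 'n ^ 'r))\<^sup>2)" .
        moreover have "real k * (4 * (m + \<epsilon>)) \<le> real k * (\<alpha>\<^sup>2 * real CARD('n) * 2 powr (c / real CARD('n)))"
          using \<epsilon>(2) by (rule mult_left_mono) simp
        moreover have "real k * (4 * (m + \<epsilon>)) = 4 * (real k * (m + \<epsilon>))"
          "real k * (\<alpha>\<^sup>2 * real CARD('n) * 2 powr (c / real CARD('n))) =
            \<alpha>\<^sup>2 * (real CARD('n) * real k * 2 powr (c / real CARD('n)))"
          by (simp_all only: mult_ac)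
        ultimately show False using small by linarith
      qed
      then have "is_arg_min (decoding_metric k h Y) (\<lambda>X'. X' \<in> S) X"
        using S(1) by (auto simp: is_arg_min_def) (metis order_less_asym order_less_irrefl)
      then have "is_arg_min (decoding_metric k h Y) (\<lambda>X'. X' \<in> S) (D (h, Y))"
        using D hE Y unfolding minimum_distance_decoder_def by blast
      then have "D (h, Y) \<in> S" "\<not> decoding_metric k h Y X < decoding_metric k h Y (D (h, Y))"
        using S(1) by (auto simp: is_arg_min_def)
      then show False using strict[of "D (h, Y)"] w(2) by (simp add: Y_def)
    qed
  qed
  then have "measure N {w \<in> space N. D (h, channel_output k h X w) \<noteq> X} \<le> measure N ?bad"
    by (rule N.finite_measure_mono[OF _ projected_noise_sets[OF N_def]])
  also have "\<dots> \<le> C\<^sub>4 / (real k * \<epsilon>\<^sup>2)"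
    unfolding C\<^sub>4_def m_def by (rule projected_noise_tail[OF N_def k \<epsilon>(1) p(1,2,4)])
  finally show ?thesis unfolding N_def .
qed

section \<open>Fading states with large determinants\<close>

text \<open>\<open>abs_log2\<close> is infinite where the determinant is not positive, so a finite
  expectation confines this to a null set for \<open>H 1\<close>. Equality of marginals carries it
  to every index.\<close>

lemma fading_gram_det:
  fixes H :: "int \<Rightarrow> 'a \<Rightarrow> complex ^ 'n ^ 'r"
  assumes "prob_space M" and stat: "stationary_process M I H"
    and H: "\<And>i. i \<in> I \<Longrightarrow> H i \<in> borel_measurable M" and I: "1 \<in> I"
    and fin: "(\<integral>\<^sup>+\<omega>. abs_log2 (gram_det 1 (H 1 \<omega>)) \<partial>M) < \<infinity>"
  shows "integrable M (\<lambda>\<omega>. log 2 (gram_det 1 (H 1 \<omega>)))"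
    and "i \<in> I \<Longrightarrow> AE \<omega> in M. gram_det 1 (H i \<omega>) > 0"
proof -
  interpret prob_space M by fact
  have g: "(\<lambda>\<omega>. gram_det 1 (H i \<omega>)) \<in> borel_measurable M" if "i \<in> I" for i
    by (rule measurable_compose[OF H[OF that] borel_measurable_gram_det])
  have abs: "abs_log2 \<in> borel_measurable borel"
    unfolding abs_log2_def[abs_def] by measurable
  have "(\<integral>\<^sup>+\<omega>. ennreal (norm (log 2 (gram_det 1 (H 1 \<omega>)))) \<partial>M) \<le> (\<integral>\<^sup>+\<omega>. abs_log2 (gram_det 1 (H 1 \<omega>)) \<partial>M)"
    by (rule nn_integral_mono) (simp add: abs_log2_def)
  then show "integrable M (\<lambda>\<omega>. log 2 (gram_det 1 (H 1 \<omega>)))"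
    using fin g[OF I] by (intro integrableI_bounded) (auto intro: le_less_trans)
  have "AE \<omega> in M. abs_log2 (gram_det 1 (H 1 \<omega>)) \<noteq> \<infinity>"
    using fin by (intro nn_integral_PInf_AE measurable_compose[OF g[OF I] abs]) auto
  then have AE1: "AE \<omega> in M. gram_det 1 (H 1 \<omega>) > 0"
    by eventually_elim (auto simp: abs_log2_def split: if_splits)
  let ?A = "{A :: complex ^ 'n ^ 'r. \<not> gram_det 1 A > 0}"
  have A: "?A \<in> sets borel"
    using borel_measurable_gram_det[of 1] by measurable
  show "AE \<omega> in M. gram_det 1 (H i \<omega>) > 0" if i: "i \<in> I"
  proof -
    have "emeasure M {\<omega> \<in> space M. \<forall>j\<in>{1}. H (j + (i - 1)) \<omega> \<in> ?A} =
        emeasure M {\<omega> \<in> space M. \<forall>j\<in>{1}. H j \<omega> \<in> ?A}"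
      by (rule stationary_process_cylinder[OF stat H]) (use i I A in auto)
    then have "emeasure M {\<omega> \<in> space M. \<not> gram_det 1 (H i \<omega>) > 0} =
        emeasure M {\<omega> \<in> space M. \<not> gram_det 1 (H 1 \<omega>) > 0}" by simp
    also have "\<dots> = 0" using AE1 g[OF I] by (subst AE_iff_measurable[symmetric, OF _ refl]) auto
    finally show ?thesis using g[OF i] by (subst AE_iff_measurable[OF _ refl]) auto
  qed
qed

text \<open>Since the determinants are almost surely positive, the complement of \<open>G k\<close>
  is, up to a null set, the event that the average of the logarithms falls below
  \<open>c\<close>.\<close>

lemma good_fading_probability:
  fixes H :: "int \<Rightarrow> 'a \<Rightarrow> complex ^ 'n ^ 'r"
  assumes "prob_space M" "stationary_process M I H" "ergodic_process M I H"
    and H: "\<And>i. i \<in> I \<Longrightarrow> H i \<in> borel_measurable M"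
    and I: "\<And>i. i \<in> I \<Longrightarrow> i + 1 \<in> I" "1 \<in> I"
    and fin: "(\<integral>\<^sup>+\<omega>. abs_log2 (gram_det 1 (H 1 \<omega>)) \<partial>M) < \<infinity>"
    and c: "c < (\<integral>\<omega>. log 2 (gram_det 1 (H 1 \<omega>)) \<partial>M)"
  defines "G \<equiv> \<lambda>k. {\<omega> \<in> space M. (\<forall>i\<in>{1..k}. gram_det 1 (H (int i) \<omega>) > 0) \<and>
      c * real k \<le> (\<Sum>i=1..k. log 2 (gram_det 1 (H (int i) \<omega>)))}"
  shows "G k \<in> sets M" and "(\<lambda>k. measure M (space M - G k)) \<longlonglongrightarrow> 0"
proof -
  interpret prob_space M by fact
  have I_nat: "int (Suc i) \<in> I" for i
  proof (induction i)
    case (Suc i)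
    then show ?case using I(1)[of "int (Suc i)"] by (simp add: ac_simps)
  qed (simp add: I(2))
  have I_int: "int i \<in> I" if "i \<ge> 1" for i
    using I_nat[of "i - 1"] that by simp
  have g: "(\<lambda>\<omega>. gram_det 1 (H (int i) \<omega>)) \<in> borel_measurable M" if "i \<in> {1..k}" for i k
    using that by (intro measurable_compose[OF H borel_measurable_gram_det] I_int) simp
  have \<phi>: "(\<lambda>A :: complex ^ 'n ^ 'r. log 2 (gram_det 1 A)) \<in> borel_measurable borel"
    using borel_measurable_gram_det[of 1] by measurable
  define E where "E k = {\<omega> \<in> space M. (\<Sum>i=1..k. log 2 (gram_det 1 (H (int i) \<omega>))) < c * real k}" for k
  have sum_meas: "(\<lambda>\<omega>. \<Sum>i=1..k. log 2 (gram_det 1 (H (int i) \<omega>))) \<in> borel_measurable M" for k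
    by (intro borel_measurable_sum measurable_compose[OF H \<phi>] I_int) simp
  have E_sets: "E k \<in> sets M" for k
    unfolding E_def using sum_meas by measurable
  have pos_sets: "{\<omega> \<in> space M. \<forall>i\<in>{1..k}. gram_det 1 (H (int i) \<omega>) > 0} \<in> sets M" for k
    using g by (intro sets.sets_Collect_finite_All) (auto intro: measurable_sets)
  have G_eq: "G k = {\<omega> \<in> space M. \<forall>i\<in>{1..k}. gram_det 1 (H (int i) \<omega>) > 0} - E k" for k
    by (auto simp: G_def E_def)
  show G_sets: "G k \<in> sets M" for k
    unfolding G_eq using pos_sets E_sets by auto
  have le: "measure M (space M - G k) \<le> measure M (E k)" for k
  proof (rule finite_measure_mono_AE)
    have "AE \<omega> in M. \<forall>i\<in>{1..k}. gram_det 1 (H (int i) \<omega>) > 0"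
      by (intro AE_finite_allI fading_gram_det(2)[OF assms(1,2) H I(2) fin] I_int) auto
    then show "AE \<omega> in M. \<omega> \<in> space M - G k \<longrightarrow> \<omega> \<in> E k"
      by eventually_elim (auto simp: G_eq)
  qed (rule E_sets)
  have lim: "(\<lambda>k. measure M (E k)) \<longlonglongrightarrow> 0"
    unfolding E_def
    by (rule ergodic_average_lower_bound[OF assms(1-3) H I \<phi> fading_gram_det(1)[OF assms(1,2) H I(2) fin] c])
  show "(\<lambda>k. measure M (space M - G k)) \<longlonglongrightarrow> 0"
  proof (rule tendsto_sandwich[OF _ _ tendsto_const lim])
    show "eventually (\<lambda>k. 0 \<le> measure M (space M - G k)) sequentially"
      by (intro always_eventually allI measure_nonneg)
    show "eventually (\<lambda>k. measure M (space M - G k) \<le> measure M (E k)) sequentially"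
      by (intro always_eventually allI le)
  qed
qed

text \<open>The pointwise identity is a law of logarithms for positive arguments; at determinant 0
  the convention \<open>log 2 0 = 0\<close> can break it, hence the almost sure hypothesis.\<close>

lemma integral_log_gram_det_scale:
  fixes H :: "'a \<Rightarrow> complex ^ 'n ^ 'r"
  assumes "prob_space M" "s > 0" "H \<in> borel_measurable M"
    and int: "integrable M (\<lambda>\<omega>. log 2 (gram_det 1 (H \<omega>)))"
    and AE: "AE \<omega> in M. gram_det 1 (H \<omega>) > 0"
  shows "(\<integral>\<omega>. log 2 (gram_det s (H \<omega>)) \<partial>M) =
    real CARD('n) * log 2 s + (\<integral>\<omega>. log 2 (gram_det 1 (H \<omega>)) \<partial>M)"
proof -
  interpret prob_space M by fact
  have meas: "(\<lambda>\<omega>. gram_det t (H \<omega>)) \<in> borel_measurable M" for t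
    by (rule measurable_compose[OF assms(3) borel_measurable_gram_det])
  have "(\<integral>\<omega>. log 2 (gram_det s (H \<omega>)) \<partial>M) =
      (\<integral>\<omega>. real CARD('n) * log 2 s + log 2 (gram_det 1 (H \<omega>)) \<partial>M)"
  proof (rule integral_cong_AE)
    show "AE \<omega> in M. log 2 (gram_det s (H \<omega>)) = real CARD('n) * log 2 s + log 2 (gram_det 1 (H \<omega>))"
      using AE
    proof eventually_elim
      case (elim \<omega>)
      have "log 2 (gram_det s (H \<omega>)) = log 2 (s ^ CARD('n)) + log 2 (gram_det 1 (H \<omega>))"
        unfolding gram_det_scale[of s] using elim assms(2) by (intro log_mult_pos) auto
      then show ?case using assms(2) by (simp add: log_nat_power)
    qed
  qed (use meas in measurable)
  also have "\<dots> = real CARD('n) * log 2 s + (\<integral>\<omega>. log 2 (gram_det 1 (H \<omega>)) \<partial>M)"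
    using int by (simp add: prob_space)
  finally show ?thesis .
qed

section \<open>Choice of the slack constants\<close>

text \<open>The gap between the rate and its bound, divided by \<open>n\<close>, is split into four
  parts \<open>\<delta>\<close>. One lowers \<open>a\<close> below the limit pi e / n, one lowers
  \<open>c / n\<close> below \<open>E / n\<close>, and two remain as the excess that defines
  \<open>\<epsilon>\<close>.\<close>

lemma rate_margin:
  fixes n P C R E :: real
  assumes pos: "n > 0" "P > 0" "C > 0"
    and R: "R < n * log 2 (P / n) + E - n * log 2 C + n * log 2 (pi * exp 1 / (4 * n))"
  shows "\<exists>a c \<epsilon>. 0 < a \<and> a < pi * exp 1 / n \<and> c < E \<and> \<epsilon> > 0 \<and>
    4 * (n\<^sup>2 + \<epsilon>) = a * P / (2 powr (R / n) * C) * n * 2 powr (c / n)"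
proof -
  define S where "S = log 2 (P / n) + E / n - log 2 C + log 2 (pi * exp 1 / (4 * n)) - R / n"
  define \<delta> where "\<delta> = S / 4"
  have "R / n < log 2 (P / n) + E / n - log 2 C + log 2 (pi * exp 1 / (4 * n))"
    using R pos by (simp add: field_simps)
  then have \<delta>: "\<delta> > 0" by (simp add: \<delta>_def S_def)
  have \<delta>_eq: "4 * \<delta> = log 2 (P / n) + E / n - log 2 C + log 2 (pi * exp 1 / (4 * n)) - R / n"
    unfolding S_def[symmetric] by (simp add: \<delta>_def)
  define a where "a = pi * exp 1 / n * 2 powr (- \<delta>)"
  define c where "c = E - n * \<delta>"
  \<comment> \<open>The lower bound for the squared distance per block; it exceeds the noise term 4
    n^2 by the factor 2^(2 \<delta>).\<close>
  define x where "x = a * P / (2 powr (R / n) * C) * n * 2 powr (c / n)"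
  have cn: "c / n = E / n - \<delta>" using pos by (simp add: c_def diff_divide_distrib)
  have a: "a > 0" using pos by (simp add: a_def)
  have x: "x > 0" using pos a by (simp add: x_def)
  let ?\<pi> = "pi * exp 1 :: real"
  have \<pi>: "?\<pi> > 0" by simp
  have "log 2 a = log 2 ?\<pi> - log 2 n - \<delta>"
    unfolding a_def using pos \<pi> by (simp only: log_mult_pos log_divide_pos divide_pos_pos powr_gt_zero) simp
  then have "log 2 x = log 2 ?\<pi> - log 2 n - \<delta> + log 2 P - (R / n + log 2 C) + log 2 n + (E / n - \<delta>)"
    unfolding x_def cn using pos a
    by (simp only: log_mult_pos log_divide_pos mult_pos_pos divide_pos_pos powr_gt_zero) simp
  moreover have "log 2 (P / n) = log 2 P - log 2 n"
    using pos by (simp add: log_divide_pos)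
  moreover have "log 2 (?\<pi> / (4 * n)) = log 2 ?\<pi> - (log 2 4 + log 2 n)"
    using pos \<pi> by (simp only: log_divide_pos log_mult_pos mult_pos_pos zero_less_numeral)
  moreover have "log 2 (4 * n\<^sup>2) = log 2 4 + 2 * log 2 n"
    using pos by (simp add: log_mult_pos log_nat_power)
  ultimately have "log 2 x = log 2 (4 * n\<^sup>2) + 2 * \<delta>"
    using \<delta>_eq by linarith
  then have "log 2 (4 * n\<^sup>2) < log 2 x" using \<delta> by simp
  then have "4 * n\<^sup>2 < x" using x pos by simp
  moreover have "a < ?\<pi> / n"
  proof -
    have "2 powr (- \<delta>) < (1 :: real)" using \<delta> by (simp add: powr_less_one)
    then have "?\<pi> / n * 2 powr (- \<delta>) < ?\<pi> / n * 1"
      by (rule mult_strict_left_mono) (use pos \<pi> in simp)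
    then show ?thesis by (simp add: a_def)
  qed
  moreover have "c < E" using \<delta> pos by (simp add: c_def)
  ultimately have "0 < a \<and> a < ?\<pi> / n \<and> c < E \<and> x / 4 - n\<^sup>2 > 0 \<and>
      4 * (n\<^sup>2 + (x / 4 - n\<^sup>2)) = x"
    using a by simp
  then show ?thesis unfolding x_def by blast
qed

text \<open>Both factors that vary with \<open>k\<close> are replaced by constants, so that one
  margin serves all large \<open>k\<close>.\<close>

lemma code_scale_squared_lower_bound:
  assumes "n > 0" "k > 0" "P > 0" "V > 0" "C > 0"
    and V: "V powr (1 / real (n\<^sup>2 * k)) \<le> C"
    and a: "0 < a" "a < ball_const n k powr (1 / real (n\<^sup>2 * k))"
  shows "a * P / (2 powr (R / real n) * C) \<le> (code_scale n k P R V)\<^sup>2"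
proof -
  have "(code_scale n k P R V)\<^sup>2 =
      ball_const n k powr (1 / real (n\<^sup>2 * k)) * P / (2 powr (R / real n) * V powr (1 / real (n\<^sup>2 * k)))"
    using assms by (simp add: code_scale_def)
  moreover have "a * P / (2 powr (R / real n) * C) \<le> \<dots>"
    using assms by (intro frac_le mult_mono mult_nonneg_nonneg mult_pos_pos) auto
  ultimately show ?thesis by simp
qed

theorem corollaryV5:
  fixes M :: "'a measure"
    and I :: "int set"
    and H :: "int \<Rightarrow> 'a \<Rightarrow> complex ^ 'n ^ 'r"
    and K :: "nat set"
    and L :: "nat \<Rightarrow> (nat \<Rightarrow> complex ^ 'n ^ 'n) set"
    and B :: "nat \<Rightarrow> nat \<Rightarrow> nat \<Rightarrow> complex ^ 'n ^ 'n"
    and P R C\<^sub>L :: real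
    and n :: nat
    and vol scale :: "nat \<Rightarrow> real"
  defines "n \<equiv> CARD('n)"
    and "vol \<equiv> \<lambda>k. lattice_vol k (2 * n\<^sup>2 * k) (B k)"
    and "scale \<equiv> \<lambda>k. code_scale n k P R (vol k)"
  assumes "CARD('n) \<le> CARD('r)"
    and "prob_space M"
    and "I \<in> {UNIV, {0..}, {1..}}"
    and "\<forall>i\<in>I. H i \<in> borel_measurable M"
    and "stationary_process M I H"
    and "ergodic_process M I H"
    and "isotropic_process M I H"
    and "(\<integral>\<^sup>+\<omega>. abs_log2 (gram_det 1 (H 1 \<omega>)) \<partial>M) < \<infinity>"
    and "infinite K" and "0 \<notin> K"
    and "\<forall>k\<in>K. lattice_basis k (2 * n\<^sup>2 * k) (B k) (L k)"
    and "C\<^sub>L > 0"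
    and "\<forall>k\<in>K. det_min k (L k) = 1"
    and "\<forall>k\<in>K. vol k powr (1 / real (n\<^sup>2 * k)) \<le> C\<^sub>L"
    and "P > 0"
    and "R < (\<integral>\<omega>. log 2 (gram_det (P / real n) (H 1 \<omega>)) \<partial>M)
               - real n * log 2 C\<^sub>L + real n * log 2 (pi * exp 1 / (4 * real n))"
  shows "achievable M H K
           (\<lambda>k. admissible_shift k P R (scale k) (L k))
           (\<lambda>k X. lattice_code k P (scale k) X (L k))
           (\<lambda>k X. lattice_code k P (scale k) X (L k))
       \<and> achievable M H K
           (\<lambda>k. admissible_shift k P R (scale k) (L k))
           (\<lambda>k X. lattice_code k P (scale k) X (L k))
           (\<lambda>k X. shifted_lattice (scale k) X (L k))"
proof -
  have n: "n > 0" by (simp add: n_def)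
  have I1: "1 \<in> I" and Isuc: "\<And>i. i \<in> I \<Longrightarrow> i + 1 \<in> I" using assms(6) by auto
  have H: "\<And>i. i \<in> I \<Longrightarrow> H i \<in> borel_measurable M" using assms(7) by blast
  have kpos: "k > 0" if "k \<in> K" for k using that \<open>0 \<notin> K\<close> by (cases k) auto
  have basis: "lattice_basis k (2 * n\<^sup>2 * k) (B k) (L k)" if "k \<in> K" for k
    using assms(14) that by blast
  have vol: "vol k > 0" if "k \<in> K" for k
    unfolding vol_def by (rule lattice_vol_pos[OF basis[OF that]])
  have scale: "scale k > 0" if "k \<in> K" for k
    unfolding scale_def by (rule code_scale_pos[OF n kpos[OF that] \<open>P > 0\<close> vol[OF that]])
  let ?E = "\<integral>\<omega>. log 2 (gram_det 1 (H 1 \<omega>)) \<partial>M"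
  let ?code = "\<lambda>k X. lattice_code k P (scale k) X (L k)"
  note gram = fading_gram_det[OF assms(5,8) H I1 assms(11)]
  have "(\<integral>\<omega>. log 2 (gram_det (P / real n) (H 1 \<omega>)) \<partial>M) = real n * log 2 (P / real n) + ?E"
    unfolding n_def using \<open>P > 0\<close>
    by (intro integral_log_gram_det_scale[OF assms(5)] H I1 gram) auto
  with assms(19) have "R < real n * log 2 (P / real n) + ?E - real n * log 2 C\<^sub>L + real n * log 2 (pi * exp 1 / (4 * real n))"
    by simp
  from rate_margin[OF _ \<open>P > 0\<close> \<open>C\<^sub>L > 0\<close> this] n
  obtain a c \<epsilon> where a: "0 < a" "a < pi * exp 1 / real n" and c: "c < ?E" and \<epsilon>: "\<epsilon> > 0"
    "4 * ((real n)\<^sup>2 + \<epsilon>) = a * P / (2 powr (R / real n) * C\<^sub>L) * real n * 2 powr (c / real n)"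
    by auto
  define G where "G k = {\<omega> \<in> space M. (\<forall>i\<in>{1..k}. gram_det 1 (H (int i) \<omega>) > 0) \<and>
      c * real k \<le> (\<Sum>i=1..k. log 2 (gram_det 1 (H (int i) \<omega>)))}" for k
  note good = good_fading_probability[OF assms(5,8,9) H Isuc I1 assms(11) c, folded G_def]
  define C\<^sub>4 where "C\<^sub>4 = (real (CARD('r) * CARD('n)))\<^sup>2 * (\<integral>z. (cmod z) ^ 4 \<partial>complex_normal)"
  have C4: "C\<^sub>4 \<ge> 0" by (simp add: C\<^sub>4_def)
  have "(\<lambda>k. C\<^sub>4 / \<epsilon>\<^sup>2 * inverse (real k) + measure M (space M - G k)) \<longlonglongrightarrow> C\<^sub>4 / \<epsilon>\<^sup>2 * 0 + 0"
    by (intro tendsto_add tendsto_mult tendsto_const lim_inverse_n good(2))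
  then have bound_lim: "(\<lambda>k. C\<^sub>4 / (real k * \<epsilon>\<^sup>2) + measure M (space M - G k)) \<longlonglongrightarrow> 0"
    by (simp add: field_simps)
  have shift: "\<exists>X. admissible_shift k P R (scale k) (L k) X" if "k \<in> K" for k
    using admissible_shift_exists[OF basis[OF that, unfolded n_def] kpos[OF that] \<open>P > 0\<close>]
    unfolding scale_def vol_def n_def by blast
  have code: "finite (?code k X)" "?code k X \<noteq> {}" "?code k X \<subseteq> shifted_lattice (scale k) X (L k)"
    if "k \<in> K" "admissible_shift k P R (scale k) (L k) X" for k X
  proof -
    show "finite (?code k X)" by (rule finite_lattice_code[OF basis[OF that(1)] scale[OF that(1)]])
    show "?code k X \<noteq> {}"
    proof
      assume "?code k X = {}"
      then have "2 powr (R * real CARD('n) * real k) \<le> 0"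
        using that(2) by (simp add: admissible_shift_def)
      then show False using powr_gt_zero[of 2 "R * real CARD('n) * real k"] by simp
    qed
    show "?code k X \<subseteq> shifted_lattice (scale k) X (L k)" by (auto simp: lattice_code_def)
  qed
  have countable: "countable (shifted_lattice (scale k) X (L k))" if "k \<in> K" for k X
  proof -
    have "shifted_lattice (scale k) X (L k) = (\<lambda>Y i. X i + scale k *\<^sub>R Y i) ` L k"
      by (auto simp: shifted_lattice_def)
    then show ?thesis using lattice_basis_countable[OF basis[OF that]] by simp
  qed
  \<comment> \<open>Maximum likelihood and naive lattice decoding are the two extreme search sets
    allowed here.\<close>
  have achievable: "achievable M H K (\<lambda>k. admissible_shift k P R (scale k) (L k)) ?code search"
    if search: "\<And>k X. ?code k X \<subseteq> search k X" "\<And>k X. search k X \<subseteq> shifted_lattice (scale k) X (L k)"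
    for search
    unfolding achievable_def
  proof (intro conjI ballI allI impI)
    show "\<exists>X. admissible_shift k P R (scale k) (L k) X" if "k \<in> K" for k by (rule shift[OF that])
    show "\<exists>D :: ('n, 'r) decoder. minimum_distance_decoder k (search k X) D"
      if "k \<in> K" "admissible_shift k P R (scale k) (L k) X" for k X
      using code(2)[OF that] search countable_subset[OF search(2) countable[OF that(1)]]
      by (intro minimum_distance_decoder_exists) blast+
    fix X and D :: "nat \<Rightarrow> ('n, 'r) decoder"
    assume XD: "\<forall>k\<in>K. admissible_shift k P R (scale k) (L k) (X k) \<and>
      minimum_distance_decoder k (search k (X k)) (D k)"
    \<comment> \<open>The Stirling bound holds only for large \<open>k\<close>; membership in
      \<open>K\<close> is a premise because the limit is taken along \<open>K\<close>.\<close>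
    have err: "eventually (\<lambda>k. k \<in> K \<longrightarrow> error_prob M H k (?code k (X k)) (D k) \<le>
        C\<^sub>4 / (real k * \<epsilon>\<^sup>2) + measure M (space M - G k)) sequentially"
      using ball_const_root_lower_bound[OF n a(2)]
    proof (eventually_elim, intro impI)
      fix k assume root: "a < ball_const n k powr (1 / real (n\<^sup>2 * k))" and k: "k \<in> K"
      have adm: "admissible_shift k P R (scale k) (L k) (X k)"
        and D: "minimum_distance_decoder k (search k (X k)) (D k)" using XD k by auto
      have "a * P / (2 powr (R / real n) * C\<^sub>L) \<le> (scale k)\<^sup>2"
        unfolding scale_def using assms(17) k
        by (intro code_scale_squared_lower_bound n kpos[OF k] vol[OF k] \<open>P > 0\<close> \<open>C\<^sub>L > 0\<close> a(1) root) auto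
      then have "a * P / (2 powr (R / real n) * C\<^sub>L) * (real n * 2 powr (c / real n)) \<le>
          (scale k)\<^sup>2 * (real n * 2 powr (c / real n))"
        by (rule mult_right_mono) simp
      then have margin: "4 * ((real n)\<^sup>2 + \<epsilon>) \<le> (scale k)\<^sup>2 * real n * 2 powr (c / real n)"
        unfolding \<epsilon>(2) by (simp only: mult.assoc)
      show "error_prob M H k (?code k (X k)) (D k) \<le> C\<^sub>4 / (real k * \<epsilon>\<^sup>2) + measure M (space M - G k)"
      proof (rule error_prob_le[OF assms(5) code(1)[OF k adm] code(2)[OF k adm] good(1)])
        show "0 \<le> C\<^sub>4 / (real k * \<epsilon>\<^sup>2)" using C4 by simp
        fix X' \<omega> assume X': "X' \<in> ?code k (X k)" and \<omega>: "\<omega> \<in> G k"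
        show "measure (noise k) {w \<in> space (noise k).
            D k (channel_state k H \<omega>, channel_output k (channel_state k H \<omega>) X' w) \<noteq> X'}
          \<le> C\<^sub>4 / (real k * \<epsilon>\<^sup>2)"
          unfolding C\<^sub>4_def
        proof (rule decoder_slice_bound[OF kpos[OF k] basis[OF k] _ D _ search(2) scale[OF k] _ _ _ \<epsilon>(1)])
          show "det_min k (L k) = 1" using assms(16) k by blast
          show "X' \<in> search k (X k)" using X' search(1) by blast
          show "channel_state k H \<omega> \<in> extensional {1..k}" by (simp add: channel_state_def)
          show "gram_det 1 (channel_state k H \<omega> i) > 0" if "i \<in> {1..k}" for i
            using \<omega> that by (simp add: G_def channel_state_def)
          show "c * real k \<le> (\<Sum>i=1..k. log 2 (gram_det 1 (channel_state k H \<omega> i)))"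
            using \<omega> by (simp add: G_def channel_state_def)
          show "4 * ((real CARD('n))\<^sup>2 + \<epsilon>) \<le> (scale k)\<^sup>2 * real CARD('n) * 2 powr (c / real CARD('n))"
            using margin by (simp add: n_def)
        qed
      qed
    qed
    show "((\<lambda>k. error_prob M H k (?code k (X k)) (D k)) \<longlongrightarrow> 0) (inf sequentially (principal K))"
    proof (rule tendsto_sandwich[OF _ _ tendsto_const])
      show "eventually (\<lambda>k. 0 \<le> error_prob M H k (?code k (X k)) (D k)) (inf sequentially (principal K))"
        by (simp add: error_prob_def Let_def)
      show "eventually (\<lambda>k. error_prob M H k (?code k (X k)) (D k) \<le>
          C\<^sub>4 / (real k * \<epsilon>\<^sup>2) + measure M (space M - G k)) (inf sequentially (principal K))"
        using err unfolding eventually_inf_principal .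
      show "((\<lambda>k. C\<^sub>4 / (real k * \<epsilon>\<^sup>2) + measure M (space M - G k)) \<longlongrightarrow> 0) (inf sequentially (principal K))"
        by (rule tendsto_mono[OF inf_le1 bound_lim])
    qed
  qed
  show ?thesis
    by (intro conjI achievable) (auto simp: lattice_code_def)
qed

end
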